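(* Let $p,q\in(1,\infty)$ and let $\sigma$ and $w$ be two Radon measures on $\mathbb{R}^N$ satisfying the quadratic $\mathscr{A}_{p,q}$-condition, i.e. $[\sigma,w]_{p,q}<\infty$. Let $T^\sigma$ be a dyadic shift with complexity $\kappa$, and let $T^w$ be its formal adjoint. Then there exists a constant $C$ such that $$\|T^{\sigma}f\|_{L^{q}(w)}\le C\|f\|_{L^{p}(\sigma)}\qquad\text{for all } f\in L^p(\sigma) \tag{1}$$ if and only if there exist constants $C'$ and $C''$ such that for all sequences $(Q_i)_{i=1}^\infty\subset\mathscr{D}$ of dyadic cubes and all sequences $(a_i)_{i=1}^\infty$ of real numbers $$\Big\|\Big(\sum_{i=1}^\infty (a_i1_{Q_i}T^\sigma 1_{Q_i})^2\Big)^{1/2}\Big\|_{L^q(w)}\le C'\Big\|\Big(\sum_{i=1}^\infty a_i^21_{Q_i}\Big)^{1/2}\Big\|_{L^p(\sigma)} \tag{2}$$ and $$\Big\|\Big(\sum_{i=1}^\infty (a_i1_{Q_i}T^w 1_{Q_i})^2\Big)^{1/2}\Big\|_{L^{p'}(\sigma)}\le C''\Big\|\Big(\sum_{i=1}^\infty a_i^21_{Q_i}\Big)^{1/2}\Big\|_{L^{q'}(w)}. \tag{3}$$ Moreover, if $\mathcal{T}^\sigma$ and $\mathcal{T}^w$ denote the best possible constants in (2) and (3), respectively, then the best constant $\|T\|$ in (1) satisfies $$\|T\|\lesssim (1+\kappa)(\mathcal{T}^\sigma+\mathcal{T}^w)+(1+\kappa)^2[\sigma,w]_{p,q},$$ where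 the implicit constant depends only on $p$, $q$ and $N$.
   Context: All functions are real valued; $p',q'$ are the Hölder conjugate exponents of $p,q$. Dyadic lattice. A dyadic lattice $\mathscr{D}=\bigcup_{k\in\mathbb{Z}}\mathscr{D}_k$ on $\mathbb{R}^N$ is fixed: each $\mathscr{D}_k$ is a disjoint cover of $\mathbb{R}^N$ by cubes of the form $x+[0,2^{-k})^N$, and every cube in $\mathscr{D}_k$ is a union of $2^N$ cubes of $\mathscr{D}_{k+1}$ (its dyadic children). $|Q|$ is the Lebesgue measure of $Q$. For $Q\in\mathscr{D}_k$, $Q^{(0)}=Q$, and for $r\ge1$, $Q^{(r)}$ is the unique cube in $\mathscr{D}_{k-r}$ containing $Q$. Haar functions. For an interval $I\subset\mathbb{R}$, $h_I^0:=|I|^{-1/2}1_I$ and $h_I^1:=|I|^{-1/2}(1_{I_l}-1_{I_r})$, with $I_l,I_r$ the left and right halves of $I$. For a cube $Q=I_1\times\dots\times I_N\in\mathscr{D}$ and $\eta\in\{0,1\}^N$, $h_Q^\eta(x):=\prod_{i=1}^N h_{I_i}^{\eta_i}(x_i)$. Any of the functions $h_Q^\eta$, $\eta\in\{0,1\}^N$, is called a Haar function related to $Q$. Dyadic shifts. Write $\langle f,g\rangle_\mu=\int fg\,d\mu$. Fix integers $m,n\ge0$. A dyadic shift with parameters $(m,n)$ is an operator $T^\sigma f=\sum_{K\in\mathscr{D}}A_K^\sigma f$, $f\in L^1_{loc}(\sigma)$, where $$A_K^\sigma f=\sum_{I,J\in\mathscr{D}:\ I^{(m)}=J^{(n)}=K}a_{IJK}\langle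 f,h_I^J\rangle_\sigma h_J^I,$$ $h_I^J$ is some Haar function related to the cube $I$, $h_J^I$ is some Haar function related to the cube $J$ (arbitrary choices, which may depend on the pair $(I,J)$), $a_{IJK}\in\mathbb{R}$ satisfy $|a_{IJK}|\le \sqrt{|I||J|}/|K|$, and only finitely many $K\in\mathscr{D}$ have some non-zero coefficient $a_{IJK}$. Its formal adjoint is $T^w g=\sum_K A_K^w g$, $g\in L^1_{loc}(w)$, with $A_K^wg=\sum_{I^{(m)}=J^{(n)}=K}a_{IJK}\langle g,h_J^I\rangle_w h_I^J$. The complexity of the shift is $\max\{m,n\}$. Quadratic $\mathscr{A}_{p,q}$-condition. $[\sigma,w]_{p,q}\in[0,\infty]$ is the best constant such that for every collection $\{a_Q\}_{Q\in\mathscr{D}}\subset\mathbb{R}$ $$\Big\|\Big(\sum_{Q\in\mathscr{D}}\Big(a_Q\frac{\sigma(Q)}{|Q|}\Big)^21_Q\Big)^{1/2}\Big\|_{L^q(w)}\le[\sigma,w]_{p,q}\Big\|\Big(\sum_{Q\in\mathscr{D}}a_Q^21_Q\Big)^{1/2}\Big\|_{L^p(\sigma)};$$ the condition holds if $[\sigma,w]_{p,q}<\infty$. *)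

theory Defs
  imports "HOL-Analysis.Analysis"
begin

definition radon_measure :: "(real ^ 'n) measure \<Rightarrow> bool" where
  "radon_measure \<mu> \<longleftrightarrow> sets \<mu> = sets borel \<and>
     (\<forall>K. compact K \<longrightarrow> emeasure \<mu> K < \<infinity>) \<and>
     (\<forall>B \<in> sets borel. emeasure \<mu> B = (SUP K \<in> {K. compact K \<and> K \<subseteq> B}. emeasure \<mu> K))"

definition holder_conj :: "real \<Rightarrow> real" where
  "holder_conj p = p / (p - 1)"

(* Only used with exponents a > 0. *)
definition epowr :: "ennreal \<Rightarrow> real \<Rightarrow> ennreal" where
  "epowr x a = (if x = \<infinity> then \<infinity> else ennreal (enn2real x powr a))"

(* Norms are taken of [0,\<infinity>]-valued functions, since square functions may be infinite;
   a real function f enters through |f|. *)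
definition Lp_norm :: "'a measure \<Rightarrow> real \<Rightarrow> ('a \<Rightarrow> ennreal) \<Rightarrow> ennreal" where
  "Lp_norm \<mu> p F = epowr (\<integral>\<^sup>+ x. epowr (F x) p \<partial>\<mu>) (1 / p)"

definition Lp_space :: "'a measure \<Rightarrow> real \<Rightarrow> ('a \<Rightarrow> real) set" where
  "Lp_space \<mu> p = {f \<in> borel_measurable \<mu>. Lp_norm \<mu> p (\<lambda>x. ennreal \<bar>f x\<bar>) < \<infinity>}"

definition pairing :: "'a measure \<Rightarrow> ('a \<Rightarrow> real) \<Rightarrow> ('a \<Rightarrow> real) \<Rightarrow> real" where
  "pairing \<mu> f g = (LINT x|\<mu>. f x * g x)"


definition cube_at :: "real ^ 'n \<Rightarrow> int \<Rightarrow> (real ^ 'n) set" where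
  "cube_at x k = {y. \<forall>i. x $ i \<le> y $ i \<and> y $ i < x $ i + 2 powi (- k)}"

definition dyadic_lattice :: "(int \<Rightarrow> (real ^ 'n) set set) \<Rightarrow> bool" where
  "dyadic_lattice D \<longleftrightarrow>
     (\<forall>k. partition_on UNIV (D k) \<and>
          (\<forall>Q \<in> D k. \<exists>x. Q = cube_at x k) \<and>
          (\<forall>Q \<in> D k. \<exists>\<C> \<subseteq> D (k + 1). card \<C> = 2 ^ CARD('n) \<and> Q = \<Union>\<C>))"

definition dyadic_cubes :: "(int \<Rightarrow> (real ^ 'n) set set) \<Rightarrow> (real ^ 'n) set set" where
  "dyadic_cubes D = (\<Union>k. D k)"

(* The side length of Q determines its generation k, so this is well defined on a lattice. *)
definition ancestor :: "(int \<Rightarrow> (real ^ 'n) set set) \<Rightarrow> nat \<Rightarrow> (real ^ 'n) set \<Rightarrow> (real ^ 'n) set" where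
  "ancestor D r Q = (THE R. \<exists>k. Q \<in> D k \<and> R \<in> D (k - int r) \<and> Q \<subseteq> R)"

abbreviation vol :: "(real ^ 'n) set \<Rightarrow> real" where
  "vol Q \<equiv> measure lborel Q"


definition left_half :: "real set \<Rightarrow> real set" where
  "left_half I = {t \<in> I. t < (Inf I + Sup I) / 2}"

definition right_half :: "real set \<Rightarrow> real set" where
  "right_half I = {t \<in> I. (Inf I + Sup I) / 2 \<le> t}"

(* The Boolean superscript encodes {0,1}: False is h^0, True is h^1. *)
definition haar_interval :: "bool \<Rightarrow> real set \<Rightarrow> real \<Rightarrow> real" where
  "haar_interval e I t = measure lborel I powr (- (1 / 2)) *
     (if e then indicator (left_half I) t - indicator (right_half I) t else indicator I t)"

definition side :: "(real ^ 'n) set \<Rightarrow> 'n \<Rightarrow> real set" where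
  "side Q i = (\<lambda>y. y $ i) ` Q"

definition haar :: "('n \<Rightarrow> bool) \<Rightarrow> (real ^ 'n) set \<Rightarrow> real ^ 'n \<Rightarrow> real" where
  "haar \<eta> Q x = (\<Prod>i\<in>UNIV. haar_interval (\<eta> i) (side Q i) (x $ i))"

definition haar_functions :: "(real ^ 'n) set \<Rightarrow> (real ^ 'n \<Rightarrow> real) set" where
  "haar_functions Q = {haar \<eta> Q | \<eta>. True}"


(* g I J and h I J are the Haar functions h_I^J (related to I) and h_J^I (related to J). *)
definition dyadic_shift ::
  "(int \<Rightarrow> (real ^ 'n) set set) \<Rightarrow> nat \<Rightarrow> nat \<Rightarrow>
   ((real ^ 'n) set \<Rightarrow> (real ^ 'n) set \<Rightarrow> (real ^ 'n) set \<Rightarrow> real) \<Rightarrow>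
   ((real ^ 'n) set \<Rightarrow> (real ^ 'n) set \<Rightarrow> real ^ 'n \<Rightarrow> real) \<Rightarrow>
   ((real ^ 'n) set \<Rightarrow> (real ^ 'n) set \<Rightarrow> real ^ 'n \<Rightarrow> real) \<Rightarrow> bool" where
  "dyadic_shift D m n a g h \<longleftrightarrow>
     (\<forall>I \<in> dyadic_cubes D. \<forall>J \<in> dyadic_cubes D. \<forall>K \<in> dyadic_cubes D.
        ancestor D m I = K \<and> ancestor D n J = K \<longrightarrow>
          g I J \<in> haar_functions I \<and> h I J \<in> haar_functions J \<and>
          \<bar>a I J K\<bar> \<le> sqrt (vol I * vol J) / vol K) \<and>
     finite {K \<in> dyadic_cubes D. \<exists>I \<in> dyadic_cubes D. \<exists>J \<in> dyadic_cubes D.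
        ancestor D m I = K \<and> ancestor D n J = K \<and> a I J K \<noteq> 0}"

definition shift_block ::
  "(int \<Rightarrow> (real ^ 'n) set set) \<Rightarrow> nat \<Rightarrow> nat \<Rightarrow>
   ((real ^ 'n) set \<Rightarrow> (real ^ 'n) set \<Rightarrow> (real ^ 'n) set \<Rightarrow> real) \<Rightarrow>
   ((real ^ 'n) set \<Rightarrow> (real ^ 'n) set \<Rightarrow> real ^ 'n \<Rightarrow> real) \<Rightarrow>
   ((real ^ 'n) set \<Rightarrow> (real ^ 'n) set \<Rightarrow> real ^ 'n \<Rightarrow> real) \<Rightarrow>
   (real ^ 'n) measure \<Rightarrow> (real ^ 'n) set \<Rightarrow> (real ^ 'n \<Rightarrow> real) \<Rightarrow> real ^ 'n \<Rightarrow> real" where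
  "shift_block D m n a g h \<sigma> K f x =
     (\<Sum>(I, J) \<in> {(I, J). I \<in> dyadic_cubes D \<and> J \<in> dyadic_cubes D \<and>
                        ancestor D m I = K \<and> ancestor D n J = K}.
        a I J K * pairing \<sigma> f (g I J) * h I J x)"

(* Pointwise, only finitely many terms are non-zero when dyadic_shift holds. *)
definition shift_op ::
  "(int \<Rightarrow> (real ^ 'n) set set) \<Rightarrow> nat \<Rightarrow> nat \<Rightarrow>
   ((real ^ 'n) set \<Rightarrow> (real ^ 'n) set \<Rightarrow> (real ^ 'n) set \<Rightarrow> real) \<Rightarrow>
   ((real ^ 'n) set \<Rightarrow> (real ^ 'n) set \<Rightarrow> real ^ 'n \<Rightarrow> real) \<Rightarrow>
   ((real ^ 'n) set \<Rightarrow> (real ^ 'n) set \<Rightarrow> real ^ 'n \<Rightarrow> real) \<Rightarrow>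
   (real ^ 'n) measure \<Rightarrow> (real ^ 'n \<Rightarrow> real) \<Rightarrow> real ^ 'n \<Rightarrow> real" where
  "shift_op D m n a g h \<sigma> f x =
     (\<Sum>\<^sub>\<infinity>K \<in> dyadic_cubes D. shift_block D m n a g h \<sigma> K f x)"

definition adjoint_block ::
  "(int \<Rightarrow> (real ^ 'n) set set) \<Rightarrow> nat \<Rightarrow> nat \<Rightarrow>
   ((real ^ 'n) set \<Rightarrow> (real ^ 'n) set \<Rightarrow> (real ^ 'n) set \<Rightarrow> real) \<Rightarrow>
   ((real ^ 'n) set \<Rightarrow> (real ^ 'n) set \<Rightarrow> real ^ 'n \<Rightarrow> real) \<Rightarrow>
   ((real ^ 'n) set \<Rightarrow> (real ^ 'n) set \<Rightarrow> real ^ 'n \<Rightarrow> real) \<Rightarrow>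
   (real ^ 'n) measure \<Rightarrow> (real ^ 'n) set \<Rightarrow> (real ^ 'n \<Rightarrow> real) \<Rightarrow> real ^ 'n \<Rightarrow> real" where
  "adjoint_block D m n a g h w K \<phi> x =
     (\<Sum>(I, J) \<in> {(I, J). I \<in> dyadic_cubes D \<and> J \<in> dyadic_cubes D \<and>
                        ancestor D m I = K \<and> ancestor D n J = K}.
        a I J K * pairing w \<phi> (h I J) * g I J x)"

definition adjoint_op ::
  "(int \<Rightarrow> (real ^ 'n) set set) \<Rightarrow> nat \<Rightarrow> nat \<Rightarrow>
   ((real ^ 'n) set \<Rightarrow> (real ^ 'n) set \<Rightarrow> (real ^ 'n) set \<Rightarrow> real) \<Rightarrow>
   ((real ^ 'n) set \<Rightarrow> (real ^ 'n) set \<Rightarrow> real ^ 'n \<Rightarrow> real) \<Rightarrow>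
   ((real ^ 'n) set \<Rightarrow> (real ^ 'n) set \<Rightarrow> real ^ 'n \<Rightarrow> real) \<Rightarrow>
   (real ^ 'n) measure \<Rightarrow> (real ^ 'n \<Rightarrow> real) \<Rightarrow> real ^ 'n \<Rightarrow> real" where
  "adjoint_op D m n a g h w \<phi> x =
     (\<Sum>\<^sub>\<infinity>K \<in> dyadic_cubes D. adjoint_block D m n a g h w K \<phi> x)"


definition quadratic_Apq_bound ::
  "(int \<Rightarrow> (real ^ 'n) set set) \<Rightarrow> real \<Rightarrow> real \<Rightarrow>
   (real ^ 'n) measure \<Rightarrow> (real ^ 'n) measure \<Rightarrow> ennreal \<Rightarrow> bool" where
  "quadratic_Apq_bound D p q \<sigma> w C \<longleftrightarrow>
     (\<forall>a :: (real ^ 'n) set \<Rightarrow> real.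
        Lp_norm w q (\<lambda>x. epowr (\<Sum>\<^sub>\<infinity>Q \<in> dyadic_cubes D.
          ennreal ((a Q * (measure \<sigma> Q / vol Q))\<^sup>2 * indicator Q x)) (1 / 2))
        \<le> C * Lp_norm \<sigma> p (\<lambda>x. epowr (\<Sum>\<^sub>\<infinity>Q \<in> dyadic_cubes D.
          ennreal ((a Q)\<^sup>2 * indicator Q x)) (1 / 2)))"

(* Best constants are infima in [0,\<infinity>], so they equal \<infinity> if there is no finite constant. *)
definition quadratic_Apq ::
  "(int \<Rightarrow> (real ^ 'n) set set) \<Rightarrow> real \<Rightarrow> real \<Rightarrow>
   (real ^ 'n) measure \<Rightarrow> (real ^ 'n) measure \<Rightarrow> ennreal" where
  "quadratic_Apq D p q \<sigma> w = Inf {C. quadratic_Apq_bound D p q \<sigma> w C}"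

definition norm_bound ::
  "real \<Rightarrow> real \<Rightarrow> 'a measure \<Rightarrow> 'a measure \<Rightarrow>
   (('a \<Rightarrow> real) \<Rightarrow> 'a \<Rightarrow> real) \<Rightarrow> ennreal \<Rightarrow> bool" where
  "norm_bound p q \<sigma> w T C \<longleftrightarrow>
     (\<forall>f \<in> Lp_space \<sigma> p.
        Lp_norm w q (\<lambda>x. ennreal \<bar>T f x\<bar>) \<le> C * Lp_norm \<sigma> p (\<lambda>x. ennreal \<bar>f x\<bar>))"

definition best_norm ::
  "real \<Rightarrow> real \<Rightarrow> 'a measure \<Rightarrow> 'a measure \<Rightarrow>
   (('a \<Rightarrow> real) \<Rightarrow> 'a \<Rightarrow> real) \<Rightarrow> ennreal" where
  "best_norm p q \<sigma> w T = Inf {C. norm_bound p q \<sigma> w T C}"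

definition testing_bound ::
  "(int \<Rightarrow> (real ^ 'n) set set) \<Rightarrow> real \<Rightarrow> real \<Rightarrow>
   (real ^ 'n) measure \<Rightarrow> (real ^ 'n) measure \<Rightarrow>
   ((real ^ 'n \<Rightarrow> real) \<Rightarrow> real ^ 'n \<Rightarrow> real) \<Rightarrow> ennreal \<Rightarrow> bool" where
  "testing_bound D p q \<sigma> w T C \<longleftrightarrow>
     (\<forall>(Q :: nat \<Rightarrow> (real ^ 'n) set) (a :: nat \<Rightarrow> real). (\<forall>i. Q i \<in> dyadic_cubes D) \<longrightarrow>
        Lp_norm w q (\<lambda>x. epowr (\<Sum>i.
          ennreal ((a i * indicator (Q i) x * T (indicator (Q i)) x)\<^sup>2)) (1 / 2))
        \<le> C * Lp_norm \<sigma> p (\<lambda>x. epowr (\<Sum>i.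
          ennreal ((a i)\<^sup>2 * indicator (Q i) x)) (1 / 2)))"

definition best_testing ::
  "(int \<Rightarrow> (real ^ 'n) set set) \<Rightarrow> real \<Rightarrow> real \<Rightarrow>
   (real ^ 'n) measure \<Rightarrow> (real ^ 'n) measure \<Rightarrow>
   ((real ^ 'n \<Rightarrow> real) \<Rightarrow> real ^ 'n \<Rightarrow> real) \<Rightarrow> ennreal" where
  "best_testing D p q \<sigma> w T = Inf {C. testing_bound D p q \<sigma> w T C}"

end

theory Submission
  imports Defs
begin

text \<open>
A dyadic shift has only finitely many active cubes \<open>K\<close>, and the kernel of \<open>A\<^sub>K\<close> is bounded by
\<open>1 / |K|\<close> on \<open>K \<times> K\<close>. Hence the norm inequality and both testing inequalities always hold with some
finite constant (\<open>testing_finite\<close> for the latter), and the equivalence follows. The substance is the quantitative estimate,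
in which the constant may not depend on the number of active cubes.

Reduction to a finite set. The kernel of \<open>A\<^sub>K\<close> is constant on products of cubes that lie \<open>r = \<kappa> + 1\<close>
generations below \<open>K\<close>. So the bilinear form \<open>\<langle>T f, g\<rangle>\<close> sees \<open>f\<close> and \<open>g\<close> only through their averages over the
cubes (atoms) of one fine generation inside a bounded region. Every atom is replaced by a representative
point; both measures become weights on a finite set, and the generations become a filtration of that set.
The quadratic condition and the testing conditions pass to the finite set with the same constants.

The estimate on the finite set. Let \<open>f\<^sub>k\<close> and \<open>g\<^sub>k\<close> be the averages at level \<open>k\<close> with respect to \<open>\<sigma>\<close> and \<open>w\<close>, with
\<open>f\<^sub>0 = g\<^sub>0 = 0\<close>, and let \<open>d\<^sub>k\<close>, \<open>e\<^sub>k\<close> be their increments. The part \<open>B\<^sub>k\<close> of the form that comes from the cubes of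
level \<open>k\<close> sees only \<open>f\<^sub>k\<^sub>+\<^sub>r\<close> and \<open>g\<^sub>k\<^sub>+\<^sub>r\<close>, hence is a double sum of terms \<open>B\<^sub>k (d\<^sub>s, e\<^sub>l)\<close> with \<open>s, l \<le> k + r\<close>. They
are of three kinds.

 \<^item> Pairs with \<open>|s - l| \<le> r\<close>, which form \<open>2 r + 1\<close> diagonals. If one of the two levels exceeds \<open>k\<close>, the size of the
   kernel and the quadratic condition suffice. If both levels are at most \<open>k\<close>, then \<open>d\<^sub>s\<close> and \<open>e\<^sub>l\<close> are constant on
   the cubes of level \<open>k\<close>, and the sum over \<open>k\<close> produces the shift, truncated to the subcubes of a cube, applied to
   the indicator of that cube: this is controlled by testing. On each diagonal the first case splits
   into \<open>r\<close> sums and the second is a single one, whence the powers of \<open>1 + \<kappa>\<close>.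
 \<^item> Pairs with \<open>s < l - r\<close>, whose sum over \<open>s\<close> is the paraproduct with terms \<open>B\<^sub>k (f\<^sub>l\<^sub>-\<^sub>1\<^sub>-\<^sub>r, e\<^sub>l)\<close>. The average
   \<open>f\<^sub>l\<^sub>-\<^sub>1\<^sub>-\<^sub>r\<close> is compared with the average over the last stopping cube, where stopping means that the average
   of \<open>|f|\<close> has doubled; testing is applied to the stopping cubes, and the maximal function sums their averages.
 \<^item> Pairs with \<open>l < s - r\<close>, which are the same for the adjoint. The adjoint satisfies the quadratic condition by duality
   (\<open>dual_apq\<close>).

The martingale tools hold with constants that depend on the exponent alone: the maximal inequality of Doob, the
inequality of Stein for sequences of averages, and bounds for vector-valued martingale transforms (\<open>martingale_transform\<close>),
which contain the square function estimate and also the estimate for the stopped paraproduct. The bounds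
for transforms are dual to a bilinear inequality (\<open>bilinear_embedding\<close>), which is proved by inserting powers of the
maximal function as weights.
\<close>

section \<open>Inequalities for powers\<close>

text \<open>
Comparing \<open>b\<close> with \<open>A a\<close> bounds a mixed product by pure powers, and a large \<open>A\<close> makes the
second coefficient small. This allows a power to be absorbed into the left-hand side of an estimate.
\<close>
lemma powr_split_le:
  fixes a b t u A :: real
  assumes "0 \<le> a" "0 \<le> b" "0 < t" "0 \<le> u" "0 < A"
  shows "a powr t * b powr u \<le> A powr u * a powr (t + u) + b powr (t + u) / A powr t"
proof (cases "b \<le> A * a")
  case True
  have "a powr t * b powr u \<le> a powr t * (A * a) powr u"
    using assms True by (intro mult_left_mono powr_mono2) auto
  also have "\<dots> = A powr u * a powr (t + u)"
    using assms by (simp add: powr_mult powr_add)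
  finally show ?thesis using assms by (simp add: add_increasing2)
next
  case False
  then have "a \<le> b / A" using assms by (simp add: field_simps)
  then have "a powr t * b powr u \<le> (b / A) powr t * b powr u"
    using assms by (intro mult_right_mono powr_mono2) auto
  also have "\<dots> = b powr (t + u) / A powr t"
    using assms by (simp add: powr_divide powr_add)
  finally show ?thesis using assms by (simp add: add_increasing)
qed

text \<open>
Strong convexity of the power function: the second derivative \<open>s (s - 1) t powr (s - 2)\<close> does not increase with \<open>t\<close>,
hence smallest at the larger end point.
\<close>
lemma powr_taylor_lower:
  fixes A B s :: real
  assumes "1 < s" "s \<le> 2" "0 \<le> A" "0 \<le> B"
  shows "A powr s + s * A powr (s - 1) * (B - A) + s * (s - 1) / 2 * (B - A)\<^sup>2 * max A B powr (s - 2)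
    \<le> B powr s"
proof -
  consider "A = 0" | "B = 0" "A > 0" | "A = B" | "A > 0" "B > 0" "A \<noteq> B" using assms by linarith
  then show ?thesis
  proof cases
    case 1
    have "s * (s - 1) / 2 \<le> 1" using assms mult_mono[of s 2 "s-1" 1] by simp
    moreover have "B\<^sup>2 * B powr (s - 2) = B powr s"
      using assms powr_add[of B 2 "s-2"] by (cases "B = 0") (auto simp: powr_numeral)
    ultimately show ?thesis using 1 assms mult_right_mono[of "s * (s - 1) / 2" 1 "B powr s"]
      by (simp add: max_def mult.assoc)
  next
    case 2
    have e: "A\<^sup>2 * A powr (s - 2) = A powr s" "A powr (s-1) * A = A powr s"
      using 2 powr_add[of A 2 "s-2"] powr_add[of A "s-1" 1] by (auto simp: powr_numeral)
    have "(s - 1) * (s/2) \<le> (s - 1) * 1" using assms by (intro mult_left_mono) auto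
    then have "A powr s * (1 - s + s * (s - 1)/2) \<le> 0"
      using assms by (intro mult_nonneg_nonpos) (auto simp: field_simps)
    then show ?thesis using 2 e assms by (simp add: max_def algebra_simps flip: e(2))
  next
    case 3 then show ?thesis by simp
  next
    case 4
    define diff where "diff = (\<lambda>(n::nat) x::real. if n = 0 then x powr s else if n = 1 then s * x powr (s-1) else s*(s-1)* x powr (s-2))"
    have d: "\<forall>m t. m < 2 \<and> min A B \<le> t \<and> t \<le> max A B \<longrightarrow> (diff m has_real_derivative diff (Suc m) t) (at t)"
    proof (intro allI impI)
      fix m t assume h: "m < (2::nat) \<and> min A B \<le> t \<and> t \<le> max A B"
      then have t: "t > 0" using 4 by auto
      have "s - 2 = s - 1 - 1" by simp
      then show "(diff m has_real_derivative diff (Suc m) t) (at t)"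
        using t h by (cases "m = 0") (auto simp: diff_def less_2_cases_iff intro!: derivative_eq_intros)
    qed
    obtain t where t: "if B < A then B < t \<and> t < A else A < t \<and> t < B"
      and e: "diff 0 B = (\<Sum>m<2. (diff m A / fact m) * (B - A)^m) + (diff 2 t / fact 2) * (B - A)^2"
      using Taylor[of 2 diff "diff 0" "min A B" "max A B" A B, OF _ refl d] 4 by auto
    have "t \<le> max A B" "t > 0" using t 4 by (auto split: if_splits)
    then have "max A B powr (s-2) \<le> t powr (s-2)" using assms by (intro powr_mono2') auto
    then have "s * (s - 1) / 2 * (B - A)\<^sup>2 * max A B powr (s - 2) \<le> s * (s - 1) / 2 * (B - A)\<^sup>2 * t powr (s - 2)"
      using assms by (intro mult_left_mono) auto
    then show ?thesis using e by (simp add: diff_def numeral_2_eq_2 mult_ac)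
  qed
qed

lemma powr_tangent_le:
  fixes a b p :: real
  assumes "1 \<le> p" "0 \<le> a" "0 \<le> b"
  shows "a powr p + p * a powr (p - 1) * (b - a) \<le> b powr p"
proof -
  consider "a = 0" | "b = 0" "a > 0" | "a > 0" "b > 0" using assms by linarith
  then show ?thesis
  proof cases
    case 2
    have "a powr (p-1) * a = a powr p" using 2 powr_add[of a "p-1" 1] by auto
    moreover have "a powr p \<le> p * a powr p" using assms 2 by (simp add: mult_le_cancel_right1)
    ultimately show ?thesis using 2 by (simp add: algebra_simps)
  next
    case 3
    have "p * a powr (p-1) * (b - a) \<le> b powr p - a powr p"
    proof (rule convex_on_imp_above_tangent[where A="{0<..}" and f="\<lambda>x. x powr p"])
      show "convex_on {0<..} (\<lambda>x. x powr p)" using assms(1) by (rule powr_convex)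
      show "((\<lambda>x. x powr p) has_real_derivative p * a powr (p-1)) (at a within {0<..})"
        using 3 by (auto intro!: derivative_eq_intros)
    qed (use 3 in \<open>auto simp: connected_contains_Icc interior_open\<close>)
    then show ?thesis by simp
  qed (use assms in auto)
qed

text \<open>
The discrete form of \<open>d (t\<^sup>p) = p / (p - 1) \<cdot> t \<cdot> d (t\<^sup>p\<^sup>-\<^sup>1)\<close>: the tangent inequality, rearranged.
\<close>
lemma powr_increment_le:
  fixes a b p :: real
  assumes "1 < p" "0 \<le> a" "0 \<le> b"
  shows "b powr p - a powr p \<le> p / (p - 1) * b * (b powr (p - 1) - a powr (p - 1))"
proof -
  have e: "x powr (p-1) * x = x powr p" if "0 \<le> x" for x :: real
    using that powr_add[of x "p-1" 1] by auto
  have "a powr p + p * a powr (p - 1) * (b - a) \<le> b powr p"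
    using assms by (intro powr_tangent_le) auto
  then have "(p - 1) * (b powr p - a powr p) \<le> p * b * (b powr (p - 1) - a powr (p - 1))"
    unfolding e[OF assms(2), symmetric] e[OF assms(3), symmetric] by (simp add: algebra_simps)
  then show ?thesis using assms by (simp add: field_simps)
qed

text \<open>
The vector-valued form of strong convexity: \<open>A\<close> and \<open>B\<close> are the lengths of two vectors and \<open>c\<close> is their inner product,
so that \<open>A\<^sup>2 + B\<^sup>2 - 2 c\<close> is the squared distance. The left-hand side increases with \<open>c\<close>, so parallel vectors are the
worst case, and for them the inequality is the scalar one.
\<close>
lemma powr_inner_taylor_lower:
  fixes A B c s :: real
  assumes s: "1 < s" "s \<le> 2" and AB: "0 \<le> A" "0 \<le> B" and c: "\<bar>c\<bar> \<le> A * B"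
  shows "A powr s + s * A powr (s - 2) * (c - A\<^sup>2) +
     s * (s - 1) / 2 * (A\<^sup>2 + B\<^sup>2 - 2 * c) * max A B powr (s - 2) \<le> B powr s"
proof (cases "A = 0")
  case True
  then show ?thesis using powr_taylor_lower[OF s AB] c by simp
next
  case False
  then have A: "A > 0" using AB by simp
  define k where "k = s * A powr (s - 2) - s * (s - 1) * max A B powr (s - 2)"
  have "max A B powr (s-2) \<le> A powr (s-2)" using A s by (intro powr_mono2') auto
  then have "(s - 1) * max A B powr (s-2) \<le> 1 * A powr (s-2)" using s by (intro mult_mono) auto
  then have "k \<ge> 0" using s unfolding k_def by (simp add: mult.assoc mult_left_mono)
  then have "k * c \<le> k * (A * B)" using c by (intro mult_left_mono) auto
  moreover have "A powr (s - 1) = A powr (s-2) * A" using A powr_add[of A "s-2" 1] by auto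
  ultimately have a: "s * A powr (s-1) * (B - A) \<ge> s * A powr (s - 2) * (c - A\<^sup>2) + s * (s - 1) / 2 * (2 * A * B - 2 * c) * max A B powr (s - 2)"
    by (simp add: k_def field_simps power2_eq_square)
  have "(A\<^sup>2 + B\<^sup>2 - 2 * c) = (B - A)\<^sup>2 + (2 * A * B - 2 * c)" by (simp add: power2_eq_square algebra_simps)
  then show ?thesis using powr_taylor_lower[OF s AB] a
    by (simp only: distrib_left distrib_right)
qed

text \<open>
Whichever of \<open>a\<close> and \<open>b powr (p - 1)\<close> is smaller is replaced by the larger one; the exponents are such that
the result is a pure power.
\<close>
lemma powr_conj_split_le:
  fixes a b p :: real
  assumes "1 < p" "p \<le> 2" "0 \<le> a" "0 \<le> b"
  shows "a\<^sup>2 * b powr (2 - p) \<le> a powr (p / (p - 1)) + b powr p"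
proof (cases "a = 0 \<or> b = 0")
  case True then show ?thesis by auto
next
  case False
  then have ab: "a > 0" "b > 0" using assms by auto
  have a2: "a\<^sup>2 = a powr 2" using ab by (simp add: powr_numeral)
  show ?thesis
  proof (cases "a \<le> b powr (p - 1)")
    case True
    have "a powr 2 * b powr (2 - p) \<le> (b powr (p-1)) powr 2 * b powr (2-p)"
      using True ab by (intro mult_right_mono powr_mono2) auto
    also have "\<dots> = b powr p" by (simp add: powr_powr algebra_simps flip: powr_add)
    finally show ?thesis using a2 by (simp add: add_increasing)
  next
    case False
    then have "(b powr (p-1)) powr (1/(p-1)) \<le> a powr (1/(p-1))"
      using ab assms by (intro powr_mono2) auto
    then have "b \<le> a powr (1/(p-1))" using ab assms by (simp add: powr_powr)
    then have "a powr 2 * b powr (2 - p) \<le> a powr 2 * (a powr (1/(p-1))) powr (2-p)"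
      using ab assms by (intro mult_left_mono powr_mono2) auto
    also have "\<dots> = a powr (2 + (2-p)/(p-1))" by (simp add: powr_powr powr_add)
    also have "2 + (2-p)/(p-1) = p/(p-1)" using assms by (simp add: field_simps)
    finally show ?thesis using a2 by (simp add: add_increasing2)
  qed
qed

lemma L2_powr: "L2_set f A powr p = (\<Sum>i\<in>A. (f i)\<^sup>2) powr (p / 2)"
  by (simp add: L2_set_def powr_half_sqrt[symmetric] sum_nonneg powr_powr)

lemma L2_set_square: "(L2_set f A)\<^sup>2 = (\<Sum>i\<in>A. (f i)\<^sup>2)"
  by (simp add: L2_set_def sum_nonneg)

text \<open>
The family \<open>f k |f| powr (p - 2)\<close> linearises the \<open>p\<close>-th power of the length \<open>|f|\<close> of \<open>f\<close>, and it is extremal in the duality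
between the exponents \<open>p\<close> and \<open>p / (p - 1)\<close>. The convention \<open>0 powr x = 0\<close> makes both identities hold for \<open>f = 0\<close>.
\<close>
lemma L2_set_linearize:
  "(\<Sum>k\<in>A. f k * (f k * L2_set f A powr (p - 2))) = L2_set f A powr p"
  "L2_set (\<lambda>k. f k * L2_set f A powr (p - 2)) A = L2_set f A powr (p - 1)"
proof -
  define G where "G = L2_set f A"
  have G0: "0 \<le> G" by (simp add: G_def)
  have "(\<Sum>k\<in>A. f k * (f k * G powr (p - 2))) = (\<Sum>k\<in>A. (f k)\<^sup>2) * G powr (p - 2)"
    by (simp add: sum_distrib_right power2_eq_square mult.assoc)
  also have "(\<Sum>k\<in>A. (f k)\<^sup>2) = G\<^sup>2" by (simp add: G_def L2_set_def sum_nonneg)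
  also have "G\<^sup>2 * G powr (p - 2) = G powr p"
    using G0 powr_add[of G 2 "p - 2"] by (cases "G = 0") (auto simp: powr_numeral)
  finally show "(\<Sum>k\<in>A. f k * (f k * L2_set f A powr (p - 2))) = L2_set f A powr p" by (simp add: G_def)
  have "L2_set (\<lambda>k. f k * G powr (p - 2)) A = G * G powr (p - 2)"
    unfolding G_def by (subst L2_set_left_distrib) auto
  also have "\<dots> = G powr (p - 1)" using G0 powr_add[of G 1 "p - 2"] by auto
  finally show "L2_set (\<lambda>k. f k * L2_set f A powr (p - 2)) A = L2_set f A powr (p - 1)" by (simp add: G_def)
qed

section \<open>Averages and martingale differences on a finite filtered set\<close>

text \<open>
The constants below bound power sums; their \<open>1 / p\<close>-th powers bound norms.
\<close>
definition doob_const :: "real \<Rightarrow> real" where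
  "doob_const p = (2 * (p / (p - 1))) powr p"

text \<open>
In the application the points represent small cubes, and \<open>lab k x\<close> is the cube of the \<open>k\<close>-th generation around \<open>x\<close>. Arbitrary
labels keep the martingale arguments free of geometry.
\<close>
locale filtration =
  fixes X :: "'a set" and lab :: "nat \<Rightarrow> 'a \<Rightarrow> 'b"
  assumes finite_X: "finite X"
    and refine: "\<lbrakk>x \<in> X; y \<in> X; lab (Suc k) x = lab (Suc k) y\<rbrakk> \<Longrightarrow> lab k x = lab k y"
begin

definition cell :: "nat \<Rightarrow> 'a \<Rightarrow> 'a set" where
  "cell k x = {y \<in> X. lab k y = lab k x}"

definition cst :: "nat \<Rightarrow> ('a \<Rightarrow> real) \<Rightarrow> bool" where
  "cst k h \<longleftrightarrow> (\<forall>x\<in>X. \<forall>y\<in>X. lab k x = lab k y \<longrightarrow> h x = h y)"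

lemma cell_subset: "cell k x \<subseteq> X"
  by (auto simp: cell_def)

lemma finite_cell [simp]: "finite (cell k x)"
  using finite_X cell_subset by (rule rev_finite_subset)

lemma lab_antimono:
  assumes "j \<le> k" "x \<in> X" "y \<in> X" "lab k x = lab k y"
  shows "lab j x = lab j y"
  using assms(1) assms(4)
proof (induction k rule: dec_induct)
  case (step n)
  show ?case by (rule step.IH[OF refine[OF assms(2,3) step.prems]])
qed

lemma cstI: "(\<And>x y. x \<in> X \<Longrightarrow> y \<in> X \<Longrightarrow> lab k x = lab k y \<Longrightarrow> h x = h y) \<Longrightarrow> cst k h"
  unfolding cst_def by (intro ballI impI)

lemma cstD: "cst k h \<Longrightarrow> x \<in> X \<Longrightarrow> y \<in> X \<Longrightarrow> lab k x = lab k y \<Longrightarrow> h x = h y"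
  unfolding cst_def by (drule bspec, assumption, drule bspec, assumption, erule mp)

lemma cst_mono: "j \<le> k \<Longrightarrow> cst j h \<Longrightarrow> cst k h"
  by (rule cstI) (erule cstD, assumption+, rule lab_antimono)

lemma cst_const [intro]: "cst k (\<lambda>x. c)"
  by (rule cstI) (rule refl)

lemma cst_comp: "cst k h \<Longrightarrow> cst k (\<lambda>x. \<phi> (h x))"
  by (rule cstI, rule arg_cong[where f=\<phi>]) (rule cstD)

lemma cst_comp2: "cst k h \<Longrightarrow> cst k h' \<Longrightarrow> cst k (\<lambda>x. \<psi> (h x) (h' x))"
  by (rule cstI, rule arg_cong2[where f=\<psi>]) (rule cstD, assumption+)+

lemma cst_mult: "cst k h \<Longrightarrow> cst k h' \<Longrightarrow> cst k (\<lambda>x. h x * h' x)"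
  by (rule cst_comp2)

lemma cst_diff: "cst k h \<Longrightarrow> cst k h' \<Longrightarrow> cst k (\<lambda>x. h x - h' x)"
  by (rule cst_comp2)

lemma cst_sum: "(\<And>i. i \<in> A \<Longrightarrow> cst k (h i)) \<Longrightarrow> cst k (\<lambda>x. \<Sum>i\<in>A. h i x)"
  by (rule cstI, rule sum.cong[OF refl]) (rule cstD)

lemma cst_L2_set: "(\<And>i. i \<in> A \<Longrightarrow> cst k (h i)) \<Longrightarrow> cst k (\<lambda>x. L2_set (\<lambda>i. h i x) A)"
  by (rule cstI, rule L2_set_cong[OF refl]) (rule cstD)

end

locale weighted_filtration = filtration X lab for X :: "'a set" and lab :: "nat \<Rightarrow> 'a \<Rightarrow> 'b" +
  fixes \<mu> :: "'a \<Rightarrow> real"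
  assumes nonneg: "x \<in> X \<Longrightarrow> 0 \<le> \<mu> x"
begin

definition mass :: "nat \<Rightarrow> 'a \<Rightarrow> real" where
  "mass k x = (\<Sum>y\<in>cell k x. \<mu> y)"

text \<open>
Level \<open>0\<close> carries the zero function instead of an average. Thus the increments at levels \<open>1, \<dots>, n\<close> add up to the
average at level \<open>n\<close> without a constant term, and truncated subtraction of levels yields the term zero whenever it leaves
the range of levels. On a cell of mass zero the average is \<open>0\<close>; such cells have no influence on integrals.
\<close>
definition E :: "nat \<Rightarrow> ('a \<Rightarrow> real) \<Rightarrow> 'a \<Rightarrow> real" where
  "E k f x = (if k = 0 then 0 else (\<Sum>y\<in>cell k x. \<mu> y * f y) / mass k x)"

definition D :: "nat \<Rightarrow> ('a \<Rightarrow> real) \<Rightarrow> 'a \<Rightarrow> real" where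
  "D k f x = E k f x - E (k - 1) f x"

definition I :: "('a \<Rightarrow> real) \<Rightarrow> real" where
  "I h = (\<Sum>x\<in>X. \<mu> x * h x)"

lemma I_mono: "(\<And>x. x \<in> X \<Longrightarrow> f x \<le> g x) \<Longrightarrow> I f \<le> I g"
  unfolding I_def by (intro sum_mono mult_left_mono nonneg)

lemma I_cong: "(\<And>x. x \<in> X \<Longrightarrow> f x = g x) \<Longrightarrow> I f = I g"
  unfolding I_def by (intro sum.cong) auto

lemma I_nonneg: "(\<And>x. x \<in> X \<Longrightarrow> 0 \<le> f x) \<Longrightarrow> 0 \<le> I f"
  unfolding I_def by (intro sum_nonneg mult_nonneg_nonneg nonneg)

lemma I_zero [simp]: "I (\<lambda>x. 0) = 0"
  and I_add: "I (\<lambda>x. f x + g x) = I f + I g"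
  and I_diff: "I (\<lambda>x. f x - g x) = I f - I g"
  and I_cmult: "I (\<lambda>x. c * f x) = c * I f"
  and I_cdiv: "I (\<lambda>x. f x / c) = I f / c"
  by (simp_all add: I_def sum.distrib sum_subtractf sum_distrib_left sum_divide_distrib algebra_simps)

lemma I_sum: "I (\<lambda>x. \<Sum>i\<in>A. f i x) = (\<Sum>i\<in>A. I (f i))"
  unfolding I_def sum_distrib_left by (rule sum.swap)

lemma mass_nonneg: "0 \<le> mass k x"
  unfolding mass_def using nonneg cell_subset by (intro sum_nonneg) auto

lemma mass_eq_0D: "mass k x = 0 \<Longrightarrow> y \<in> cell k x \<Longrightarrow> \<mu> y = 0"
  unfolding mass_def using nonneg cell_subset
  by (subst (asm) sum_nonneg_eq_0_iff) auto

lemma cst_mass: "cst k (mass k)"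
  by (rule cstI) (simp add: mass_def cell_def)

lemma cst_E: "cst k (E k f)"
  by (rule cstI) (simp add: E_def mass_def cell_def)

lemma cst_E': "j \<le> k \<Longrightarrow> cst k (E j f)"
  using cst_E cst_mono by blast

lemma cst_Dk: "k \<le> j \<Longrightarrow> cst j (D k f)"
  unfolding D_def by (intro cst_diff cst_E') auto

lemma E_0 [simp]: "E 0 f x = 0" and D_0 [simp]: "D 0 f x = 0"
  by (simp_all add: E_def D_def)

lemma E_sum: "E k (\<lambda>y. \<Sum>i\<in>A. f i y) x = (\<Sum>i\<in>A. E k (f i) x)"
proof (cases "k = 0")
  case False
  have "(\<Sum>y\<in>cell k x. \<mu> y * (\<Sum>i\<in>A. f i y)) = (\<Sum>i\<in>A. \<Sum>y\<in>cell k x. \<mu> y * f i y)"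
    unfolding sum_distrib_left by (rule sum.swap)
  then show ?thesis using False by (simp add: E_def sum_divide_distrib)
qed simp

lemma E_cmult: "E k (\<lambda>y. c * f y) x = c * E k f x"
  and E_multc: "E k (\<lambda>y. f y * c) x = E k f x * c"
  by (simp_all add: E_def sum_distrib_left sum_distrib_right algebra_simps)

lemma E_mono: "(\<And>y. y \<in> X \<Longrightarrow> f y \<le> g y) \<Longrightarrow> E k f x \<le> E k g x"
  unfolding E_def using cell_subset[of k x] nonneg mass_nonneg[of k x]
  by (auto intro!: divide_right_mono sum_mono mult_left_mono)

lemma E_nonneg: "(\<And>y. y \<in> X \<Longrightarrow> 0 \<le> f y) \<Longrightarrow> 0 \<le> E k f x"
  using E_mono[of "\<lambda>_. 0" f k x] E_cmult[of k 0 f x] by simp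

lemma E_abs_le: "\<bar>E k f x\<bar> \<le> E k (\<lambda>y. \<bar>f y\<bar>) x"
proof -
  have "E k f x \<le> E k (\<lambda>y. \<bar>f y\<bar>) x" by (rule E_mono) simp
  moreover have "E k (\<lambda>y. -1 * \<bar>f y\<bar>) x \<le> E k f x" by (rule E_mono) simp
  ultimately show ?thesis unfolding E_cmult by linarith
qed

lemma E_mass: "0 < k \<Longrightarrow> E k f x * mass k x = (\<Sum>y\<in>cell k x. \<mu> y * f y)"
  using mass_eq_0D[of k x] by (auto simp: E_def intro!: sum.neutral[symmetric])

text \<open>
The triangle inequality for averages of vectors, by pairing the averaged vector with itself.
\<close>
lemma E_vec_le:
  assumes "finite J"
  shows "L2_set (\<lambda>j. E k (f j) x) J \<le> E k (\<lambda>y. L2_set (\<lambda>j. f j y) J) x"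
proof -
  define N where "N = L2_set (\<lambda>j. E k (f j) x) J"
  have "N * N = (\<Sum>j\<in>J. E k (f j) x * E k (f j) x)"
    by (simp add: N_def L2_set_def sum_nonneg flip: power2_eq_square)
  also have "\<dots> = E k (\<lambda>y. \<Sum>j\<in>J. f j y * E k (f j) x) x" by (simp add: E_sum E_multc)
  also have "\<dots> \<le> E k (\<lambda>y. L2_set (\<lambda>j. f j y) J * N) x"
  proof (rule E_mono)
    fix y
    have "(\<Sum>j\<in>J. f j y * E k (f j) x) \<le> (\<Sum>j\<in>J. \<bar>f j y\<bar> * \<bar>E k (f j) x\<bar>)"
      by (intro sum_mono) (metis abs_ge_self abs_mult)
    then show "(\<Sum>j\<in>J. f j y * E k (f j) x) \<le> L2_set (\<lambda>j. f j y) J * N"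
      unfolding N_def by (rule order_trans) (rule L2_set_mult_ineq)
  qed
  finally have "N * N \<le> E k (\<lambda>y. L2_set (\<lambda>j. f j y) J) x * N" by (simp add: E_multc)
  moreover have "N \<ge> 0" "0 \<le> E k (\<lambda>y. L2_set (\<lambda>j. f j y) J) x" by (auto simp: N_def intro: E_nonneg)
  ultimately show ?thesis unfolding N_def[symmetric] by (cases "N = 0") auto
qed

lemma E_square_le: "(E k f x)\<^sup>2 \<le> E k (\<lambda>y. (f y)\<^sup>2) x"
proof (cases "k = 0 \<or> mass k x = 0")
  case False
  then have m: "mass k x > 0" using mass_nonneg[of k x] by simp
  have "(\<Sum>y\<in>cell k x. \<mu> y * f y) = (\<Sum>y\<in>cell k x. sqrt (\<mu> y) * (sqrt (\<mu> y) * f y))"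
    using nonneg cell_subset[of k x] by (intro sum.cong) (auto simp flip: mult.assoc)
  also have "\<dots>\<^sup>2 \<le> (\<Sum>y\<in>cell k x. (sqrt (\<mu> y))\<^sup>2) * (\<Sum>y\<in>cell k x. (sqrt (\<mu> y) * f y)\<^sup>2)"
    by (rule Cauchy_Schwarz_ineq_sum)
  also have "(\<Sum>y\<in>cell k x. (sqrt (\<mu> y))\<^sup>2) = mass k x"
    unfolding mass_def using nonneg cell_subset[of k x] by (intro sum.cong) auto
  also have "(\<Sum>y\<in>cell k x. (sqrt (\<mu> y) * f y)\<^sup>2) = (\<Sum>y\<in>cell k x. \<mu> y * (f y)\<^sup>2)"
    using nonneg cell_subset[of k x] by (intro sum.cong) (auto simp: power_mult_distrib)
  finally show ?thesis using False m by (simp add: E_def power_divide field_simps power2_eq_square)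
qed (auto simp: E_def)

text \<open>
The averages are the orthogonal projections onto the functions that are constant on cells; at level \<open>0\<close> the
projection is onto the zero function.
\<close>
lemma I_E_mult:
  assumes "cst k h" "k = 0 \<Longrightarrow> \<forall>x\<in>X. h x = 0"
  shows "I (\<lambda>x. E k f x * h x) = I (\<lambda>x. f x * h x)"
proof (cases "k = 0")
  case True
  then have "I (\<lambda>x. f x * h x) = I (\<lambda>x. 0)" using assms by (intro I_cong) auto
  then show ?thesis using True by simp
next
  case False
  have "I (\<lambda>x. E k f x * h x) = (\<Sum>x\<in>X. \<Sum>y\<in>X. if lab k y = lab k x then \<mu> x * h x * \<mu> y * f y / mass k x else 0)"
    using False finite_X unfolding I_def E_def cell_def
    by (intro sum.cong refl) (auto simp: sum_distrib_left sum_distrib_right sum_divide_distrib sum.inter_filter algebra_simps intro!: sum.cong)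
  also have "\<dots> = (\<Sum>y\<in>X. \<Sum>x\<in>X. if lab k y = lab k x then \<mu> x * h x * \<mu> y * f y / mass k x else 0)"
    by (rule sum.swap)
  also have "\<dots> = (\<Sum>y\<in>X. \<mu> y * (f y * h y))"
  proof (rule sum.cong[OF refl])
    fix y assume y: "y \<in> X"
    have "(\<Sum>x\<in>X. if lab k y = lab k x then \<mu> x * h x * \<mu> y * f y / mass k x else 0)
      = (\<Sum>x\<in>X. if lab k x = lab k y then \<mu> x * (h y * \<mu> y * f y / mass k y) else 0)"
    proof (intro sum.cong refl)
      fix x assume "x \<in> X"
      then have "lab k x = lab k y \<Longrightarrow> h x = h y \<and> mass k x = mass k y"
        using cstD[OF assms(1)] cstD[OF cst_mass] y by blast
      then show "(if lab k y = lab k x then \<mu> x * h x * \<mu> y * f y / mass k x else 0) =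
          (if lab k x = lab k y then \<mu> x * (h y * \<mu> y * f y / mass k y) else 0)" by (auto simp: mult_ac)
    qed
    also have "\<dots> = mass k y * (h y * \<mu> y * f y / mass k y)"
      unfolding mass_def cell_def sum_distrib_right sum.inter_filter[OF finite_X] by (intro sum.cong) auto
    also have "\<dots> = \<mu> y * (f y * h y)"
      using mass_eq_0D[of k y y] y by (cases "mass k y = 0") (auto simp: cell_def)
    finally show "(\<Sum>x\<in>X. if lab k y = lab k x then \<mu> x * h x * \<mu> y * f y / mass k x else 0) = \<mu> y * (f y * h y)" .
  qed
  finally show ?thesis by (simp add: I_def)
qed

lemma I_D_mult_eq_0:
  assumes "cst (k - 1) h" "k \<le> 1 \<Longrightarrow> \<forall>x\<in>X. h x = 0"
  shows "I (\<lambda>x. D k f x * h x) = 0"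
proof (cases "k = 0")
  case False
  have "I (\<lambda>x. E k f x * h x) = I (\<lambda>x. f x * h x)"
    using assms cst_mono[of "k-1" k h] False by (intro I_E_mult) auto
  moreover have "I (\<lambda>x. E (k - 1) f x * h x) = I (\<lambda>x. f x * h x)"
    using assms False by (intro I_E_mult) auto
  ultimately show ?thesis by (simp add: D_def left_diff_distrib I_diff)
qed simp

primrec runmax :: "nat \<Rightarrow> ('a \<Rightarrow> real) \<Rightarrow> 'a \<Rightarrow> real" where
  "runmax 0 f x = 0"
| "runmax (Suc k) f x = max (runmax k f x) (E (Suc k) f x)"

lemma cst_runmax: "cst k (runmax k f)"
proof (induction k)
  case (Suc k)
  have "runmax (Suc k) f = (\<lambda>x. max (runmax k f x) (E (Suc k) f x))" by auto
  then show ?case using cst_comp2[of "Suc k" "runmax k f" "E (Suc k) f" max] cst_mono[OF _ Suc, of "Suc k"] cst_E[of "Suc k" f] by simp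
qed (simp add: cst_def)

lemma runmax_nonneg [simp]: "0 \<le> runmax k f x"
  by (induction k) auto

lemma runmax_mono: "j \<le> k \<Longrightarrow> runmax j f x \<le> runmax k f x"
  by (induction k rule: dec_induct) auto

lemma E_le_runmax: "j \<le> k \<Longrightarrow> E j f x \<le> runmax k f x"
  using runmax_mono[of j k f x] by (cases j) auto

text \<open>
The running maximum grows only at levels where it equals the current average, so every increment of its
\<open>p\<close>-th power is at most \<open>p / (p - 1)\<close> times the current average times the increment of the \<open>(p - 1)\<close>-st power.
That increment is constant on cells, so the average may be replaced by the function, and the sum over the levels telescopes.
\<close>
lemma doob:
  assumes p: "1 < p" and f: "\<And>x. x \<in> X \<Longrightarrow> 0 \<le> f x"
  shows "I (\<lambda>x. runmax n f x powr p) \<le> doob_const p * I (\<lambda>x. f x powr p)"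
proof -
  define q where "q = p / (p - 1)"
  have q: "q > 0" using p by (simp add: q_def)
  have "I (\<lambda>x. runmax n f x powr p) \<le> q * I (\<lambda>x. f x * runmax n f x powr (p - 1))"
  proof (induction n)
    case (Suc n)
    define h where "h = (\<lambda>x. runmax (Suc n) f x powr (p - 1) - runmax n f x powr (p - 1))"
    have ch: "cst (Suc n) h" unfolding h_def
      by (intro cst_diff cst_comp[of _ _ "\<lambda>t. t powr (p-1)"] cst_runmax cst_mono[OF _ cst_runmax[of n]]) auto
    have "runmax (Suc n) f x powr p - runmax n f x powr p \<le> q * (E (Suc n) f x * h x)" for x
    proof (cases "E (Suc n) f x \<le> runmax n f x")
      case True then show ?thesis by (simp add: h_def)
    next
      case False
      then show ?thesis using powr_increment_le[OF p, of "runmax n f x" "runmax (Suc n) f x"]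
        runmax_nonneg[of n f x] by (simp add: h_def q_def mult.assoc del: runmax_nonneg)
    qed
    then have "I (\<lambda>x. runmax (Suc n) f x powr p - runmax n f x powr p) \<le> I (\<lambda>x. q * (E (Suc n) f x * h x))"
      by (intro I_mono)
    also have "\<dots> = q * I (\<lambda>x. f x * h x)" using I_E_mult[OF ch, of f] by (simp add: I_cmult)
    also have "\<dots> = q * I (\<lambda>x. f x * runmax (Suc n) f x powr (p - 1)) - q * I (\<lambda>x. f x * runmax n f x powr (p - 1))"
      by (simp only: h_def right_diff_distrib I_diff)
    finally show ?case using Suc by (simp add: I_diff)
  qed simp
  \<comment> \<open>The factor \<open>2 q\<close> makes the coefficient of the maximal function equal to \<open>1 / 2\<close>, which is absorbed.\<close>
  also have "\<dots> \<le> q * I (\<lambda>x. (2 * q) powr (p - 1) * f x powr p + runmax n f x powr p / (2 * q))"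
  proof (intro mult_left_mono I_mono)
    fix x assume "x \<in> X"
    then show "f x * runmax n f x powr (p - 1) \<le> (2 * q) powr (p - 1) * f x powr p + runmax n f x powr p / (2 * q)"
      using powr_split_le[of "f x" "runmax n f x" 1 "p-1" "2*q"] f p q by simp
  qed (use q in auto)
  also have "\<dots> = q * (2 * q) powr (p - 1) * I (\<lambda>x. f x powr p) + I (\<lambda>x. runmax n f x powr p) / 2"
    unfolding I_add I_cmult I_cdiv using q by (simp add: field_simps)
  finally have "I (\<lambda>x. runmax n f x powr p) \<le> (2 * q * (2 * q) powr (p - 1)) * I (\<lambda>x. f x powr p)" by simp
  also have "2 * q * (2 * q) powr (p - 1) = (2 * q) powr p"
    using q powr_add[of "2*q" 1 "p-1"] by simp
  finally show ?thesis by (simp add: q_def doob_const_def)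
qed

end

section \<open>Stein's inequality\<close>

definition stein_const :: "real \<Rightarrow> real" where
  "stein_const p = (if 2 \<le> p then p powr (p / 2)
     else 2 * (2 * (p / (p - 1)) powr (p / (p - 1) / 2)) powr (p - 1))"

context weighted_filtration
begin

text \<open>
With \<open>A\<^sub>k\<close> the sum of the first \<open>k\<close> squared averages and \<open>s = p / 2\<close>, convexity bounds the increments of \<open>A\<^sub>k\<^sup>s\<close>
by the new square times \<open>A\<^sub>k\<^sup>s\<^sup>-\<^sup>1\<close>. This weight is constant on cells of level \<open>k\<close>, so it may be moved through the average,
after which it is replaced by the final weight.
\<close>
lemma stein_ge_2:
  assumes p: "2 \<le> p"
  shows "I (\<lambda>x. L2_set (\<lambda>k. E k (\<phi> k) x) {1..n} powr p)
    \<le> p powr (p / 2) * I (\<lambda>x. L2_set (\<lambda>k. \<phi> k x) {1..n} powr p)"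
proof -
  define s where "s = p / 2"
  have s: "1 \<le> s" using p by (simp add: s_def)
  define A where "A = (\<lambda>m x. \<Sum>k=1..m. (E k (\<phi> k) x)\<^sup>2)"
  define F where "F = (\<lambda>x. \<Sum>k=1..n. (\<phi> k x)\<^sup>2)"
  have A0: "0 \<le> A m x" for m x by (simp add: A_def sum_nonneg)
  have F0: "0 \<le> F x" for x by (simp add: F_def sum_nonneg)
  have cA: "cst m (A m)" for m unfolding A_def
    by (intro cst_sum cst_comp[of _ _ "\<lambda>t. t\<^sup>2"] cst_E') auto
  have A_mono: "A k x \<le> A m x" if "k \<le> m" for k m x
    unfolding A_def using that by (intro sum_mono2) auto
  have step: "I (\<lambda>x. A m x powr s) \<le> s * (\<Sum>k=1..m. I (\<lambda>x. (\<phi> k x)\<^sup>2 * A k x powr (s - 1)))" for m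
  proof (induction m)
    case (Suc m)
    have c: "cst (Suc m) (\<lambda>x. A (Suc m) x powr (s - 1))" by (intro cst_comp[of _ _ "\<lambda>t. t powr (s-1)"] cA)
    have "I (\<lambda>x. A (Suc m) x powr s - A m x powr s)
      \<le> I (\<lambda>x. s * (E (Suc m) (\<lambda>y. (\<phi> (Suc m) y)\<^sup>2) x * A (Suc m) x powr (s - 1)))"
    proof (rule I_mono)
      fix x
      have "A (Suc m) x powr s - A m x powr s \<le> s * A (Suc m) x powr (s - 1) * (A (Suc m) x - A m x)"
        using powr_tangent_le[OF s A0[of "Suc m" x] A0[of m x]] by (simp add: algebra_simps)
      also have "A (Suc m) x - A m x = (E (Suc m) (\<phi> (Suc m)) x)\<^sup>2" by (simp add: A_def)
      also have "s * A (Suc m) x powr (s - 1) * \<dots> \<le> s * A (Suc m) x powr (s - 1) * E (Suc m) (\<lambda>y. (\<phi> (Suc m) y)\<^sup>2) x"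
        using s by (intro mult_left_mono E_square_le) auto
      finally show "A (Suc m) x powr s - A m x powr s
          \<le> s * (E (Suc m) (\<lambda>y. (\<phi> (Suc m) y)\<^sup>2) x * A (Suc m) x powr (s - 1))" by (simp add: mult_ac)
    qed
    also have "\<dots> = s * I (\<lambda>x. (\<phi> (Suc m) x)\<^sup>2 * A (Suc m) x powr (s - 1))"
      unfolding I_cmult using I_E_mult[OF c] by simp
    finally show ?case using Suc by (simp add: I_diff distrib_left)
  qed (simp add: A_def)
  have "I (\<lambda>x. A n x powr s) \<le> s * I (\<lambda>x. \<Sum>k=1..n. (\<phi> k x)\<^sup>2 * A k x powr (s - 1))"
    using step[of n] by (simp add: I_sum)
  also have "\<dots> \<le> s * I (\<lambda>x. (2 * s) powr (s - 1) * F x powr s + A n x powr s / (2 * s))"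
  proof (intro mult_left_mono I_mono)
    fix x
    have "(\<Sum>k=1..n. (\<phi> k x)\<^sup>2 * A k x powr (s - 1)) \<le> (\<Sum>k=1..n. (\<phi> k x)\<^sup>2 * A n x powr (s - 1))"
      using s A0 A_mono by (intro sum_mono mult_left_mono powr_mono2) auto
    also have "\<dots> = F x powr 1 * A n x powr (s - 1)" using F0 by (simp add: F_def sum_distrib_right)
    also have "\<dots> \<le> (2 * s) powr (s - 1) * F x powr s + A n x powr s / (2 * s)"
      using powr_split_le[OF F0[of x] A0[of n x], of 1 "s - 1" "2 * s"] s by simp
    finally show "(\<Sum>k=1..n. (\<phi> k x)\<^sup>2 * A k x powr (s - 1)) \<le> (2 * s) powr (s - 1) * F x powr s + A n x powr s / (2 * s)" .
  qed (use s in auto)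
  also have "\<dots> = s * (2 * s) powr (s - 1) * I (\<lambda>x. F x powr s) + I (\<lambda>x. A n x powr s) / 2"
    unfolding I_add I_cmult I_cdiv using s by (simp add: field_simps)
  finally have "I (\<lambda>x. A n x powr s) \<le> (2 * s * (2 * s) powr (s - 1)) * I (\<lambda>x. F x powr s)" by simp
  also have "2 * s * (2 * s) powr (s - 1) = (2 * s) powr s"
    using s powr_add[of "2 * s" 1 "s-1"] by simp
  finally show ?thesis by (simp add: s_def L2_powr A_def F_def)
qed

text \<open>
Averages are self-adjoint, so the case of small exponents is dual to that of large ones.
\<close>
lemma stein:
  assumes p: "1 < p"
  shows "I (\<lambda>x. L2_set (\<lambda>k. E k (\<phi> k) x) {1..n} powr p)
    \<le> stein_const p * I (\<lambda>x. L2_set (\<lambda>k. \<phi> k x) {1..n} powr p)"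
proof (cases "2 \<le> p")
  case True
  then show ?thesis using stein_ge_2[OF True] by (simp add: stein_const_def)
next
  case False
  define q where "q = p / (p - 1)"
  have q: "2 \<le> q" and pq: "q * (p - 1) = p" "1 / (p - 1) = q - 1" using p False by (auto simp: q_def field_simps)
  \<comment> \<open>With this \<open>B\<close> the dual term is at most half of the left-hand side.\<close>
  define B where "B = 2 * q powr (q / 2)"
  have B: "B > 0" using q by (simp add: B_def)
  define G where "G = (\<lambda>x. L2_set (\<lambda>k. E k (\<phi> k) x) {1..n})"
  define F where "F = (\<lambda>x. L2_set (\<lambda>k. \<phi> k x) {1..n})"
  define \<psi> where "\<psi> = (\<lambda>k x. E k (\<phi> k) x * G x powr (p - 2))"
  define H where "H = (\<lambda>x. L2_set (\<lambda>k. E k (\<psi> k) x) {1..n})"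
  have G0: "0 \<le> G x" and H0: "0 \<le> H x" and F0: "0 \<le> F x" for x by (auto simp: G_def H_def F_def)
  have L2psi: "L2_set (\<lambda>k. \<psi> k x) {1..n} = G x powr (p - 1)" for x
    unfolding \<psi>_def G_def by (rule L2_set_linearize)
  have "I (\<lambda>x. G x powr p) = I (\<lambda>x. \<Sum>k=1..n. E k (\<phi> k) x * \<psi> k x)"
    by (simp only: \<psi>_def G_def L2_set_linearize)
  also have "\<dots> = I (\<lambda>x. \<Sum>k=1..n. \<phi> k x * E k (\<psi> k) x)"
    unfolding I_sum
  proof (rule sum.cong[OF refl])
    fix k
    have "I (\<lambda>x. E k (\<phi> k) x * \<psi> k x) = I (\<lambda>x. E k (\<psi> k) x * E k (\<phi> k) x)"
      using I_E_mult[of k "E k (\<phi> k)" "\<psi> k"] cst_E[of k "\<phi> k"] by (simp add: mult.commute)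
    also have "\<dots> = I (\<lambda>x. \<phi> k x * E k (\<psi> k) x)"
      using I_E_mult[of k "E k (\<psi> k)" "\<phi> k"] cst_E[of k "\<psi> k"] by (simp add: mult.commute)
    finally show "I (\<lambda>x. E k (\<phi> k) x * \<psi> k x) = I (\<lambda>x. \<phi> k x * E k (\<psi> k) x)" .
  qed
  also have "\<dots> \<le> I (\<lambda>x. B powr (p - 1) * F x powr p + H x powr q / B)"
  proof (rule I_mono)
    fix x
    have "(\<Sum>k=1..n. \<phi> k x * E k (\<psi> k) x) \<le> (\<Sum>k=1..n. \<bar>\<phi> k x\<bar> * \<bar>E k (\<psi> k) x\<bar>)"
      by (intro sum_mono) (metis abs_ge_self abs_mult)
    also have "\<dots> \<le> F x * H x" unfolding F_def H_def by (rule L2_set_mult_ineq)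
    also have "\<dots> = F x powr 1 * (H x powr (q - 1)) powr (p - 1)"
      using F0[of x] H0[of x] pq p by (simp add: powr_powr flip: pq(2))
    also have "\<dots> \<le> B powr (p - 1) * F x powr p + (H x powr (q - 1)) powr p / B"
      using powr_split_le[OF F0[of x], of "H x powr (q - 1)" 1 "p-1" B] B p by simp
    also have "(H x powr (q - 1)) powr p = H x powr q"
      using p by (simp add: powr_powr flip: pq(2)) (simp add: q_def)
    finally show "(\<Sum>k=1..n. \<phi> k x * E k (\<psi> k) x) \<le> B powr (p - 1) * F x powr p + H x powr q / B" .
  qed
  also have "\<dots> = B powr (p - 1) * I (\<lambda>x. F x powr p) + I (\<lambda>x. H x powr q) / B"
    unfolding I_add I_cmult I_cdiv ..
  also have "I (\<lambda>x. H x powr q) \<le> q powr (q / 2) * I (\<lambda>x. G x powr p)"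
    using stein_ge_2[OF q, of \<psi> n] unfolding L2psi by (simp add: powr_powr pq mult.commute H_def)
  then have "I (\<lambda>x. H x powr q) / B \<le> I (\<lambda>x. G x powr p) / 2"
    using B q by (simp add: B_def field_simps)
  finally have "I (\<lambda>x. G x powr p) \<le> 2 * B powr (p - 1) * I (\<lambda>x. F x powr p)" by simp
  then show ?thesis using False by (simp add: stein_const_def B_def q_def G_def F_def)
qed

end

section \<open>Martingale transforms\<close>

text \<open>
The exponent is meant to lie in \<open>(1, 2]\<close>; of two conjugate exponents the smaller one always does.
\<close>
definition bilinear_const :: "real \<Rightarrow> real" where
  "bilinear_const p = doob_const p / (p * (p - 1)) + 5 / 2 * (doob_const p + doob_const (p / (p - 1)))"

definition transform_const :: "real \<Rightarrow> real" where
  "transform_const p = (2 * bilinear_const (min p (p / (p - 1)))) powr p"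

lemma doob_const_pos: "1 < p \<Longrightarrow> 0 < doob_const p"
  by (simp add: doob_const_def)

lemma bilinear_const_pos: "1 < p \<Longrightarrow> 0 < bilinear_const p"
  unfolding bilinear_const_def using doob_const_pos[of p] doob_const_pos[of "p/(p-1)"]
  by (intro add_pos_pos mult_pos_pos divide_pos_pos) auto

context weighted_filtration
begin

abbreviation L2n :: "('i \<Rightarrow> 'a \<Rightarrow> real) \<Rightarrow> 'i set \<Rightarrow> 'a \<Rightarrow> real" where
  "L2n u J x \<equiv> L2_set (\<lambda>i. u i x) J"

lemma L2_D_square:
  "(L2_set (\<lambda>i. D k (u i) x) J)\<^sup>2 = (L2_set (\<lambda>i. E (k - 1) (u i) x) J)\<^sup>2 + (L2_set (\<lambda>i. E k (u i) x) J)\<^sup>2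
     - 2 * (\<Sum>i\<in>J. E (k - 1) (u i) x * E k (u i) x)"
  unfolding L2_set_square sum_distrib_left sum.distrib[symmetric] sum_subtractf[symmetric]
  by (rule sum.cong) (simp_all add: D_def power2_diff)

lemma L2_E_square_diff:
  "(\<Sum>i\<in>J. E (k - 1) (u i) x * E k (u i) x) - (L2_set (\<lambda>i. E (k - 1) (u i) x) J)\<^sup>2
    = (\<Sum>i\<in>J. D k (u i) x * E (k - 1) (u i) x)"
  unfolding L2_set_square sum_subtractf[symmetric]
  by (rule sum.cong) (simp_all add: D_def power2_eq_square algebra_simps)

lemma L2_E_inner_le:
  "\<bar>\<Sum>i\<in>J. E (k - 1) (u i) x * E k (u i) x\<bar> \<le> L2_set (\<lambda>i. E (k - 1) (u i) x) J * L2_set (\<lambda>i. E k (u i) x) J"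
  using L2_set_mult_ineq[of "\<lambda>i. E (k - 1) (u i) x" "\<lambda>i. E k (u i) x" J]
    sum_abs[of "\<lambda>i. E (k - 1) (u i) x * E k (u i) x" J] by (simp add: abs_mult)

lemma L2_E_le_runmax: "finite J \<Longrightarrow> j \<le> k \<Longrightarrow> L2_set (\<lambda>i. E j (u i) x) J \<le> runmax k (L2n u J) x"
  using E_vec_le E_le_runmax by (rule order_trans)

lemma I_inner_D_eq_0:
  assumes "cst (k - 1) h"
  shows "I (\<lambda>x. (\<Sum>i\<in>J. D k (u i) x * E (k - 1) (u i) x) * h x) = 0"
proof -
  have "I (\<lambda>x. D k (u i) x * (E (k - 1) (u i) x * h x)) = 0" for i
    using assms by (intro I_D_mult_eq_0 cst_mult cst_E) auto
  then show ?thesis by (simp add: sum_distrib_right I_sum mult.assoc)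
qed

text \<open>
Strong convexity of the \<open>p\<close>-th power of the length is applied to consecutive averages and summed over the levels. The
term that is linear in the increment integrates to zero, because its coefficient is constant on cells of the previous level.
\<close>
lemma sum_square_weighted_low:
  assumes p: "1 < p" "p \<le> 2" and J: "finite J"
  shows "(\<Sum>k=1..n. I (\<lambda>x. (L2n (\<lambda>i. D k (u i)) J x)\<^sup>2 * runmax k (L2n u J) x powr (p - 2)))
    \<le> 2 / (p * (p - 1)) * I (\<lambda>x. L2n (\<lambda>i. E n (u i)) J x powr p)"
proof (induction n)
  case (Suc n)
  define A where "A = L2n (\<lambda>i. E n (u i)) J"
  define B where "B = L2n (\<lambda>i. E (Suc n) (u i)) J"
  define d where "d = L2n (\<lambda>i. D (Suc n) (u i)) J"
  define m where "m = runmax (Suc n) (L2n u J)"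
  define c where "c = (\<lambda>x. \<Sum>i\<in>J. E n (u i) x * E (Suc n) (u i) x)"
  define t where "t = (\<lambda>x. \<Sum>i\<in>J. D (Suc n) (u i) x * E n (u i) x)"
  have d2: "(d x)\<^sup>2 = (A x)\<^sup>2 + (B x)\<^sup>2 - 2 * c x" for x
    using L2_D_square[of "Suc n" u x J] by (simp add: A_def B_def d_def c_def)
  have t: "c x - (A x)\<^sup>2 = t x" for x
    using L2_E_square_diff[of "Suc n" u x J] by (simp add: A_def c_def t_def)
  have "cst n (\<lambda>x. A x powr (p - 2))" unfolding A_def
    by (intro cst_comp[of _ _ "\<lambda>t. t powr (p-2)"] cst_L2_set cst_E)
  then have It: "I (\<lambda>x. t x * A x powr (p - 2)) = 0"
    using I_inner_D_eq_0[of "Suc n"] by (simp add: t_def)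
  have "I (\<lambda>x. A x powr p + p * (t x * A x powr (p - 2)) + p * (p - 1) / 2 * ((d x)\<^sup>2 * m x powr (p - 2)))
    \<le> I (\<lambda>x. B x powr p)"
  proof (rule I_mono)
    fix x
    have AB: "0 \<le> A x" "0 \<le> B x" "max (A x) (B x) \<le> m x"
      using L2_E_le_runmax[OF J, of n "Suc n" u x] L2_E_le_runmax[OF J, of "Suc n" "Suc n" u x]
      by (simp_all add: A_def B_def m_def)
    have c: "\<bar>c x\<bar> \<le> A x * B x" using L2_E_inner_le[of "Suc n" u x J] by (simp add: A_def B_def c_def)
    have "(d x)\<^sup>2 * m x powr (p - 2) \<le> (d x)\<^sup>2 * max (A x) (B x) powr (p - 2)"
    proof (cases "max (A x) (B x) = 0")
      case True
      then have "A x = 0" "B x = 0" using AB by (auto simp: max_def split: if_splits)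
      then show ?thesis using d2[of x] c by simp
    next
      case False
      then show ?thesis using AB p by (intro mult_left_mono powr_mono2') auto
    qed
    then have "p * (p - 1) / 2 * ((d x)\<^sup>2 * m x powr (p - 2)) \<le> p * (p - 1) / 2 * ((d x)\<^sup>2 * max (A x) (B x) powr (p - 2))"
      by (rule mult_left_mono) (use p in simp)
    moreover have "A x powr p + p * (t x * A x powr (p - 2)) + p * (p - 1) / 2 * ((d x)\<^sup>2 * max (A x) (B x) powr (p - 2)) \<le> B x powr p"
      using powr_inner_taylor_lower[OF p AB(1,2) c] by (simp add: d2 t mult_ac)
    ultimately show "A x powr p + p * (t x * A x powr (p - 2)) + p * (p - 1) / 2 * ((d x)\<^sup>2 * m x powr (p - 2)) \<le> B x powr p"
      by linarith
  qed
  then have "p * (p - 1) / 2 * I (\<lambda>x. (d x)\<^sup>2 * m x powr (p - 2)) \<le> I (\<lambda>x. B x powr p) - I (\<lambda>x. A x powr p)"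
    unfolding I_add I_cmult It by simp
  then have "I (\<lambda>x. (d x)\<^sup>2 * m x powr (p - 2)) \<le> 2 / (p * (p - 1)) * (I (\<lambda>x. B x powr p) - I (\<lambda>x. A x powr p))"
    using p by (simp add: field_simps)
  then show ?case using Suc by (simp add: A_def B_def d_def m_def right_diff_distrib)
qed (use p in \<open>simp add: I_nonneg\<close>)

text \<open>
Split the weight \<open>b\<^sub>k\<close> into \<open>b\<^sub>k\<^sub>-\<^sub>1\<close> and the increment of \<open>b\<close>. For the first part, orthogonality turns the squared increment
of \<open>u\<close> into an increment of the squared averages, which is summed by parts. For the second part the squared
increment of \<open>u\<close> is at most four times the square of the maximal function, and the increments of \<open>b\<close> telescope.
\<close>
lemma sum_square_weighted_increasing:
  assumes J: "finite J" and b: "\<And>k. cst k (b k)" "\<And>x. x \<in> X \<Longrightarrow> b 0 x = 0" "\<And>k x. b k x \<le> b (Suc k) x" "\<And>k x. 0 \<le> b k x"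
  shows "(\<Sum>k=1..n. I (\<lambda>x. (L2n (\<lambda>i. D k (u i)) J x)\<^sup>2 * b k x))
    \<le> 5 * I (\<lambda>x. (runmax n (L2n u J) x)\<^sup>2 * b n x)"
proof -
  define M where "M = runmax n (L2n u J)"
  define A where "A = (\<lambda>k. L2n (\<lambda>i. E k (u i)) J)"
  have A0: "0 \<le> A k x" for k x by (simp add: A_def)
  have AM: "A k x \<le> M x" if "k \<le> n" for k x using L2_E_le_runmax[OF J that] by (simp add: A_def M_def)
  have "(\<Sum>k=1..m. I (\<lambda>x. (L2n (\<lambda>i. D k (u i)) J x)\<^sup>2 * b k x))
    \<le> I (\<lambda>x. (A m x)\<^sup>2 * b m x) + 4 * I (\<lambda>x. (M x)\<^sup>2 * b m x)" if "m \<le> n" for m using that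
  proof (induction m)
    case 0
    show ?case using A0 b by (simp add: I_nonneg)
  next
    case (Suc m)
    define d where "d = L2n (\<lambda>i. D (Suc m) (u i)) J"
    define c where "c = (\<lambda>x. \<Sum>i\<in>J. E m (u i) x * E (Suc m) (u i) x)"
    define t where "t = (\<lambda>x. \<Sum>i\<in>J. D (Suc m) (u i) x * E m (u i) x)"
    have d2: "(d x)\<^sup>2 = (A m x)\<^sup>2 + (A (Suc m) x)\<^sup>2 - 2 * c x" for x
      using L2_D_square[of "Suc m" u x J] by (simp add: A_def d_def c_def)
    have t: "c x - (A m x)\<^sup>2 = t x" for x
      using L2_E_square_diff[of "Suc m" u x J] by (simp add: A_def c_def t_def)
    have It: "I (\<lambda>x. t x * b m x) = 0"
      using I_inner_D_eq_0[of "Suc m" "b m" u J] b(1) by (simp add: t_def)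
    have "I (\<lambda>x. (d x)\<^sup>2 * b (Suc m) x) \<le> I (\<lambda>x. (A (Suc m) x)\<^sup>2 * b (Suc m) x - (A m x)\<^sup>2 * b m x - 2 * (t x * b m x)
        + 4 * ((M x)\<^sup>2 * b (Suc m) x - (M x)\<^sup>2 * b m x))"
    proof (rule I_mono)
      fix x
      have "\<bar>c x\<bar> \<le> A m x * A (Suc m) x" using L2_E_inner_le[of "Suc m" u x J] by (simp add: A_def c_def)
      then have "(d x)\<^sup>2 \<le> (A m x + A (Suc m) x)\<^sup>2" using d2[of x] by (simp add: power2_eq_square algebra_simps)
      also have "\<dots> \<le> (2 * M x)\<^sup>2" using AM[of m x] AM[of "Suc m" x] A0[of m x] A0[of "Suc m" x] Suc.prems
        by (intro power_mono) auto
      finally have d: "(d x)\<^sup>2 \<le> 4 * (M x)\<^sup>2" by (simp add: power_mult_distrib)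
      have "(d x)\<^sup>2 * (b (Suc m) x - b m x) \<le> 4 * (M x)\<^sup>2 * (b (Suc m) x - b m x)"
        using b(3)[of m x] by (intro mult_right_mono d) auto
      moreover have "(d x)\<^sup>2 * b m x = ((A (Suc m) x)\<^sup>2 - (A m x)\<^sup>2 - 2 * t x) * b m x"
        using d2[of x] t[of x] by simp
      moreover have "(A (Suc m) x)\<^sup>2 * b m x \<le> (A (Suc m) x)\<^sup>2 * b (Suc m) x"
        using b(3)[of m x] by (intro mult_left_mono) auto
      ultimately show "(d x)\<^sup>2 * b (Suc m) x \<le> (A (Suc m) x)\<^sup>2 * b (Suc m) x - (A m x)\<^sup>2 * b m x - 2 * (t x * b m x)
        + 4 * ((M x)\<^sup>2 * b (Suc m) x - (M x)\<^sup>2 * b m x)" by (simp add: algebra_simps)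
    qed
    also have "\<dots> = I (\<lambda>x. (A (Suc m) x)\<^sup>2 * b (Suc m) x) - I (\<lambda>x. (A m x)\<^sup>2 * b m x)
        + 4 * (I (\<lambda>x. (M x)\<^sup>2 * b (Suc m) x) - I (\<lambda>x. (M x)\<^sup>2 * b m x))"
      unfolding I_add I_diff I_cmult It by simp
    finally show ?case using Suc by (simp add: d_def)
  qed
  from this[of n] have "(\<Sum>k=1..n. I (\<lambda>x. (L2n (\<lambda>i. D k (u i)) J x)\<^sup>2 * b k x))
    \<le> I (\<lambda>x. (A n x)\<^sup>2 * b n x) + 4 * I (\<lambda>x. (M x)\<^sup>2 * b n x)" by simp
  moreover have "I (\<lambda>x. (A n x)\<^sup>2 * b n x) \<le> I (\<lambda>x. (M x)\<^sup>2 * b n x)"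
    using A0 AM b(4) by (intro I_mono mult_right_mono power_mono) auto
  ultimately show ?thesis by (simp add: M_def)
qed

text \<open>
Write \<open>M\<^sub>k\<close> for the running maximum of the averages of \<open>|u|\<close>. By the inequality between the arithmetic and the
geometric mean, the product of the two increments is at most half the sum of the squared increment of \<open>u\<close> with the decreasing
weight \<open>M\<^sub>k powr (p - 2)\<close> and the squared increment of \<open>v\<close> with the increasing weight \<open>M\<^sub>k powr (2 - p)\<close>. These weights are
the ones that the two preceding lemmas handle.
\<close>
lemma bilinear_embedding:
  assumes p: "1 < p" "p \<le> 2" and fin: "finite J" "finite J'"
  shows "(\<Sum>k=1..n. I (\<lambda>x. L2n (\<lambda>i. D k (u i)) J x * L2n (\<lambda>i. D k (v i)) J' x))
    \<le> bilinear_const p * (I (\<lambda>x. L2n u J x powr p) + I (\<lambda>x. L2n v J' x powr (p / (p - 1))))"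
proof -
  define q where "q = p / (p - 1)"
  have q: "q > 1" using p by (simp add: q_def)
  define du where "du = (\<lambda>k. L2n (\<lambda>i. D k (u i)) J)"
  define dv where "dv = (\<lambda>k. L2n (\<lambda>i. D k (v i)) J')"
  define m where "m = (\<lambda>k. runmax k (L2n u J))"
  define P where "P = runmax n (L2n v J')"
  have dp: "doob_const p \<ge> 0" "doob_const q \<ge> 0" by (simp_all add: doob_const_def)
  define U where "U = I (\<lambda>x. L2n u J x powr p)"
  define V where "V = I (\<lambda>x. L2n v J' x powr q)"
  have UV: "U \<ge> 0" "V \<ge> 0" by (auto simp: U_def V_def intro!: I_nonneg)
  have mU: "I (\<lambda>x. m n x powr p) \<le> doob_const p * U"
    unfolding m_def U_def using p by (intro doob) auto
  have PV: "I (\<lambda>x. P x powr q) \<le> doob_const q * V"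
    unfolding P_def V_def using q by (intro doob) auto
  have pt: "du k x * dv k x \<le> ((du k x)\<^sup>2 * m k x powr (p - 2)) / 2 + ((dv k x)\<^sup>2 * m k x powr (2 - p)) / 2" for k x
  proof (cases "m k x = 0")
    case True
    have "(du k x)\<^sup>2 = 0"
    proof -
      have "L2_set (\<lambda>i. E k (u i) x) J = 0" "L2_set (\<lambda>i. E (k-1) (u i) x) J = 0"
        using L2_E_le_runmax[OF fin(1), of k k u x] L2_E_le_runmax[OF fin(1), of "k-1" k u x] True
        by (auto simp: m_def intro!: antisym)
      then show ?thesis using L2_D_square[of k u x J] L2_E_inner_le[of k u x J] by (simp add: du_def)
    qed
    then show ?thesis using True by simp
  next
    case False
    then have m: "m k x > 0" using runmax_nonneg[of k "L2n u J" x] unfolding m_def by linarith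
    \<comment> \<open>The weights \<open>m k x powr (p - 2)\<close> and \<open>m k x powr (2 - p)\<close> are \<open>s\<^sup>2\<close> and \<open>s\<^sup>-\<^sup>2\<close>.\<close>
    define s where "s = m k x powr ((p - 2) / 2)"
    have s: "s > 0" "m k x powr (p - 2) = s\<^sup>2" "m k x powr (2 - p) = (1 / s)\<^sup>2"
      using m by (auto simp: s_def power2_eq_square powr_minus_divide[symmetric] simp flip: powr_add)
    have "0 \<le> (du k x * s - dv k x * (1 / s))\<^sup>2" by simp
    then show ?thesis using s by (simp add: power2_diff power_mult_distrib power_divide)
  qed
  have B1: "(\<Sum>k=1..n. I (\<lambda>x. (du k x)\<^sup>2 * m k x powr (p - 2))) \<le> 2 / (p * (p - 1)) * (doob_const p * U)"
  proof -
    have "I (\<lambda>x. L2n (\<lambda>i. E n (u i)) J x powr p) \<le> I (\<lambda>x. m n x powr p)"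
      unfolding m_def using p by (intro I_mono powr_mono2 L2_E_le_runmax fin) auto
    then have "2 / (p * (p - 1)) * I (\<lambda>x. L2n (\<lambda>i. E n (u i)) J x powr p) \<le> 2 / (p * (p - 1)) * (doob_const p * U)"
      using mU p by (intro mult_left_mono) auto
    then show ?thesis using sum_square_weighted_low[OF p fin(1), of u n] by (simp add: du_def m_def)
  qed
  have B2: "(\<Sum>k=1..n. I (\<lambda>x. (dv k x)\<^sup>2 * m k x powr (2 - p))) \<le> 5 * (doob_const p * U + doob_const q * V)"
  proof -
    have "(\<Sum>k=1..n. I (\<lambda>x. (dv k x)\<^sup>2 * m k x powr (2 - p))) \<le> 5 * I (\<lambda>x. (P x)\<^sup>2 * m n x powr (2 - p))"
      unfolding dv_def P_def
    proof (rule sum_square_weighted_increasing[OF fin(2)])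
      show "cst k (\<lambda>x. m k x powr (2 - p))" for k
        unfolding m_def by (intro cst_comp[of _ _ "\<lambda>t. t powr (2-p)"] cst_runmax)
      show "m k x powr (2 - p) \<le> m (Suc k) x powr (2 - p)" for k x
        unfolding m_def using p by (intro powr_mono2 runmax_mono) auto
    qed (simp_all add: m_def)
    also have "I (\<lambda>x. (P x)\<^sup>2 * m n x powr (2 - p)) \<le> I (\<lambda>x. P x powr q + m n x powr p)"
      unfolding q_def using p by (intro I_mono powr_conj_split_le) (auto simp: P_def m_def)
    also have "\<dots> \<le> doob_const p * U + doob_const q * V" using mU PV by (simp add: I_add)
    finally show ?thesis by simp
  qed
  have "(\<Sum>k=1..n. I (\<lambda>x. du k x * dv k x))
    \<le> (\<Sum>k=1..n. I (\<lambda>x. ((du k x)\<^sup>2 * m k x powr (p - 2)) / 2 + ((dv k x)\<^sup>2 * m k x powr (2 - p)) / 2))"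
    by (intro sum_mono I_mono pt)
  also have "\<dots> = (\<Sum>k=1..n. I (\<lambda>x. (du k x)\<^sup>2 * m k x powr (p - 2))) / 2 + (\<Sum>k=1..n. I (\<lambda>x. (dv k x)\<^sup>2 * m k x powr (2 - p))) / 2"
    by (simp only: I_add I_cdiv sum.distrib sum_divide_distrib)
  also have "\<dots> \<le> (2 / (p * (p - 1)) * (doob_const p * U)) / 2 + 5 * (doob_const p * U + doob_const q * V) / 2"
    by (intro add_mono divide_right_mono B1 B2) auto
  also have "\<dots> = (doob_const p / (p * (p - 1)) + 5 / 2 * doob_const p) * U + 5 / 2 * doob_const q * V"
    using p by (simp add: field_simps)
  also have "\<dots> \<le> bilinear_const p * U + bilinear_const p * V"
  proof -
    have "0 \<le> doob_const p / (p * (p - 1))" using p dp by simp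
    then have "doob_const p / (p * (p - 1)) + 5 / 2 * doob_const p \<le> bilinear_const p" "5 / 2 * doob_const q \<le> bilinear_const p"
      unfolding bilinear_const_def q_def[symmetric] distrib_left using dp by linarith+
    then show ?thesis using UV by (intro add_mono mult_right_mono)
  qed
  finally show ?thesis by (simp add: du_def dv_def U_def V_def q_def distrib_left)
qed

text \<open>
After linearisation the left-hand side is the pairing of the transform with a dual family, in which only the products
of increments of the same level survive; these are summed by the bilinear embedding, applied to whichever of the two factors
has an exponent at most \<open>2\<close>. If \<open>\<epsilon> j l\<close> is \<open>1\<close> for \<open>j = l\<close> and \<open>0\<close> otherwise, this is the square function estimate; if
it is supported where \<open>j\<close> is the stopping level that belongs to \<open>l\<close>, then the increments are grouped by stopping cells.
\<close>
lemma martingale_transform: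
  assumes p: "1 < p" and J: "finite J"
    and e: "\<And>j l. j \<in> J \<Longrightarrow> 1 \<le> l \<Longrightarrow> l \<le> n \<Longrightarrow> cst (l - 1) (\<epsilon> j l)"
    and e1: "\<And>l x. 1 \<le> l \<Longrightarrow> l \<le> n \<Longrightarrow> x \<in> X \<Longrightarrow> (\<Sum>j\<in>J. (\<epsilon> j l x)\<^sup>2) \<le> 1"
  shows "I (\<lambda>x. L2_set (\<lambda>j. \<Sum>l=1..n. \<epsilon> j l x * D l g x) J powr p)
    \<le> transform_const p * I (\<lambda>x. \<bar>g x\<bar> powr p)"
proof -
  define q where "q = p / (p - 1)"
  have q: "q > 1" "q / (q - 1) = p" "(p - 1) * q = p" using p by (auto simp: q_def field_simps)
  define C where "C = bilinear_const (min p q)"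
  have C: "C > 0" using p q by (auto simp: C_def intro!: bilinear_const_pos)
  \<comment> \<open>The dual family is scaled by \<open>\<delta>\<close> so that half of the left-hand side can be absorbed (\<open>\<delta>q\<close>).\<close>
  define \<delta> where "\<delta> = (2 * C) powr (- (p - 1))"
  have \<delta>: "\<delta> > 0" using C by (simp add: \<delta>_def)
  have \<delta>q: "C * \<delta> powr q = \<delta> / 2"
  proof -
    have "\<delta> powr q = (2 * C) powr (- (p - 1) + (-1))"
      using q(3) by (simp add: \<delta>_def powr_powr algebra_simps)
    also have "\<dots> = \<delta> / (2 * C)" unfolding powr_add using C by (simp add: \<delta>_def powr_minus_divide)
    finally show ?thesis using C by simp
  qed
  define Y where "Y = (\<lambda>j x. \<Sum>l=1..n. \<epsilon> j l x * D l g x)"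
  define N where "N = L2n Y J"
  define \<phi> where "\<phi> = (\<lambda>j x. \<delta> * (Y j x * N x powr (p - 2)))"
  have L2phi: "L2n \<phi> J x = \<delta> * N x powr (p - 1)" for x
    using \<delta> by (simp add: \<phi>_def N_def L2_set_linearize flip: L2_set_right_distrib)
  have lin: "(\<Sum>j\<in>J. Y j x * \<phi> j x) = \<delta> * N x powr p" for x
    unfolding N_def L2_set_linearize(1)[symmetric, of "\<lambda>j. Y j x" J p] sum_distrib_left
    by (simp add: \<phi>_def N_def mult_ac)
  have "\<delta> * I (\<lambda>x. N x powr p) = I (\<lambda>x. \<Sum>j\<in>J. Y j x * \<phi> j x)"
    by (simp add: lin I_cmult)
  also have "\<dots> = (\<Sum>j\<in>J. \<Sum>l=1..n. I (\<lambda>x. \<epsilon> j l x * D l g x * \<phi> j x))"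
    by (simp add: Y_def I_sum sum_distrib_right)
  also have "\<dots> = (\<Sum>j\<in>J. \<Sum>l=1..n. I (\<lambda>x. \<epsilon> j l x * D l g x * E l (\<phi> j) x))"
  proof (intro sum.cong refl)
    fix j l assume jl: "j \<in> J" "l \<in> {1..n}"
    have "cst l (\<lambda>x. \<epsilon> j l x * D l g x)"
      using jl e[of j l] by (intro cst_mult cst_Dk cst_mono[of "l-1" l]) auto
    then show "I (\<lambda>x. \<epsilon> j l x * D l g x * \<phi> j x) = I (\<lambda>x. \<epsilon> j l x * D l g x * E l (\<phi> j) x)"
      using I_E_mult[of l "\<lambda>x. \<epsilon> j l x * D l g x" "\<phi> j"] jl by (simp add: mult.commute)
  qed
  also have "\<dots> = (\<Sum>j\<in>J. \<Sum>l=1..n. I (\<lambda>x. \<epsilon> j l x * D l g x * D l (\<phi> j) x))"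
  proof (intro sum.cong refl)
    fix j l assume jl: "j \<in> J" "l \<in> {1..n}"
    have "I (\<lambda>x. D l g x * (\<epsilon> j l x * E (l - 1) (\<phi> j) x)) = 0"
      using jl e[of j l] by (intro I_D_mult_eq_0 cst_mult cst_E) auto
    then show "I (\<lambda>x. \<epsilon> j l x * D l g x * E l (\<phi> j) x) = I (\<lambda>x. \<epsilon> j l x * D l g x * D l (\<phi> j) x)"
      by (simp add: D_def[of l "\<phi> j"] right_diff_distrib I_diff mult_ac)
  qed
  also have "\<dots> = (\<Sum>l=1..n. I (\<lambda>x. \<Sum>j\<in>J. \<epsilon> j l x * D l g x * D l (\<phi> j) x))"
    unfolding I_sum by (rule sum.swap)
  also have "\<dots> \<le> (\<Sum>l=1..n. I (\<lambda>x. \<bar>D l g x\<bar> * L2n (\<lambda>j. D l (\<phi> j)) J x))"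
  proof (intro sum_mono I_mono)
    fix l x assume l: "l \<in> {1..n}" and x: "x \<in> X"
    have "(\<Sum>j\<in>J. \<epsilon> j l x * D l g x * D l (\<phi> j) x) \<le> \<bar>D l g x\<bar> * (\<Sum>j\<in>J. \<bar>\<epsilon> j l x\<bar> * \<bar>D l (\<phi> j) x\<bar>)"
      unfolding sum_distrib_left by (intro sum_mono) (simp add: abs_mult[symmetric] mult_ac)
    also have "\<dots> \<le> \<bar>D l g x\<bar> * (L2_set (\<lambda>j. \<epsilon> j l x) J * L2n (\<lambda>j. D l (\<phi> j)) J x)"
      by (intro mult_left_mono L2_set_mult_ineq) auto
    also have "\<dots> \<le> \<bar>D l g x\<bar> * (1 * L2n (\<lambda>j. D l (\<phi> j)) J x)"
    proof (intro mult_left_mono mult_right_mono)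
      show "L2_set (\<lambda>j. \<epsilon> j l x) J \<le> 1" using e1[of l x] l x by (simp add: L2_set_def)
    qed auto
    finally show "(\<Sum>j\<in>J. \<epsilon> j l x * D l g x * D l (\<phi> j) x) \<le> \<bar>D l g x\<bar> * L2n (\<lambda>j. D l (\<phi> j)) J x" by simp
  qed
  also have "\<dots> \<le> C * (I (\<lambda>x. \<bar>g x\<bar> powr p) + I (\<lambda>x. L2n \<phi> J x powr q))"
  proof (cases "p \<le> 2")
    case True
    then have "min p q = p" using p by (simp add: q_def field_simps)
    then show ?thesis using bilinear_embedding[OF p True, of "{()}" J "\<lambda>_. g" \<phi> n] J
      by (simp add: C_def q_def)
  next
    case False
    then have q2: "q \<le> 2" and "min p q = q" using p by (simp_all add: q_def field_simps)
    then show ?thesis using bilinear_embedding[OF q(1) q2, of J "{()}" \<phi> "\<lambda>_. g" n] J q(2)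
      by (simp add: C_def add.commute mult.commute)
  qed
  also have "I (\<lambda>x. L2n \<phi> J x powr q) = \<delta> powr q * I (\<lambda>x. N x powr p)"
    unfolding L2phi I_cmult[symmetric] using \<delta> q(3) by (intro I_cong) (simp add: powr_mult powr_powr)
  also have "C * (I (\<lambda>x. \<bar>g x\<bar> powr p) + \<delta> powr q * I (\<lambda>x. N x powr p)) = C * I (\<lambda>x. \<bar>g x\<bar> powr p) + \<delta> / 2 * I (\<lambda>x. N x powr p)"
    using \<delta>q by (simp add: distrib_left flip: mult.assoc)
  finally have "\<delta> / 2 * I (\<lambda>x. N x powr p) \<le> C * I (\<lambda>x. \<bar>g x\<bar> powr p)" by simp
  then have "I (\<lambda>x. N x powr p) \<le> (2 * C / \<delta>) * I (\<lambda>x. \<bar>g x\<bar> powr p)"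
    using \<delta> by (simp add: field_simps)
  also have "2 * C / \<delta> = transform_const p"
  proof -
    have "\<delta> * (2 * C) powr (p - 1) = 1" using C by (simp add: \<delta>_def flip: powr_add)
    then have "2 * C / \<delta> = 2 * C * (2 * C) powr (p - 1)" using \<delta> by (simp add: field_simps)
    also have "\<dots> = (2 * C) powr p" using C powr_add[of "2 * C" 1 "p - 1"] by simp
    finally show ?thesis by (simp add: transform_const_def C_def q_def)
  qed
  finally show ?thesis by (simp add: N_def Y_def)
qed

end

section \<open>Weighted norms, stopping levels and two weights\<close>

definition doob_norm :: "real \<Rightarrow> real" where "doob_norm p = doob_const p powr (1 / p)"
definition stein_norm :: "real \<Rightarrow> real" where "stein_norm p = stein_const p powr (1 / p)"
definition transform_norm :: "real \<Rightarrow> real" where "transform_norm p = transform_const p powr (1 / p)"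

context weighted_filtration
begin

definition nrm :: "real \<Rightarrow> ('a \<Rightarrow> real) \<Rightarrow> real" where
  "nrm p f = I (\<lambda>x. \<bar>f x\<bar> powr p) powr (1 / p)"

lemma nrm_nonneg [simp]: "0 \<le> nrm p f"
  by (simp add: nrm_def)

lemma nrm_mono:
  assumes "0 < p" "\<And>x. x \<in> X \<Longrightarrow> \<bar>f x\<bar> \<le> \<bar>g x\<bar>"
  shows "nrm p f \<le> nrm p g"
  unfolding nrm_def using assms by (intro powr_mono2 I_mono I_nonneg) auto

lemma nrm_powr: "0 < p \<Longrightarrow> nrm p f powr p = I (\<lambda>x. \<bar>f x\<bar> powr p)"
  by (simp add: nrm_def powr_powr I_nonneg)

lemma nrm_le:
  assumes "0 < p" "0 \<le> C" "I (\<lambda>x. \<bar>f x\<bar> powr p) \<le> C * I (\<lambda>x. \<bar>g x\<bar> powr p)"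
  shows "nrm p f \<le> C powr (1 / p) * nrm p g"
proof -
  have "nrm p f \<le> (C * I (\<lambda>x. \<bar>g x\<bar> powr p)) powr (1 / p)"
    unfolding nrm_def using assms by (intro powr_mono2 I_nonneg) auto
  also have "\<dots> = C powr (1 / p) * nrm p g"
    using assms by (simp add: nrm_def powr_mult I_nonneg)
  finally show ?thesis .
qed

lemma nrm_eq_0D:
  assumes "nrm p f = 0" "0 < p" "x \<in> X"
  shows "\<mu> x * f x = 0"
proof -
  have "I (\<lambda>x. \<bar>f x\<bar> powr p) = 0" using assms nrm_powr[of p f] by simp
  then have "\<forall>x\<in>X. \<mu> x * \<bar>f x\<bar> powr p = 0"
    unfolding I_def using nonneg finite_X by (subst (asm) sum_nonneg_eq_0_iff) auto
  then show ?thesis using assms by auto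
qed

lemma nrm_cmult: "0 < p \<Longrightarrow> nrm p (\<lambda>x. c * f x) = \<bar>c\<bar> * nrm p f"
  by (simp add: nrm_def abs_mult powr_mult I_cmult I_nonneg powr_powr)

lemma holder:
  assumes p: "1 < p"
  shows "I (\<lambda>x. \<bar>f x\<bar> * \<bar>g x\<bar>) \<le> nrm p f * nrm (p / (p - 1)) g"
proof -
  define q where "q = p / (p - 1)"
  have q: "q > 1" "1 / p + 1 / q = 1" using p by (auto simp: q_def field_simps)
  define F where "F = nrm p f"
  define G where "G = nrm q g"
  have FG: "0 \<le> F" "0 \<le> G" by (auto simp: F_def G_def)
  show ?thesis
  proof (cases "F = 0 \<or> G = 0")
    case True
    have "\<mu> x * (\<bar>f x\<bar> * \<bar>g x\<bar>) = 0" if "x \<in> X" for x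
      using True nrm_eq_0D[of p f x] nrm_eq_0D[of q g x] p q that by (auto simp: F_def G_def)
    then have "I (\<lambda>x. \<bar>f x\<bar> * \<bar>g x\<bar>) = 0" unfolding I_def by (intro sum.neutral ballI)
    then show ?thesis by simp
  next
    case False
    then have pos: "F > 0" "G > 0" using FG by auto
    have "I (\<lambda>x. (\<bar>f x\<bar> / F) * (\<bar>g x\<bar> / G)) \<le> I (\<lambda>x. (\<bar>f x\<bar> / F) powr p / p + (\<bar>g x\<bar> / G) powr q / q)"
      using p q pos by (intro I_mono Youngs_inequality) auto
    also have "\<dots> = I (\<lambda>x. \<bar>f x\<bar> powr p) / (F powr p) / p + I (\<lambda>x. \<bar>g x\<bar> powr q) / (G powr q) / q"
      using pos by (simp add: powr_divide I_add I_cdiv)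
    also have "\<dots> = 1 / p + 1 / q"
      using pos p q nrm_powr[of p f] nrm_powr[of q g] by (simp add: F_def G_def flip: nrm_powr)
    finally have "I (\<lambda>x. \<bar>f x\<bar> * \<bar>g x\<bar>) / (F * G) \<le> 1" using q by (simp add: I_cdiv)
    then show ?thesis using pos by (simp add: field_simps F_def G_def q_def)
  qed
qed

lemma holder_L2:
  assumes p: "1 < p"
  shows "(\<Sum>k\<in>A. I (\<lambda>x. \<bar>a k x\<bar> * \<bar>b k x\<bar>)) \<le> nrm p (L2n a A) * nrm (p / (p - 1)) (L2n b A)"
proof -
  have "(\<Sum>k\<in>A. I (\<lambda>x. \<bar>a k x\<bar> * \<bar>b k x\<bar>)) = I (\<lambda>x. \<Sum>k\<in>A. \<bar>a k x\<bar> * \<bar>b k x\<bar>)"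
    by (simp add: I_sum)
  also have "\<dots> \<le> I (\<lambda>x. \<bar>L2n a A x\<bar> * \<bar>L2n b A x\<bar>)"
    by (intro I_mono) (use L2_set_mult_ineq in auto)
  also have "\<dots> \<le> nrm p (L2n a A) * nrm (p / (p - 1)) (L2n b A)" by (rule holder[OF p])
  finally show ?thesis .
qed

lemma stein_nrm: "1 < p \<Longrightarrow> nrm p (L2n (\<lambda>k. E k (\<phi> k)) {1..n}) \<le> stein_norm p * nrm p (L2n \<phi> {1..n})"
  unfolding stein_norm_def using stein[of p \<phi> n] by (intro nrm_le) (auto simp: stein_const_def)

lemma doob_nrm: "1 < p \<Longrightarrow> nrm p (runmax n (\<lambda>x. \<bar>f x\<bar>)) \<le> doob_norm p * nrm p f"
  unfolding doob_norm_def using doob[of p "\<lambda>x. \<bar>f x\<bar>" n] by (intro nrm_le) (auto simp: doob_const_def)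

lemma transform_nrm:
  assumes "1 < p" "finite J" "\<And>j l. j \<in> J \<Longrightarrow> 1 \<le> l \<Longrightarrow> l \<le> n \<Longrightarrow> cst (l - 1) (\<epsilon> j l)"
    "\<And>l x. 1 \<le> l \<Longrightarrow> l \<le> n \<Longrightarrow> x \<in> X \<Longrightarrow> (\<Sum>j\<in>J. (\<epsilon> j l x)\<^sup>2) \<le> 1"
  shows "nrm p (L2n (\<lambda>j x. \<Sum>l=1..n. \<epsilon> j l x * D l g x) J) \<le> transform_norm p * nrm p g"
  unfolding transform_norm_def using assms martingale_transform[OF assms]
  by (intro nrm_le) (auto simp: transform_const_def)

lemma square_function_nrm:
  assumes "1 < p"
  shows "nrm p (L2n (\<lambda>k. D k g) {1..n}) \<le> transform_norm p * nrm p g"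
proof -
  have "nrm p (L2n (\<lambda>j x. \<Sum>l=1..n. (if j = l then 1 else 0) * D l g x) {1..n}) \<le> transform_norm p * nrm p g"
    using assms by (intro transform_nrm) (auto simp: if_distrib[of "\<lambda>t. t\<^sup>2"] cong: if_cong)
  also have "L2n (\<lambda>j x. \<Sum>l=1..n. (if j = l then 1 else 0) * D l g x) {1..n} = L2n (\<lambda>k. D k g) {1..n}"
    by (intro ext L2_set_cong) (auto simp: if_distrib[of "\<lambda>t. t * _"] cong: if_cong)
  finally show ?thesis .
qed

text \<open>
The last level, up to \<open>k\<close>, at which the average of \<open>f\<close> more than doubled, compared with the preceding such level.
Since the average at level \<open>0\<close> is zero, the first level with a positive average is one of them.
\<close>
primrec stop :: "nat \<Rightarrow> ('a \<Rightarrow> real) \<Rightarrow> 'a \<Rightarrow> nat" where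
  "stop 0 f x = 0"
| "stop (Suc k) f x = (if E (Suc k) f x > 2 * E (stop k f x) f x then Suc k else stop k f x)"

lemma stop_le: "stop k f x \<le> k"
  by (induction k) (auto intro: le_SucI)

lemma stop_cst:
  assumes "x \<in> X" "y \<in> X"
  shows "lab k x = lab k y \<Longrightarrow> stop k f x = stop k f y"
proof (induction k)
  case (Suc k)
  have s: "stop k f x = stop k f y" using Suc.IH refine[OF assms Suc.prems] by simp
  have "E (Suc k) f x = E (Suc k) f y" using cstD[OF cst_E assms Suc.prems] .
  moreover have "E (stop k f y) f x = E (stop k f y) f y"
    using cstD[OF cst_E assms] lab_antimono[OF _ assms Suc.prems] stop_le[of k f y] by simp
  ultimately show ?case by (simp add: s)
qed simp

lemma E_le_stop:
  assumes "\<And>y. 0 \<le> f y"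
  shows "E k f x \<le> 2 * E (stop k f x) f x"
proof (induction k)
  case (Suc k)
  then show ?case using E_nonneg[of f "Suc k" x] assms by auto
qed simp

lemma stop_idem: "stop k f x = j \<Longrightarrow> stop j f x = j"
proof (induction k)
  case (Suc k)
  then show ?case by (cases "E (Suc k) f x > 2 * E (stop k f x) f x") (auto split: if_splits)
qed auto

text \<open>
Along the stopping levels the averages grow geometrically, so the sum of their squares is comparable to the
square of the last one.
\<close>
lemma sum_stop_le:
  assumes "\<And>y. 0 \<le> f y"
  shows "(\<Sum>j=1..k. (if stop j f x = j then E j f x else 0)\<^sup>2) \<le> 2 * (E (stop k f x) f x)\<^sup>2"
proof (induction k)
  case (Suc k)
  show ?case
  proof (cases "E (Suc k) f x > 2 * E (stop k f x) f x")
    case True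
    have "0 \<le> E (stop k f x) f x" using assms by (rule E_nonneg)
    then have "(2 * E (stop k f x) f x)\<^sup>2 \<le> (E (Suc k) f x)\<^sup>2" using True by (intro power_mono) auto
    then have "2 * (E (stop k f x) f x)\<^sup>2 \<le> (E (Suc k) f x)\<^sup>2"
      using zero_le_power2[of "E (stop k f x) f x"] unfolding power_mult_distrib power2_eq_square[of "2::real"] by linarith
    then show ?thesis using True order_trans[OF Suc] by simp
  next
    case False
    then have "stop (Suc k) f x \<noteq> Suc k" using stop_le[of k f x] by simp
    then show ?thesis using False Suc by simp
  qed
qed simp

end

text \<open>
The parameter \<open>\<rho>\<close> is the reciprocal of the volume of a cell, and \<open>apq\<close> is the quadratic condition with constant \<open>A\<close>, for
coefficients that are indexed by the cells of the levels \<open>1, \<dots>, L\<close>.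
\<close>
locale two_weight = S: weighted_filtration X lab \<sigma> + W: weighted_filtration X lab w
  for X :: "'a set" and lab :: "nat \<Rightarrow> 'a \<Rightarrow> 'b" and \<sigma> w :: "'a \<Rightarrow> real" +
  fixes p q :: real and \<rho> :: "nat \<Rightarrow> 'a \<Rightarrow> real" and L :: nat and A :: real
  assumes p: "1 < p" and q: "1 < q" and A: "0 \<le> A"
    and \<rho>_nonneg: "x \<in> X \<Longrightarrow> 0 \<le> \<rho> k x" and \<rho>_cst: "S.cst k (\<rho> k)"
    and apq: "(\<And>k. S.cst k (a k)) \<Longrightarrow>
      W.nrm q (\<lambda>x. L2_set (\<lambda>k. a k x * (S.mass k x * \<rho> k x)) {1..L}) \<le> A * S.nrm p (\<lambda>x. L2_set (\<lambda>k. a k x) {1..L})"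
begin

lemma I_mass_swap:
  assumes "S.cst k c"
  shows "S.I (\<lambda>x. W.mass k x * c x) = W.I (\<lambda>x. S.mass k x * c x)"
proof -
  have "S.I (\<lambda>x. W.mass k x * c x) = (\<Sum>x\<in>X. \<Sum>y\<in>X. if lab k y = lab k x then \<sigma> x * w y * c x else 0)"
    unfolding S.I_def W.mass_def S.cell_def sum.inter_filter[OF S.finite_X] sum_distrib_right sum_distrib_left
    by (intro sum.cong) auto
  also have "\<dots> = (\<Sum>y\<in>X. \<Sum>x\<in>X. if lab k y = lab k x then \<sigma> x * w y * c x else 0)" by (rule sum.swap)
  also have "\<dots> = (\<Sum>y\<in>X. \<Sum>x\<in>X. if lab k x = lab k y then \<sigma> x * w y * c y else 0)"
  proof (intro sum.cong refl)
    fix x y assume "x \<in> X" "y \<in> X"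
    then show "(if lab k y = lab k x then \<sigma> x * w y * c x else 0) = (if lab k x = lab k y then \<sigma> x * w y * c y else 0)"
      using S.cstD[OF assms, of x y] by auto
  qed
  also have "\<dots> = W.I (\<lambda>x. S.mass k x * c x)"
    unfolding W.I_def S.mass_def S.cell_def sum.inter_filter[OF S.finite_X] sum_distrib_right sum_distrib_left
    by (intro sum.cong) auto
  finally show ?thesis .
qed

text \<open>
After linearisation, the weighted mass of a cell is moved from \<open>w\<close> to \<open>\<sigma>\<close> (\<open>I_mass_swap\<close>), which leaves the quadratic
condition for the averages of the dual family; Stein's inequality removes the averages.
\<close>
lemma dual_apq:
  assumes b: "\<And>k. S.cst k (b k)"
  shows "S.nrm (p / (p - 1)) (\<lambda>x. L2_set (\<lambda>k. b k x * (W.mass k x * \<rho> k x)) {1..L})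
    \<le> stein_norm p * A * W.nrm (q / (q - 1)) (\<lambda>x. L2_set (\<lambda>k. b k x) {1..L})"
proof -
  define P where "P = p / (p - 1)"
  have P: "P > 1" "(P - 1) * p = P" "1 - 1 / p = 1 / P" using p by (auto simp: P_def field_simps)
  define h where "h = (\<lambda>k x. b k x * (W.mass k x * \<rho> k x))"
  define G where "G = S.L2n h {1..L}"
  define \<psi> where "\<psi> = (\<lambda>k x. h k x * G x powr (P - 2))"
  have L2psi: "S.L2n \<psi> {1..L} x = G x powr (P - 1)" for x
    unfolding \<psi>_def G_def by (rule L2_set_linearize)
  have lin: "(\<Sum>k=1..L. \<psi> k x * h k x) = G x powr P" for x
    using L2_set_linearize(1)[of "\<lambda>k. h k x" "{1..L}" P] by (simp add: \<psi>_def G_def mult_ac)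
  define N where "N = S.I (\<lambda>x. G x powr P)"
  have N0: "N \<ge> 0" by (auto simp: N_def intro!: S.I_nonneg)
  define V where "V = W.nrm (q / (q - 1)) (W.L2n b {1..L})"
  define K where "K = stein_norm p * A * V"
  have "N = S.I (\<lambda>x. \<Sum>k=1..L. \<psi> k x * h k x)" by (simp only: N_def lin)
  also have "\<dots> = (\<Sum>k=1..L. W.I (\<lambda>x. (S.E k (\<psi> k) x * (S.mass k x * \<rho> k x)) * b k x))"
    unfolding S.I_sum
  proof (rule sum.cong[OF refl])
    fix k assume k: "k \<in> {1..L}"
    have c: "S.cst k (h k)" unfolding h_def by (intro S.cst_mult b W.cst_mass \<rho>_cst)
    have "S.I (\<lambda>x. \<psi> k x * h k x) = S.I (\<lambda>x. S.E k (\<psi> k) x * h k x)"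
      using S.I_E_mult[OF c, of "\<psi> k"] k by simp
    also have "\<dots> = S.I (\<lambda>x. W.mass k x * (S.E k (\<psi> k) x * \<rho> k x * b k x))"
      by (simp add: h_def mult_ac)
    also have "\<dots> = W.I (\<lambda>x. S.mass k x * (S.E k (\<psi> k) x * \<rho> k x * b k x))"
      by (intro I_mass_swap S.cst_mult b \<rho>_cst S.cst_E)
    finally show "S.I (\<lambda>x. \<psi> k x * h k x) = W.I (\<lambda>x. (S.E k (\<psi> k) x * (S.mass k x * \<rho> k x)) * b k x)"
      by (simp add: mult_ac)
  qed
  also have "\<dots> \<le> (\<Sum>k=1..L. W.I (\<lambda>x. \<bar>S.E k (\<psi> k) x * (S.mass k x * \<rho> k x)\<bar> * \<bar>b k x\<bar>))"
    by (intro sum_mono W.I_mono) (metis abs_ge_self abs_mult)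
  also have "\<dots> \<le> W.nrm q (W.L2n (\<lambda>k x. S.E k (\<psi> k) x * (S.mass k x * \<rho> k x)) {1..L}) * V"
    unfolding V_def by (rule W.holder_L2[OF q])
  also have "\<dots> \<le> (A * S.nrm p (S.L2n (\<lambda>k. S.E k (\<psi> k)) {1..L})) * V"
    by (intro mult_right_mono apq S.cst_E) (simp add: V_def)
  also have "\<dots> \<le> (A * (stein_norm p * S.nrm p (S.L2n \<psi> {1..L}))) * V"
    by (intro mult_right_mono mult_left_mono S.stein_nrm p A) (simp add: V_def)
  also have "S.nrm p (S.L2n \<psi> {1..L}) = N powr (1 / p)"
    unfolding L2psi S.nrm_def N_def using P by (simp add: powr_powr)
  finally have NK: "N \<le> K * N powr (1 / p)" by (simp add: K_def mult_ac)
  have K0: "K \<ge> 0" using A by (simp add: K_def V_def stein_norm_def)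
  have "N powr (1 / P) \<le> K"
  proof (cases "N = 0")
    case False
    then have "N powr (1 / p) * N powr (1 / P) \<le> N powr (1 / p) * K"
      using NK N0 by (simp add: mult.commute P(3)[symmetric] flip: powr_add)
    then show ?thesis using False by (simp add: mult_le_cancel_left)
  qed (simp add: K0)
  then show ?thesis by (simp add: K_def V_def N_def S.nrm_def G_def h_def P_def)
qed

end

section \<open>The bilinear form of a shift on a finite filtered set\<close>

text \<open>
An operator with levels \<open>1, \<dots>, K\<close> whose part of level \<open>k\<close> has a kernel that is supported on pairs in the same cell of
level \<open>k\<close>, is bounded by the reciprocal volume, and is constant on cells of level \<open>k + r\<close> in each variable.
The assumption \<open>testing\<close> is the testing condition on the cells, for the operator without truncation.
\<close>
locale two_weight_shift = two_weight X lab \<sigma> w p q \<rho> L A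
  for X :: "'a set" and lab :: "nat \<Rightarrow> 'a \<Rightarrow> 'b" and \<sigma> w p q \<rho> L A +
  fixes ker :: "nat \<Rightarrow> 'a \<Rightarrow> 'a \<Rightarrow> real" and K r :: nat and T :: real
  assumes L: "L = K + r" and r: "0 < r" and T: "0 \<le> T"
    and ker_loc: "\<lbrakk>x \<in> X; y \<in> X; k \<in> {1..K}; ker k x y \<noteq> 0\<rbrakk> \<Longrightarrow> lab k x = lab k y"
    and ker_le: "\<lbrakk>x \<in> X; y \<in> X; k \<in> {1..K}\<rbrakk> \<Longrightarrow> \<bar>ker k x y\<bar> \<le> \<rho> k x"
    and ker_cst1: "\<lbrakk>k \<in> {1..K}; y \<in> X\<rbrakk> \<Longrightarrow> S.cst (k + r) (\<lambda>x. ker k x y)"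
    and ker_cst2: "\<lbrakk>k \<in> {1..K}; x \<in> X\<rbrakk> \<Longrightarrow> S.cst (k + r) (\<lambda>y. ker k x y)"
    and \<rho>_double: "\<lbrakk>x \<in> X; 1 \<le> k\<rbrakk> \<Longrightarrow> 2 * \<rho> k x \<le> \<rho> (Suc k) x"
    and testing: "(\<And>k. S.cst k (a k)) \<Longrightarrow>
      W.nrm q (\<lambda>x. L2_set (\<lambda>k. a k x * (\<Sum>j\<in>{1..K}. \<Sum>y\<in>S.cell k x. ker j x y * \<sigma> y)) {1..L})
        \<le> T * S.nrm p (\<lambda>x. L2_set (\<lambda>k. a k x) {1..L})"
begin

text \<open>
The part of level \<open>k\<close> applied to the constant function \<open>1\<close>; by locality, on a cell of level at most \<open>k\<close> it is also
the result for the indicator of the cell.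
\<close>
definition op_one :: "nat \<Rightarrow> 'a \<Rightarrow> real" where
  "op_one k x = (\<Sum>y\<in>X. ker k x y * \<sigma> y)"

text \<open>
At a point \<open>x\<close>, this is the operator truncated to the subcells of the cell of level \<open>k\<close> around \<open>x\<close>, applied to the
indicator of that cell.
\<close>
definition trunc_one :: "nat \<Rightarrow> 'a \<Rightarrow> real" where
  "trunc_one k x = (\<Sum>j\<in>{j \<in> {1..K}. k \<le> j}. op_one j x)"

definition form :: "nat \<Rightarrow> ('a \<Rightarrow> real) \<Rightarrow> ('a \<Rightarrow> real) \<Rightarrow> real" where
  "form k f g = (\<Sum>x\<in>X. \<Sum>y\<in>X. ker k x y * (\<sigma> y * f y) * (w x * g x))"

lemma form_eq: "form k f g = W.I (\<lambda>x. (\<Sum>y\<in>X. ker k x y * (\<sigma> y * f y)) * g x)"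
  by (simp add: form_def W.I_def sum_distrib_left sum_distrib_right mult_ac)

lemma form_eq': "form k f g = S.I (\<lambda>y. (\<Sum>x\<in>X. ker k x y * (w x * g x)) * f y)"
  unfolding form_def by (subst sum.swap) (simp add: S.I_def sum_distrib_left sum_distrib_right mult_ac)

lemma form_add1: "form k (\<lambda>x. f x + f' x) g = form k f g + form k f' g"
  and form_add2: "form k f (\<lambda>x. g x + g' x) = form k f g + form k f g'"
  by (simp_all add: form_def sum.distrib algebra_simps)

lemma form_sum1: "form k (\<lambda>x. \<Sum>i\<in>J. f i x) g = (\<Sum>i\<in>J. form k (f i) g)"
  by (induction J rule: infinite_finite_induct) (auto simp: form_add1, simp_all add: form_def)

lemma form_sum2: "form k f (\<lambda>x. \<Sum>i\<in>J. g i x) = (\<Sum>i\<in>J. form k f (g i))"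
  by (induction J rule: infinite_finite_induct) (auto simp: form_add2, simp_all add: form_def)

lemma form_cond_exp:
  assumes k: "k \<in> {1..K}"
  shows "form k f g = form k (S.E (k + r) f) (W.E (k + r) g)"
proof -
  have "form k f g = form k (S.E (k + r) f) g"
  proof -
    have "S.I (\<lambda>y. f y * ker k x y) = S.I (\<lambda>y. S.E (k + r) f y * ker k x y)" if "x \<in> X" for x
      using S.I_E_mult[OF ker_cst2[OF k that], of f] k by simp
    then have "(\<Sum>y\<in>X. ker k x y * (\<sigma> y * f y)) = (\<Sum>y\<in>X. ker k x y * (\<sigma> y * S.E (k + r) f y))" if "x \<in> X" for x
      using that by (simp add: S.I_def mult_ac)
    then show ?thesis unfolding form_eq by (intro W.I_cong) simp
  qed
  also have "\<dots> = form k (S.E (k + r) f) (W.E (k + r) g)"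
  proof -
    have "W.I (\<lambda>x. g x * ker k x y) = W.I (\<lambda>x. W.E (k + r) g x * ker k x y)" if "y \<in> X" for y
      using W.I_E_mult[OF ker_cst1[OF k that], of g] k by simp
    then have "(\<Sum>x\<in>X. ker k x y * (w x * g x)) = (\<Sum>x\<in>X. ker k x y * (w x * W.E (k + r) g x))" if "y \<in> X" for y
      using that by (simp add: W.I_def mult_ac)
    then show ?thesis unfolding form_eq' by (intro S.I_cong) simp
  qed
  finally show ?thesis .
qed

lemma form_cst:
  assumes k: "k \<in> {1..K}" and f: "S.cst k f"
  shows "form k f g = W.I (\<lambda>x. f x * g x * op_one k x)"
  unfolding form_eq
proof (rule W.I_cong)
  fix x assume x: "x \<in> X"
  have "(\<Sum>y\<in>X. ker k x y * (\<sigma> y * f y)) = (\<Sum>y\<in>X. f x * (ker k x y * \<sigma> y))"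
  proof (rule sum.cong[OF refl])
    fix y assume y: "y \<in> X"
    show "ker k x y * (\<sigma> y * f y) = f x * (ker k x y * \<sigma> y)"
      using ker_loc[OF x y k] S.cstD[OF f x y] by (cases "ker k x y = 0") auto
  qed
  then show "(\<Sum>y\<in>X. ker k x y * (\<sigma> y * f y)) * g x = f x * g x * op_one k x"
    by (simp add: op_one_def sum_distrib_left mult_ac)
qed

lemma op_one_cst: "k \<in> {1..K} \<Longrightarrow> S.cst (k + r) (op_one k)"
  unfolding op_one_def by (intro S.cst_sum S.cst_mult ker_cst1 S.cst_const)

text \<open>
The kernel is at most the reciprocal volume on each cell, so this form is dominated by the averaging operator.
\<close>
lemma abs_form_le:
  assumes k: "k \<in> {1..K}"
  shows "\<bar>form k u v\<bar> \<le> W.I (\<lambda>x. \<bar>S.E k (\<lambda>y. \<bar>u y\<bar>) x * (S.mass k x * \<rho> k x)\<bar> * \<bar>v x\<bar>)"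
proof -
  have "\<bar>form k u v\<bar> \<le> W.I (\<lambda>x. \<bar>(\<Sum>y\<in>X. ker k x y * (\<sigma> y * u y)) * v x\<bar>)"
    unfolding form_eq W.I_def using W.nonneg
    by (intro order_trans[OF sum_abs] sum_mono) (simp add: abs_mult)
  also have "\<dots> \<le> W.I (\<lambda>x. \<bar>S.E k (\<lambda>y. \<bar>u y\<bar>) x * (S.mass k x * \<rho> k x)\<bar> * \<bar>v x\<bar>)"
    unfolding abs_mult[of _ "v _"]
  proof (intro W.I_mono mult_right_mono)
    fix x assume x: "x \<in> X"
    have "\<bar>\<Sum>y\<in>X. ker k x y * (\<sigma> y * u y)\<bar> \<le> (\<Sum>y\<in>X. if lab k y = lab k x then \<rho> k x * (\<sigma> y * \<bar>u y\<bar>) else 0)"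
    proof (intro order_trans[OF sum_abs] sum_mono)
      fix y assume y: "y \<in> X"
      show "\<bar>ker k x y * (\<sigma> y * u y)\<bar> \<le> (if lab k y = lab k x then \<rho> k x * (\<sigma> y * \<bar>u y\<bar>) else 0)"
        using ker_loc[OF x y k] ker_le[OF x y k] S.nonneg[OF y]
        by (cases "ker k x y = 0") (auto simp: abs_mult intro!: mult_right_mono)
    qed
    also have "\<dots> = \<rho> k x * (\<Sum>y\<in>S.cell k x. \<sigma> y * \<bar>u y\<bar>)"
      unfolding S.cell_def sum.inter_filter[OF S.finite_X] sum_distrib_left by (intro sum.cong) auto
    also have "\<dots> = S.E k (\<lambda>y. \<bar>u y\<bar>) x * (S.mass k x * \<rho> k x)"
      using k S.E_mass[of k "\<lambda>y. \<bar>u y\<bar>" x] by (simp add: mult_ac)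
    finally show "\<bar>\<Sum>y\<in>X. ker k x y * (\<sigma> y * u y)\<bar> \<le> \<bar>S.E k (\<lambda>y. \<bar>u y\<bar>) x * (S.mass k x * \<rho> k x)\<bar>"
      by linarith
  qed simp
  finally show ?thesis .
qed

text \<open>
Here \<open>u\<close> and \<open>v\<close> are arbitrary; no cancellation is used, only the size of the kernel.
\<close>
lemma near_diagonal_bound:
  "\<bar>\<Sum>k=1..K. form k (u k) (v k)\<bar>
    \<le> A * stein_norm p * S.nrm p (S.L2n u {1..L}) * W.nrm (q / (q - 1)) (W.L2n v {1..L})"
proof -
  define Z where "Z = (\<lambda>k x. S.E k (\<lambda>y. \<bar>u k y\<bar>) x * (S.mass k x * \<rho> k x))"
  define V where "V = W.nrm (q / (q - 1)) (W.L2n v {1..L})"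
  have "\<bar>\<Sum>k=1..K. form k (u k) (v k)\<bar> \<le> (\<Sum>k=1..K. W.I (\<lambda>x. \<bar>Z k x\<bar> * \<bar>v k x\<bar>))"
    unfolding Z_def by (intro order_trans[OF sum_abs] sum_mono abs_form_le)
  also have "\<dots> \<le> (\<Sum>k=1..L. W.I (\<lambda>x. \<bar>Z k x\<bar> * \<bar>v k x\<bar>))"
    using L by (intro sum_mono2) (auto intro!: W.I_nonneg)
  also have "\<dots> \<le> W.nrm q (W.L2n Z {1..L}) * V" unfolding V_def by (rule W.holder_L2[OF q])
  also have "\<dots> \<le> (A * S.nrm p (S.L2n (\<lambda>k. S.E k (\<lambda>y. \<bar>u k y\<bar>)) {1..L})) * V"
    unfolding Z_def by (intro mult_right_mono apq S.cst_E) (simp add: V_def)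
  also have "\<dots> \<le> (A * (stein_norm p * S.nrm p (S.L2n (\<lambda>k y. \<bar>u k y\<bar>) {1..L}))) * V"
    by (intro mult_right_mono mult_left_mono S.stein_nrm p A) (simp add: V_def)
  also have "S.L2n (\<lambda>k y. \<bar>u k y\<bar>) {1..L} = S.L2n u {1..L}" by (simp add: L2_set_def)
  finally show ?thesis by (simp add: V_def mult_ac)
qed

lemma sum_rho_le: "x \<in> X \<Longrightarrow> (\<Sum>j\<in>{j \<in> {1..K}. j < k}. \<rho> j x) \<le> \<rho> k x"
proof (induction k)
  case (Suc k)
  have "{j \<in> {1..K}. j < Suc k} = (if k \<in> {1..K} then insert k {j \<in> {1..K}. j < k} else {j \<in> {1..K}. j < k})"
    by auto
  then have "(\<Sum>j\<in>{j \<in> {1..K}. j < Suc k}. \<rho> j x) \<le> \<rho> k x + (if k = 0 then 0 else \<rho> k x)"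
    using Suc \<rho>_nonneg[of x k] by (auto split: if_splits)
  also have "\<dots> \<le> \<rho> (Suc k) x" if "k \<noteq> 0" using \<rho>_double[of x k] Suc.prems that by simp
  finally have "(\<Sum>j\<in>{j \<in> {1..K}. j < Suc k}. \<rho> j x) \<le> \<rho> (Suc k) x" if "k \<noteq> 0" using that .
  moreover have "(\<Sum>j\<in>{j \<in> {1..K}. j < Suc k}. \<rho> j x) = 0" if "k = 0"
    using that by (intro sum.neutral) auto
  ultimately show ?case
    using \<rho>_nonneg[OF Suc.prems, of "Suc k"] by (cases "k = 0") simp_all
qed (simp add: \<rho>_nonneg)

text \<open>
The levels before \<open>k\<close> that the truncation removes contribute at most the mass of the cell times the sum of the
reciprocal volumes of its proper ancestors, a geometric series.
\<close>
lemma trunc_one_le: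
  assumes x: "x \<in> X"
  shows "\<bar>trunc_one k x\<bar> \<le> \<bar>\<Sum>j\<in>{1..K}. \<Sum>y\<in>S.cell k x. ker j x y * \<sigma> y\<bar> + S.mass k x * \<rho> k x"
proof -
  define s where "s = (\<lambda>j. \<Sum>y\<in>S.cell k x. ker j x y * \<sigma> y)"
  have "(\<Sum>j\<in>{1..K}. s j) = (\<Sum>j\<in>{j \<in> {1..K}. k \<le> j}. s j) + (\<Sum>j\<in>{j \<in> {1..K}. j < k}. s j)"
    by (subst sum.union_disjoint[symmetric]) (auto intro!: sum.cong)
  moreover have "(\<Sum>j\<in>{j \<in> {1..K}. k \<le> j}. s j) = trunc_one k x"
    unfolding trunc_one_def s_def op_one_def
  proof (rule sum.cong[OF refl], rule sum.mono_neutral_left[OF S.finite_X S.cell_subset], rule ballI)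
    fix j y assume j: "j \<in> {j \<in> {1..K}. k \<le> j}" and y: "y \<in> X - S.cell k x"
    then have "lab j x \<noteq> lab j y" using S.lab_antimono[of k j x y] x by (auto simp: S.cell_def)
    then show "ker j x y * \<sigma> y = 0" using ker_loc[of x y j] x y j by auto
  qed
  moreover have "\<bar>\<Sum>j\<in>{j \<in> {1..K}. j < k}. s j\<bar> \<le> S.mass k x * \<rho> k x"
  proof -
    have "\<bar>s j\<bar> \<le> \<rho> j x * S.mass k x" if "j \<in> {1..K}" for j
      unfolding s_def S.mass_def sum_distrib_left
    proof (intro order_trans[OF sum_abs] sum_mono)
      fix y assume "y \<in> S.cell k x"
      then have "y \<in> X" by (simp add: S.cell_def)
      then show "\<bar>ker j x y * \<sigma> y\<bar> \<le> \<rho> j x * \<sigma> y"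
        using ker_le[OF x _ that] S.nonneg by (simp add: abs_mult mult_right_mono)
    qed
    then have "\<bar>\<Sum>j\<in>{j \<in> {1..K}. j < k}. s j\<bar> \<le> (\<Sum>j\<in>{j \<in> {1..K}. j < k}. \<rho> j x * S.mass k x)"
      by (intro order_trans[OF sum_abs] sum_mono) auto
    also have "\<dots> \<le> \<rho> k x * S.mass k x"
      unfolding sum_distrib_right[symmetric] by (intro mult_right_mono sum_rho_le x S.mass_nonneg)
    finally show ?thesis by (simp add: mult.commute)
  qed
  ultimately show ?thesis unfolding s_def by linarith
qed

text \<open>
Testing for the truncated operator: the truncation error is bounded pointwise and falls under the quadratic condition.
\<close>
lemma test_bound:
  assumes a: "\<And>k. S.cst k (a k)"
  shows "\<bar>\<Sum>k=1..L. W.I (\<lambda>x. a k x * b k x * trunc_one k x)\<bar>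
    \<le> (T + A) * S.nrm p (S.L2n a {1..L}) * W.nrm (q / (q - 1)) (W.L2n b {1..L})"
proof -
  define t where "t = (\<lambda>k x. a k x * (\<Sum>j\<in>{1..K}. \<Sum>y\<in>S.cell k x. ker j x y * \<sigma> y))"
  define m where "m = (\<lambda>k x. a k x * (S.mass k x * \<rho> k x))"
  define V where "V = W.nrm (q / (q - 1)) (W.L2n b {1..L})"
  have V: "V \<ge> 0" by (simp add: V_def)
  have "\<bar>\<Sum>k=1..L. W.I (\<lambda>x. a k x * b k x * trunc_one k x)\<bar> \<le> (\<Sum>k=1..L. W.I (\<lambda>x. \<bar>a k x * b k x * trunc_one k x\<bar>))"
    unfolding W.I_def using W.nonneg
    by (intro order_trans[OF sum_abs] sum_mono) (auto intro!: order_trans[OF sum_abs] simp: abs_mult)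
  also have "\<dots> \<le> (\<Sum>k=1..L. W.I (\<lambda>x. \<bar>t k x\<bar> * \<bar>b k x\<bar> + \<bar>m k x\<bar> * \<bar>b k x\<bar>))"
  proof (intro sum_mono W.I_mono)
    fix k x assume x: "x \<in> X"
    have "\<bar>a k x\<bar> * \<bar>trunc_one k x\<bar> \<le> \<bar>a k x\<bar> * (\<bar>\<Sum>j\<in>{1..K}. \<Sum>y\<in>S.cell k x. ker j x y * \<sigma> y\<bar> + S.mass k x * \<rho> k x)"
      using trunc_one_le[OF x] by (intro mult_left_mono) auto
    also have "\<dots> = \<bar>t k x\<bar> + \<bar>m k x\<bar>"
      using S.mass_nonneg[of k x] \<rho>_nonneg[OF x, of k] by (simp add: t_def m_def abs_mult distrib_left)
    finally have "\<bar>b k x\<bar> * (\<bar>a k x\<bar> * \<bar>trunc_one k x\<bar>) \<le> \<bar>b k x\<bar> * (\<bar>t k x\<bar> + \<bar>m k x\<bar>)"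
      by (rule mult_left_mono) simp
    then show "\<bar>a k x * b k x * trunc_one k x\<bar> \<le> \<bar>t k x\<bar> * \<bar>b k x\<bar> + \<bar>m k x\<bar> * \<bar>b k x\<bar>"
      by (simp add: abs_mult algebra_simps)
  qed
  also have "\<dots> = (\<Sum>k=1..L. W.I (\<lambda>x. \<bar>t k x\<bar> * \<bar>b k x\<bar>)) + (\<Sum>k=1..L. W.I (\<lambda>x. \<bar>m k x\<bar> * \<bar>b k x\<bar>))"
    by (simp add: W.I_add sum.distrib)
  also have "\<dots> \<le> W.nrm q (W.L2n t {1..L}) * V + W.nrm q (W.L2n m {1..L}) * V"
    unfolding V_def by (intro add_mono W.holder_L2[OF q])
  also have "\<dots> \<le> (T * S.nrm p (S.L2n a {1..L})) * V + (A * S.nrm p (S.L2n a {1..L})) * V"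
    unfolding t_def m_def using a V by (intro add_mono mult_right_mono testing apq) auto
  finally show ?thesis by (simp add: V_def algebra_simps)
qed

lemma sum_triangle_swap:
  "(\<Sum>k=1..K. \<Sum>l=1..k. F k l) = (\<Sum>l=1..L. \<Sum>k\<in>{k \<in> {1..K}. l \<le> k}. (F k l :: real))"
proof -
  have "(\<Sum>k=1..K. \<Sum>l=1..k. F k l) = (\<Sum>k\<in>{1..K}. \<Sum>l\<in>{l \<in> {1..L}. l \<le> k}. F k l)"
    using L by (intro sum.cong) auto
  also have "\<dots> = (\<Sum>l\<in>{1..L}. \<Sum>k\<in>{k \<in> {1..K}. l \<le> k}. F k l)" by (rule sum.swap_restrict) auto
  finally show ?thesis .
qed

text \<open>
Fix a point and a level \<open>l\<close>. The average \<open>f\<^sub>l\<^sub>-\<^sub>1\<^sub>-\<^sub>r\<close> is constant on cells of every level \<open>k\<close> that occurs, so the sum over \<open>k\<close>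
is this average times a truncation of the operator applied to \<open>1\<close>. The truncation may begin at any level up to \<open>l - r\<close>,
because the parts of the levels \<open>k < l - r\<close> are constant on cells of level \<open>l - 1\<close> and the increment of \<open>g\<close> integrates to zero
there. It is made to begin at the last stopping level \<open>j\<close> up to \<open>l - 1 - r\<close>, and the average of \<open>f\<close> is at most twice
the average \<open>a\<^sub>j\<close> of \<open>|f|\<close> at that level. Collecting the increments with the same \<open>j\<close> gives a martingale transform \<open>Y\<^sub>j\<close>, and the
testing condition applies to the sum over \<open>j\<close> of \<open>a\<^sub>j Y\<^sub>j\<close> times the truncation at \<open>j\<close>.
\<close>
lemma paraproduct_bound:
  "\<bar>\<Sum>k=1..K. \<Sum>l=1..k + r. form k (S.E (l - 1 - r) f) (W.D l g)\<bar>
    \<le> (T + A) * (2 * sqrt 2 * doob_norm p * transform_norm (q / (q - 1))) * S.nrm p f * W.nrm (q / (q - 1)) g"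
proof -
  define Q where "Q = q / (q - 1)"
  have Q: "Q > 1" using q by (simp add: Q_def)
  define F where "F = (\<lambda>x. \<bar>f x\<bar>)"
  have F0: "\<And>y. 0 \<le> F y" by (simp add: F_def)
  define st where "st = (\<lambda>k x. S.stop k F x)"
  have st_le: "st k x \<le> k" for k x unfolding st_def by (rule S.stop_le)
  have st_eq: "lab k x = lab k y \<Longrightarrow> st k x = st k y" if "x \<in> X" "y \<in> X" for k x y
    unfolding st_def by (rule S.stop_cst[OF that])
  define a where "a = (\<lambda>j x. if st j x = j then S.E j F x else 0)"
  have a_cst: "S.cst j (a j)" for j
  proof (rule S.cstI)
    fix x y assume xy: "x \<in> X" "y \<in> X" "lab j x = lab j y"
    show "a j x = a j y" using st_eq[OF xy] S.cstD[OF S.cst_E xy] by (simp add: a_def)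
  qed
  have f_le: "\<bar>S.E k f x\<bar> \<le> 2 * a (st k x) x" for k x
  proof -
    have "st (st k x) x = st k x" unfolding st_def by (rule S.stop_idem) simp
    then have "a (st k x) x = S.E (st k x) F x" by (simp add: a_def)
    then show ?thesis using S.E_abs_le[of k f x] S.E_le_stop[of F, OF F0, of k x] by (simp add: F_def st_def)
  qed
  have a0: "a 0 x = 0" for x by (simp add: a_def)
  \<comment> \<open>Where \<open>a j x\<close> vanishes, so does the numerator by \<open>f_le\<close>.\<close>
  define \<epsilon> where "\<epsilon> = (\<lambda>j l x. if st (l - 1 - r) x = j then S.E (l - 1 - r) f x / (2 * a j x) else 0)"
  have eps_le: "\<bar>S.E k f x / (2 * a (st k x) x)\<bar> \<le> 1" for k x
    using f_le[of k x] by (cases "a (st k x) x = 0") (auto simp: field_simps abs_if split: if_splits)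
  have eps_cst: "S.cst (l - 1) (\<epsilon> j l)" for j l
  proof (rule S.cst_mono[of "l - 1 - r"], simp, rule S.cstI)
    fix x y assume xy: "x \<in> X" "y \<in> X" "lab (l - 1 - r) x = lab (l - 1 - r) y"
    have "st (l - 1 - r) x = st (l - 1 - r) y" by (rule st_eq[OF xy])
    moreover have "S.E (l - 1 - r) f x = S.E (l - 1 - r) f y" by (rule S.cstD[OF S.cst_E xy])
    moreover have "a j x = a j y" if "j \<le> l - 1 - r" for j
      by (rule S.cstD[OF S.cst_mono[OF that a_cst] xy])
    ultimately show "\<epsilon> j l x = \<epsilon> j l y" using st_le[of "l - 1 - r" y] by (auto simp: \<epsilon>_def)
  qed
  have eps_sum: "(\<Sum>j\<in>{1..L}. (\<epsilon> j l x)\<^sup>2) \<le> 1" for l x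
  proof -
    have "(\<Sum>j\<in>{1..L}. (\<epsilon> j l x)\<^sup>2) = (\<Sum>j\<in>{1..L}. if st (l - 1 - r) x = j then (S.E (l - 1 - r) f x / (2 * a j x))\<^sup>2 else 0)"
      by (intro sum.cong) (auto simp: \<epsilon>_def)
    also have "\<dots> \<le> (S.E (l - 1 - r) f x / (2 * a (st (l - 1 - r) x) x))\<^sup>2" by simp
    also have "\<dots> \<le> 1" using eps_le by (simp add: abs_square_le_1)
    finally show ?thesis .
  qed
  define Y where "Y = (\<lambda>j x. \<Sum>l=1..L. \<epsilon> j l x * W.D l g x)"
  have swap: "(\<Sum>k=1..K. \<Sum>l=1..k + r. G k l) = (\<Sum>l=1..L. \<Sum>k\<in>{k \<in> {1..K}. l \<le> k + r}. (G k l :: real))" for G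
  proof -
    have "(\<Sum>k=1..K. \<Sum>l=1..k + r. G k l) = (\<Sum>k\<in>{1..K}. \<Sum>l\<in>{l \<in> {1..L}. l \<le> k + r}. G k l)"
      using L by (intro sum.cong) auto
    also have "\<dots> = (\<Sum>l\<in>{1..L}. \<Sum>k\<in>{k \<in> {1..K}. l \<le> k + r}. G k l)" by (rule sum.swap_restrict) auto
    finally show ?thesis .
  qed
  have "(\<Sum>k=1..K. \<Sum>l=1..k + r. form k (S.E (l - 1 - r) f) (W.D l g))
    = (\<Sum>l=1..L. W.I (\<lambda>x. S.E (l - 1 - r) f x * W.D l g x * trunc_one (st (l - 1 - r) x) x))"
    unfolding swap
  proof (rule sum.cong[OF refl])
    fix l assume l: "l \<in> {1..L}"
    define e where "e = S.E (l - 1 - r) f"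
    define s where "s = st (l - 1 - r)"
    \<comment> \<open>The parts between the stopping level and \<open>l - r\<close>, which are added at no cost.\<close>
    define h where "h = (\<lambda>x. e x * (\<Sum>k\<in>{1..K}. if s x \<le> k \<and> k + r < l then op_one k x else 0))"
    have e0: "e x = 0" if "l \<le> Suc r" for x using that by (simp add: e_def)
    have "(\<Sum>k\<in>{k \<in> {1..K}. l \<le> k + r}. form k e (W.D l g))
      = (\<Sum>k\<in>{k \<in> {1..K}. l \<le> k + r}. W.I (\<lambda>x. e x * W.D l g x * op_one k x))"
      by (intro sum.cong form_cst refl) (auto simp: e_def intro!: S.cst_E')
    also have "\<dots> = W.I (\<lambda>x. e x * W.D l g x * (\<Sum>k\<in>{k \<in> {1..K}. l \<le> k + r}. op_one k x))"
      by (simp add: W.I_sum sum_distrib_left)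
    also have "\<dots> = W.I (\<lambda>x. e x * W.D l g x * trunc_one (s x) x - W.D l g x * h x)"
    proof (rule W.I_cong)
      fix x
      show "e x * W.D l g x * (\<Sum>k\<in>{k \<in> {1..K}. l \<le> k + r}. op_one k x)
        = e x * W.D l g x * trunc_one (s x) x - W.D l g x * h x"
      proof (cases "l \<le> Suc r")
        case True then show ?thesis by (simp add: e0 h_def)
      next
        case False
        have "s x \<le> l - 1 - r" unfolding s_def by (rule st_le)
        then have "{k \<in> {1..K}. s x \<le> k} = {k \<in> {1..K}. l \<le> k + r} \<union> {k \<in> {1..K}. s x \<le> k \<and> k + r < l}"
          using False by auto
        then have "trunc_one (s x) x = (\<Sum>k\<in>{k \<in> {1..K}. l \<le> k + r} \<union> {k \<in> {1..K}. s x \<le> k \<and> k + r < l}. op_one k x)"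
          unfolding trunc_one_def by (rule arg_cong)
        also have "\<dots> = (\<Sum>k\<in>{k \<in> {1..K}. l \<le> k + r}. op_one k x) + (\<Sum>k\<in>{k \<in> {1..K}. s x \<le> k \<and> k + r < l}. op_one k x)"
        proof (rule sum.union_disjoint)
          show "{k \<in> {1..K}. l \<le> k + r} \<inter> {k \<in> {1..K}. s x \<le> k \<and> k + r < l} = {}" by fastforce
        qed simp_all
        also have "(\<Sum>k\<in>{k \<in> {1..K}. s x \<le> k \<and> k + r < l}. op_one k x)
          = (\<Sum>k\<in>{1..K}. if s x \<le> k \<and> k + r < l then op_one k x else 0)"
          by (rule sum.inter_filter) simp
        finally have "trunc_one (s x) x = (\<Sum>k\<in>{k \<in> {1..K}. l \<le> k + r}. op_one k x)
          + (\<Sum>k\<in>{1..K}. if s x \<le> k \<and> k + r < l then op_one k x else 0)" .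
        then show ?thesis by (simp add: h_def algebra_simps)
      qed
    qed
    also have "\<dots> = W.I (\<lambda>x. e x * W.D l g x * trunc_one (s x) x) - W.I (\<lambda>x. W.D l g x * h x)" by (rule W.I_diff)
    also have "W.I (\<lambda>x. W.D l g x * h x) = 0"
    proof (rule W.I_D_mult_eq_0)
      show "\<forall>x\<in>X. h x = 0" if "l \<le> 1" using that by (simp add: h_def e0)
      show "S.cst (l - 1) h"
        unfolding h_def
      proof (intro S.cst_mult S.cst_sum)
        show "S.cst (l - 1) e" unfolding e_def by (rule S.cst_E') simp
        fix k assume k: "k \<in> {1..K}"
        show "S.cst (l - 1) (\<lambda>x. if s x \<le> k \<and> k + r < l then op_one k x else 0)"
        proof (cases "k + r < l")
          case True
          then have c: "S.cst (l - 1) (op_one k)" using op_one_cst[OF k] by (intro S.cst_mono[of "k + r" "l - 1"]) auto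
          have s: "s x = s y" if "x \<in> X" "y \<in> X" "lab (l - 1) x = lab (l - 1) y" for x y
            unfolding s_def using that S.lab_antimono[of "l - 1 - r" "l - 1" x y] by (intro st_eq) auto
          show ?thesis
          proof (rule S.cstI)
            fix x y assume xy: "x \<in> X" "y \<in> X" "lab (l - 1) x = lab (l - 1) y"
            show "(if s x \<le> k \<and> k + r < l then op_one k x else 0) = (if s y \<le> k \<and> k + r < l then op_one k y else 0)"
              unfolding s[OF xy] S.cstD[OF c xy] by (rule refl)
          qed
        qed (auto intro: S.cst_const)
      qed
    qed
    finally show "(\<Sum>k\<in>{k \<in> {1..K}. l \<le> k + r}. form k (S.E (l - 1 - r) f) (W.D l g))
      = W.I (\<lambda>x. S.E (l - 1 - r) f x * W.D l g x * trunc_one (st (l - 1 - r) x) x)"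
      by (simp add: e_def s_def)
  qed
  also have "\<dots> = (\<Sum>l=1..L. W.I (\<lambda>x. \<Sum>j=1..L. 2 * a j x * (\<epsilon> j l x * W.D l g x) * trunc_one j x))"
  proof (intro sum.cong refl W.I_cong)
    fix l x assume l: "l \<in> {1..L}"
    define s where "s = st (l - 1 - r) x"
    have "l - 1 - r \<le> L" using l by auto
    then have s: "s \<le> L" unfolding s_def by (rule le_trans[OF st_le])
    have "(\<Sum>j=1..L. 2 * a j x * (\<epsilon> j l x * W.D l g x) * trunc_one j x)
      = (\<Sum>j=1..L. if s = j then 2 * a j x * (S.E (l - 1 - r) f x / (2 * a j x)) * W.D l g x * trunc_one j x else 0)"
      by (intro sum.cong) (auto simp: \<epsilon>_def s_def)
    also have "\<dots> = 2 * a s x * (S.E (l - 1 - r) f x / (2 * a s x)) * W.D l g x * trunc_one s x"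
      using s a0 by (cases "s = 0") auto
    also have "2 * a s x * (S.E (l - 1 - r) f x / (2 * a s x)) = S.E (l - 1 - r) f x"
      using f_le[of "l - 1 - r" x] by (cases "a s x = 0") (auto simp: s_def)
    finally show "S.E (l - 1 - r) f x * W.D l g x * trunc_one (st (l - 1 - r) x) x
      = (\<Sum>j=1..L. 2 * a j x * (\<epsilon> j l x * W.D l g x) * trunc_one j x)" by (simp add: s_def)
  qed
  also have "\<dots> = (\<Sum>l=1..L. \<Sum>j=1..L. W.I (\<lambda>x. 2 * a j x * (\<epsilon> j l x * W.D l g x) * trunc_one j x))"
    by (simp only: W.I_sum)
  also have "\<dots> = (\<Sum>j=1..L. \<Sum>l=1..L. W.I (\<lambda>x. 2 * a j x * (\<epsilon> j l x * W.D l g x) * trunc_one j x))"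
    by (rule sum.swap)
  also have "\<dots> = (\<Sum>j=1..L. W.I (\<lambda>x. \<Sum>l=1..L. 2 * a j x * (\<epsilon> j l x * W.D l g x) * trunc_one j x))"
    by (simp only: W.I_sum)
  also have "\<dots> = 2 * (\<Sum>j=1..L. W.I (\<lambda>x. a j x * Y j x * trunc_one j x))"
    unfolding sum_distrib_left W.I_cmult[symmetric]
    by (intro sum.cong refl W.I_cong) (simp add: Y_def sum_distrib_left sum_distrib_right mult_ac)
  finally have e: "(\<Sum>k=1..K. \<Sum>l=1..k + r. form k (S.E (l - 1 - r) f) (W.D l g))
    = 2 * (\<Sum>j=1..L. W.I (\<lambda>x. a j x * Y j x * trunc_one j x))" .
  have na: "S.nrm p (S.L2n a {1..L}) \<le> sqrt 2 * (doob_norm p * S.nrm p f)"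
  proof -
    have "S.nrm p (S.L2n a {1..L}) \<le> S.nrm p (\<lambda>x. sqrt 2 * S.runmax L F x)"
    proof (rule S.nrm_mono)
      fix x
      have "(\<Sum>j=1..L. (a j x)\<^sup>2) \<le> 2 * (S.E (st L x) F x)\<^sup>2"
        using S.sum_stop_le[of F, OF F0, of x L] by (simp add: a_def st_def)
      also have "\<dots> \<le> 2 * (S.runmax L F x)\<^sup>2"
        using S.E_nonneg[of F "st L x" x] F0 S.E_le_runmax[OF st_le, of L x F x] by (intro mult_left_mono power_mono) auto
      finally have "S.L2n a {1..L} x \<le> sqrt (2 * (S.runmax L F x)\<^sup>2)" unfolding L2_set_def by simp
      then show "\<bar>S.L2n a {1..L} x\<bar> \<le> \<bar>sqrt 2 * S.runmax L F x\<bar>" by (simp add: real_sqrt_mult)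
    qed (use p in simp)
    also have "\<dots> = sqrt 2 * S.nrm p (S.runmax L F)" using p by (simp add: S.nrm_cmult)
    also have "\<dots> \<le> sqrt 2 * (doob_norm p * S.nrm p f)"
      unfolding F_def by (intro mult_left_mono S.doob_nrm p) auto
    finally show ?thesis .
  qed
  have nY: "W.nrm Q (W.L2n Y {1..L}) \<le> transform_norm Q * W.nrm Q g"
    unfolding Y_def using eps_cst eps_sum by (intro W.transform_nrm Q) auto
  have "\<bar>\<Sum>j=1..L. W.I (\<lambda>x. a j x * Y j x * trunc_one j x)\<bar>
    \<le> (T + A) * (S.nrm p (S.L2n a {1..L}) * W.nrm Q (W.L2n Y {1..L}))"
    using test_bound[OF a_cst, of Y] by (simp add: Q_def mult.assoc)
  also have "\<dots> \<le> (T + A) * ((sqrt 2 * (doob_norm p * S.nrm p f)) * (transform_norm Q * W.nrm Q g))"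
    using T A na nY by (intro mult_left_mono mult_mono) (auto simp: doob_norm_def)
  finally show ?thesis unfolding e by (simp add: Q_def abs_mult mult_ac)
qed

text \<open>
If \<open>l \<le> k\<close>, both functions are constant on cells of level \<open>k\<close>, and the sum over \<open>k\<close> is a truncation of the operator
applied to \<open>1\<close>, so that testing applies. Each of the remaining \<open>r\<close> offsets \<open>l - k = 1, \<dots>, r\<close> is bounded by the size of
the kernel.
\<close>
lemma paired_bound:
  assumes U: "\<And>l. S.cst l (U l)" and V: "\<And>l. S.cst l (V l)"
  shows "\<bar>\<Sum>k=1..K. \<Sum>l=1..k + r. form k (U l) (V l)\<bar>
    \<le> (T + A + real r * (A * stein_norm p)) * S.nrm p (S.L2n U {1..L + r}) * W.nrm (q / (q - 1)) (W.L2n V {1..L + r})"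
proof -
  have q': "q / (q - 1) > 0" using q by simp
  define N where "N = S.nrm p (S.L2n U {1..L + r}) * W.nrm (q / (q - 1)) (W.L2n V {1..L + r})"
  have "(\<Sum>l=1..k + r. form k (U l) (V l)) = (\<Sum>l=1..k. form k (U l) (V l)) + (\<Sum>i=1..r. form k (U (k + i)) (V (k + i)))" for k
    using sum.ub_add_nat[of 1 k "\<lambda>l. form k (U l) (V l)" r] sum.shift_bounds_cl_nat_ivl[of "\<lambda>l. form k (U l) (V l)" 1 k r]
    by (simp add: add.commute)
  then have "(\<Sum>k=1..K. \<Sum>l=1..k + r. form k (U l) (V l))
    = (\<Sum>k=1..K. \<Sum>l=1..k. form k (U l) (V l)) + (\<Sum>k=1..K. \<Sum>i=1..r. form k (U (k + i)) (V (k + i)))"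
    by (simp only: sum.distrib)
  also have "(\<Sum>k=1..K. \<Sum>i=1..r. form k (U (k + i)) (V (k + i))) = (\<Sum>i=1..r. \<Sum>k=1..K. form k (U (k + i)) (V (k + i)))"
    by (rule sum.swap)
  also have "(\<Sum>k=1..K. \<Sum>l=1..k. form k (U l) (V l)) = (\<Sum>l=1..L. W.I (\<lambda>x. U l x * V l x * trunc_one l x))"
    unfolding sum_triangle_swap
  proof (rule sum.cong[OF refl])
    fix l
    have "(\<Sum>k\<in>{k \<in> {1..K}. l \<le> k}. form k (U l) (V l)) = (\<Sum>k\<in>{k \<in> {1..K}. l \<le> k}. W.I (\<lambda>x. U l x * V l x * op_one k x))"
      by (intro sum.cong form_cst refl S.cst_mono[OF _ U[of l]]) auto
    then show "(\<Sum>k\<in>{k \<in> {1..K}. l \<le> k}. form k (U l) (V l)) = W.I (\<lambda>x. U l x * V l x * trunc_one l x)"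
      by (simp add: trunc_one_def sum_distrib_left W.I_sum)
  qed
  finally have e: "(\<Sum>k=1..K. \<Sum>l=1..k + r. form k (U l) (V l))
    = (\<Sum>l=1..L. W.I (\<lambda>x. U l x * V l x * trunc_one l x)) + (\<Sum>i=1..r. \<Sum>k=1..K. form k (U (k + i)) (V (k + i)))" .
  have mono: "S.L2n (\<lambda>k. F (k + i)) {1..L} x \<le> S.L2n F {1..L + r} x" if "i \<le> r" for F :: "nat \<Rightarrow> 'a \<Rightarrow> real" and i x
  proof -
    have "(\<Sum>k=1..L. (F (k + i) x)\<^sup>2) = (\<Sum>k=1+i..L+i. (F k x)\<^sup>2)"
      by (rule sum.shift_bounds_cl_nat_ivl[symmetric])
    also have "\<dots> \<le> (\<Sum>k=1..L+r. (F k x)\<^sup>2)" using that by (intro sum_mono2) auto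
    finally show ?thesis by (simp add: L2_set_def)
  qed
  have NU: "S.nrm p (S.L2n (\<lambda>k. U (k + i)) {1..L}) \<le> S.nrm p (S.L2n U {1..L + r})" if "i \<le> r" for i
    using mono[OF that, of U] p by (intro S.nrm_mono) auto
  have NV: "W.nrm (q / (q - 1)) (W.L2n (\<lambda>k. V (k + i)) {1..L}) \<le> W.nrm (q / (q - 1)) (W.L2n V {1..L + r})" if "i \<le> r" for i
    using mono[OF that, of V] q' by (intro W.nrm_mono) auto
  have "\<bar>\<Sum>l=1..L. W.I (\<lambda>x. U l x * V l x * trunc_one l x)\<bar> \<le> (T + A) * (S.nrm p (S.L2n U {1..L}) * W.nrm (q / (q - 1)) (W.L2n V {1..L}))"
    using test_bound[OF U, of V] by (simp add: mult.assoc)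
  also have "\<dots> \<le> (T + A) * N"
    unfolding N_def using NU[of 0] NV[of 0] T A by (intro mult_left_mono mult_mono) auto
  finally have 1: "\<bar>\<Sum>l=1..L. W.I (\<lambda>x. U l x * V l x * trunc_one l x)\<bar> \<le> (T + A) * N" .
  have "\<bar>\<Sum>k=1..K. form k (U (k + i)) (V (k + i))\<bar> \<le> A * stein_norm p * N" if "i \<in> {1..r}" for i
  proof -
    have "\<bar>\<Sum>k=1..K. form k (U (k + i)) (V (k + i))\<bar> \<le> A * stein_norm p * (S.nrm p (S.L2n (\<lambda>k. U (k + i)) {1..L}) * W.nrm (q / (q - 1)) (W.L2n (\<lambda>k. V (k + i)) {1..L}))"
      using near_diagonal_bound[of "\<lambda>k. U (k + i)" "\<lambda>k. V (k + i)"] by (simp add: mult.assoc)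
    also have "\<dots> \<le> A * stein_norm p * N"
      unfolding N_def using NU[of i] NV[of i] A that by (intro mult_left_mono mult_mono) (auto simp: stein_norm_def)
    finally show ?thesis .
  qed
  then have "\<bar>\<Sum>i=1..r. \<Sum>k=1..K. form k (U (k + i)) (V (k + i))\<bar> \<le> (\<Sum>i=1..r. A * stein_norm p * N)"
    by (rule order_trans[OF sum_abs sum_mono])
  then have 2: "\<bar>\<Sum>i=1..r. \<Sum>k=1..K. form k (U (k + i)) (V (k + i))\<bar> \<le> real r * (A * stein_norm p * N)" by simp
  have "\<bar>\<Sum>k=1..K. \<Sum>l=1..k + r. form k (U l) (V l)\<bar> \<le> (T + A) * N + real r * (A * stein_norm p * N)"
    unfolding e using 1 2 by linarith
  then show ?thesis by (simp add: N_def algebra_simps)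
qed

end

section \<open>The two-weight estimate on a finite filtered set\<close>

definition paraproduct_const :: "real \<Rightarrow> real \<Rightarrow> real" where
  "paraproduct_const p q = 2 * sqrt 2 * doob_norm p * transform_norm (q / (q - 1))"

definition shift_const :: "real \<Rightarrow> real \<Rightarrow> real" where
  "shift_const p q = 1 + 3 * (transform_norm p * transform_norm (q / (q - 1))) * (1 + stein_norm p)
     + paraproduct_const p q + paraproduct_const (q / (q - 1)) (p / (p - 1)) * (1 + stein_norm p)"

lemma norm_consts_nonneg: "0 \<le> doob_norm p" "0 \<le> stein_norm p" "0 \<le> transform_norm p" "0 \<le> paraproduct_const p q"
  by (simp_all add: doob_norm_def stein_norm_def transform_norm_def paraproduct_const_def)

lemma shift_const_pos: "0 < shift_const p q"
  unfolding shift_const_def using norm_consts_nonneg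
  by (intro add_pos_nonneg mult_nonneg_nonneg add_nonneg_nonneg) auto

text \<open>
An operator together with its adjoint: the weights are exchanged, the exponents are replaced by the conjugate ones in
reverse order, and the constant of the quadratic condition is the one provided by \<open>dual_apq\<close>.
\<close>
locale two_weight_pair = two_weight_shift X lab \<sigma> w p q \<rho> L A ker K r T +
  dual: two_weight_shift X lab w \<sigma> "q / (q - 1)" "p / (p - 1)" \<rho> L "stein_norm p * A" "\<lambda>k x y. ker k y x" K r T'
  for X :: "'a set" and lab :: "nat \<Rightarrow> 'a \<Rightarrow> 'b" and \<sigma> w p q \<rho> L A ker K r T T'
begin

lemma dual_form: "dual.form k g f = form k f g"
  unfolding dual.form_def form_def by (subst sum.swap) (simp add: mult_ac)

lemma (in weighted_filtration) E_eq_sum_D: "E m f x = E (m - r) f x + (\<Sum>e=1..r. D (Suc m - e) f x)"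
  by (induction r) (auto simp: D_def Suc_diff_le)

text \<open>
Let \<open>d\<close> and \<open>e\<close> be the increments of \<open>f\<close> and \<open>g\<close>. The increment of the product \<open>f\<^sub>l g\<^sub>l\<close> is \<open>f\<^sub>l\<^sub>-\<^sub>1 e\<^sub>l + d\<^sub>l g\<^sub>l\<^sub>-\<^sub>1 + d\<^sub>l e\<^sub>l\<close>, and \<open>f\<^sub>l\<^sub>-\<^sub>1\<close> is
\<open>f\<^sub>l\<^sub>-\<^sub>1\<^sub>-\<^sub>r\<close> plus the \<open>r\<close> increments in between.
\<close>
lemma form_expand:
  "form k (S.E m f) (W.E m g) = (\<Sum>l=1..m. form k (S.E (l - 1 - r) f) (W.D l g) + form k (S.D l f) (W.E (l - 1 - r) g)
     + (\<Sum>e=1..r. form k (S.D (l - e) f) (W.D l g) + form k (S.D l f) (W.D (l - e) g)) + form k (S.D l f) (W.D l g))"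
proof (induction m)
  case 0
  show ?case by (simp add: form_def)
next
  case (Suc m)
  have S: "S.E (Suc m) f = (\<lambda>x. S.E m f x + S.D (Suc m) f x)" and W: "W.E (Suc m) g = (\<lambda>x. W.E m g x + W.D (Suc m) g x)"
    by (auto simp: S.D_def W.D_def)
  have "form k (S.E m f) (W.D (Suc m) g) = form k (S.E (m - r) f) (W.D (Suc m) g) + (\<Sum>e=1..r. form k (S.D (Suc m - e) f) (W.D (Suc m) g))"
    unfolding form_sum1[symmetric] form_add1[symmetric] by (simp only: flip: S.E_eq_sum_D)
  moreover have "form k (S.D (Suc m) f) (W.E m g) = form k (S.D (Suc m) f) (W.E (m - r) g) + (\<Sum>e=1..r. form k (S.D (Suc m) f) (W.D (Suc m - e) g))"
    unfolding form_sum2[symmetric] form_add2[symmetric] by (simp only: flip: W.E_eq_sum_D)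
  moreover have "form k (S.E (Suc m) f) (W.E (Suc m) g) = form k (S.E m f) (W.E m g) + form k (S.E m f) (W.D (Suc m) g)
     + form k (S.D (Suc m) f) (W.E m g) + form k (S.D (Suc m) f) (W.D (Suc m) g)"
    unfolding S W form_add1 form_add2 by simp
  ultimately show ?case using Suc by (simp add: sum.distrib)
qed

text \<open>
The expansion consists of two paraproducts and \<open>2 r + 1\<close> paired sums.
\<close>
theorem form_bound:
  assumes r: "real r = 1 + \<kappa>" "0 \<le> \<kappa>"
  shows "\<bar>\<Sum>k=1..K. form k f g\<bar>
    \<le> shift_const p q * ((1 + \<kappa>) * (T + T') + (1 + \<kappa>)\<^sup>2 * A) * S.nrm p f * W.nrm (q / (q - 1)) g"
proof -
  define sn where "sn = stein_norm p"
  define Q where "Q = q / (q - 1)"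
  define N where "N = S.nrm p f * W.nrm Q g"
  define c0 where "c0 = transform_norm p * transform_norm Q"
  have Q: "Q > 1" using q by (simp add: Q_def)
  have dd: "(p / (p - 1)) / (p / (p - 1) - 1) = p" using p by (simp add: field_simps)
  have nn: "0 \<le> N" "0 \<le> sn" "0 \<le> c0" by (simp_all add: N_def sn_def c0_def norm_consts_nonneg)
  have shift_down: "S.L2n (\<lambda>l. F (l - e)) {1..M} x \<le> S.L2n F {1..M} x" if "\<And>x. F 0 x = 0" for F :: "nat \<Rightarrow> 'a \<Rightarrow> real" and e M x
  proof -
    have "(\<Sum>l=1..M. (F (l - e) x)\<^sup>2) = (\<Sum>l\<in>{Suc e..M}. (F (l - e) x)\<^sup>2)"
      using that by (intro sum.mono_neutral_right) auto
    also have "\<dots> = (\<Sum>l\<in>{1..M - e}. (F l x)\<^sup>2)"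
      by (rule sum.reindex_bij_witness[of _ "\<lambda>l. l + e" "\<lambda>l. l - e"]) auto
    also have "\<dots> \<le> (\<Sum>l=1..M. (F l x)\<^sup>2)" by (intro sum_mono2) auto
    finally show ?thesis by (simp add: L2_set_def)
  qed
  have SD: "S.nrm p (S.L2n (\<lambda>l. S.D (l - e) f) {1..M}) \<le> transform_norm p * S.nrm p f" for e M
  proof -
    have "S.nrm p (S.L2n (\<lambda>l. S.D (l - e) f) {1..M}) \<le> S.nrm p (S.L2n (\<lambda>l. S.D l f) {1..M})"
      using shift_down[of "\<lambda>l. S.D l f" e _ M] p by (intro S.nrm_mono) auto
    then show ?thesis using S.square_function_nrm[OF p, of f M] by linarith
  qed
  have WD: "W.nrm Q (W.L2n (\<lambda>l. W.D (l - e) g) {1..M}) \<le> transform_norm Q * W.nrm Q g" for e M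
  proof -
    have "W.nrm Q (W.L2n (\<lambda>l. W.D (l - e) g) {1..M}) \<le> W.nrm Q (W.L2n (\<lambda>l. W.D l g) {1..M})"
      using shift_down[of "\<lambda>l. W.D l g" e _ M] Q by (intro W.nrm_mono) auto
    then show ?thesis using W.square_function_nrm[OF Q, of g M] by linarith
  qed
  define C where "C = (T + A + real r * (A * sn)) * c0"
  have paired: "\<bar>\<Sum>k=1..K. \<Sum>l=1..k + r. form k (S.D (l - e) f) (W.D (l - e') g)\<bar> \<le> C * N" for e e'
  proof -
    have "\<bar>\<Sum>k=1..K. \<Sum>l=1..k + r. form k (S.D (l - e) f) (W.D (l - e') g)\<bar>
      \<le> (T + A + real r * (A * sn)) * (S.nrm p (S.L2n (\<lambda>l. S.D (l - e) f) {1..L + r}) * W.nrm Q (W.L2n (\<lambda>l. W.D (l - e') g) {1..L + r}))"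
      using paired_bound[of "\<lambda>l. S.D (l - e) f" "\<lambda>l. W.D (l - e') g"] by (simp add: S.cst_Dk W.cst_Dk sn_def Q_def mult.assoc)
    also have "\<dots> \<le> (T + A + real r * (A * sn)) * ((transform_norm p * S.nrm p f) * (transform_norm Q * W.nrm Q g))"
      using T A nn by (intro mult_left_mono mult_mono SD WD) (auto simp: norm_consts_nonneg)
    finally show ?thesis by (simp add: C_def c0_def N_def mult_ac)
  qed
  have "\<bar>\<Sum>k=1..K. form k f g\<bar> = \<bar>(\<Sum>k=1..K. \<Sum>l=1..k + r. form k (S.E (l - 1 - r) f) (W.D l g))
      + (\<Sum>k=1..K. \<Sum>l=1..k + r. form k (S.D l f) (W.E (l - 1 - r) g))
      + (\<Sum>e=1..r. (\<Sum>k=1..K. \<Sum>l=1..k + r. form k (S.D (l - e) f) (W.D l g)) + (\<Sum>k=1..K. \<Sum>l=1..k + r. form k (S.D l f) (W.D (l - e) g)))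
      + (\<Sum>k=1..K. \<Sum>l=1..k + r. form k (S.D l f) (W.D l g))\<bar>"
  proof (rule arg_cong[of _ _ abs])
    have "(\<Sum>k=1..K. form k f g) = (\<Sum>k=1..K. form k (S.E (k + r) f) (W.E (k + r) g))"
      by (intro sum.cong refl form_cond_exp)
    moreover have "(\<Sum>k=1..K. \<Sum>l=1..k + r. \<Sum>e=1..r. form k (S.D (l - e) f) (W.D l g) + form k (S.D l f) (W.D (l - e) g))
      = (\<Sum>e=1..r. \<Sum>k=1..K. \<Sum>l=1..k + r. form k (S.D (l - e) f) (W.D l g) + form k (S.D l f) (W.D (l - e) g))"
      by (subst (2) sum.swap, subst sum.swap, rule refl)
    ultimately show "(\<Sum>k=1..K. form k f g) = (\<Sum>k=1..K. \<Sum>l=1..k + r. form k (S.E (l - 1 - r) f) (W.D l g))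
      + (\<Sum>k=1..K. \<Sum>l=1..k + r. form k (S.D l f) (W.E (l - 1 - r) g))
      + (\<Sum>e=1..r. (\<Sum>k=1..K. \<Sum>l=1..k + r. form k (S.D (l - e) f) (W.D l g)) + (\<Sum>k=1..K. \<Sum>l=1..k + r. form k (S.D l f) (W.D (l - e) g)))
      + (\<Sum>k=1..K. \<Sum>l=1..k + r. form k (S.D l f) (W.D l g))"
      unfolding form_expand by (simp only: sum.distrib)
  qed
  also have "\<dots> \<le> (T + A) * paraproduct_const p q * N + (T' + sn * A) * paraproduct_const Q (p / (p - 1)) * N
      + (\<Sum>e=1..r. C * N + C * N) + C * N"
  proof (intro order_trans[OF abs_triangle_ineq] add_mono)
    show "\<bar>\<Sum>k=1..K. \<Sum>l=1..k + r. form k (S.E (l - 1 - r) f) (W.D l g)\<bar> \<le> (T + A) * paraproduct_const p q * N"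
      using paraproduct_bound[of f g] by (simp add: paraproduct_const_def N_def Q_def mult.assoc)
    show "\<bar>\<Sum>k=1..K. \<Sum>l=1..k + r. form k (S.D l f) (W.E (l - 1 - r) g)\<bar> \<le> (T' + sn * A) * paraproduct_const Q (p / (p - 1)) * N"
      using dual.paraproduct_bound[of g f] unfolding dual_form dd paraproduct_const_def N_def Q_def[symmetric] sn_def by (simp add: mult_ac)
    show "\<bar>\<Sum>e=1..r. (\<Sum>k=1..K. \<Sum>l=1..k + r. form k (S.D (l - e) f) (W.D l g)) + (\<Sum>k=1..K. \<Sum>l=1..k + r. form k (S.D l f) (W.D (l - e) g))\<bar>
      \<le> (\<Sum>e=1..r. C * N + C * N)"
    proof (rule order_trans[OF sum_abs sum_mono])
      fix e
      show "\<bar>(\<Sum>k=1..K. \<Sum>l=1..k + r. form k (S.D (l - e) f) (W.D l g)) + (\<Sum>k=1..K. \<Sum>l=1..k + r. form k (S.D l f) (W.D (l - e) g))\<bar> \<le> C * N + C * N"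
        using paired[of e 0] paired[of 0 e] by simp
    qed
    show "\<bar>\<Sum>k=1..K. \<Sum>l=1..k + r. form k (S.D l f) (W.D l g)\<bar> \<le> C * N" using paired[of 0 0] by simp
  qed
  also have "\<dots> = ((T + A) * paraproduct_const p q + (T' + sn * A) * paraproduct_const Q (p / (p - 1)) + (2 * real r + 1) * C) * N"
    by (simp add: algebra_simps)
  also have "\<dots> \<le> (shift_const p q * ((1 + \<kappa>) * (T + T') + (1 + \<kappa>)\<^sup>2 * A)) * N"
  proof (rule mult_right_mono[OF _ nn(1)])
    define c1 where "c1 = paraproduct_const p q"
    define c2 where "c2 = paraproduct_const Q (p / (p - 1))"
    define R where "R = real r"
    have R1: "R \<ge> 1" using r by (simp add: R_def)
    have R: "R \<ge> 1" "R \<le> R\<^sup>2" "1 \<le> R\<^sup>2"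
      using R1 self_le_power[OF R1, of 2] one_le_power[OF R1, of 2] by simp_all
    have c: "0 \<le> c1" "0 \<le> c2" by (simp_all add: c1_def c2_def norm_consts_nonneg)
    have S: "shift_const p q = 1 + 3 * c0 * (1 + sn) + c1 + c2 * (1 + sn)"
      by (simp add: shift_const_def c0_def c1_def c2_def sn_def Q_def)
    define s where "s = shift_const p q"
    have T'0: "0 \<le> T'" by (rule dual.T)
    have "(2 * R + 1) * C \<le> 3 * R * C" using R T A nn by (intro mult_right_mono) (auto simp: C_def intro!: mult_nonneg_nonneg add_nonneg_nonneg)
    also have "\<dots> = (3 * c0) * (R * T) + (3 * c0) * (R * A) + (3 * c0 * sn) * (R\<^sup>2 * A)"
      by (simp add: C_def R_def power2_eq_square algebra_simps)
    finally have 1: "(2 * R + 1) * C \<le> (3 * c0) * (R * T) + (3 * c0) * (R\<^sup>2 * A) + (3 * c0 * sn) * (R\<^sup>2 * A)"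
      using mult_left_mono[OF mult_right_mono[OF R(2) A], of "3 * c0"] nn by simp
    have 2: "(T + A) * c1 \<le> c1 * (R * T) + c1 * (R\<^sup>2 * A)"
      using mult_left_mono[OF mult_right_mono[OF R(1) T] c(1)] mult_left_mono[OF mult_right_mono[OF R(3) A] c(1)]
      by (simp add: algebra_simps)
    have 3: "(T' + sn * A) * c2 \<le> c2 * (R * T') + (c2 * sn) * (R\<^sup>2 * A)"
      using mult_left_mono[OF mult_right_mono[OF R(1) T'0] c(2)] mult_left_mono[OF mult_right_mono[OF R(3) A], of "c2 * sn"] c nn
      by (simp add: algebra_simps)
    have RT: "0 \<le> R * T" "0 \<le> R * T'" "0 \<le> R\<^sup>2 * A" using R T T'0 A by auto
    have "(T + A) * c1 + (T' + sn * A) * c2 + (2 * R + 1) * C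
      \<le> (3 * c0 + c1) * (R * T) + c2 * (R * T') + (3 * c0 + 3 * c0 * sn + c1 + c2 * sn) * (R\<^sup>2 * A)"
      using 1 2 3 by (simp add: algebra_simps)
    also have "\<dots> \<le> s * (R * T) + s * (R * T') + s * (R\<^sup>2 * A)"
    proof (intro add_mono mult_right_mono RT)
      have "0 \<le> c0 * sn" "0 \<le> c2 * sn" using nn c by auto
      then show "3 * c0 + c1 \<le> s" "c2 \<le> s" "3 * c0 + 3 * c0 * sn + c1 + c2 * sn \<le> s"
        using nn c unfolding s_def S by (simp_all add: algebra_simps)
    qed
    also have "\<dots> = s * ((1 + \<kappa>) * (T + T') + (1 + \<kappa>)\<^sup>2 * A)"
      using r by (simp add: R_def algebra_simps)
    finally show "(T + A) * paraproduct_const p q + (T' + sn * A) * paraproduct_const Q (p / (p - 1)) + (2 * real r + 1) * C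
      \<le> shift_const p q * ((1 + \<kappa>) * (T + T') + (1 + \<kappa>)\<^sup>2 * A)" by (simp add: s_def c1_def c2_def R_def)
  qed
  finally show ?thesis by (simp add: N_def Q_def mult.assoc)
qed

end

section \<open>Geometry of a dyadic lattice\<close>

locale dyadic_grid =
  fixes D :: "int \<Rightarrow> (real ^ 'n::finite) set set"
  assumes grid: "dyadic_lattice D"
begin

lemma partition: "partition_on UNIV (D k)"
  using grid by (simp add: dyadic_lattice_def)

lemma cubeE: assumes "Q \<in> D k" obtains y where "Q = cube_at y k"
proof -
  have "\<exists>y. Q = cube_at y k"
    by (rule bspec[OF grid[unfolded dyadic_lattice_def, THEN spec, THEN conjunct2, THEN conjunct1] assms])
  then show thesis using that by (elim exE)
qed

lemma childrenE:
  assumes "Q \<in> D k"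
  obtains \<C> where "\<C> \<subseteq> D (k + 1)" "finite \<C>" "Q = \<Union>\<C>"
proof -
  have "\<exists>\<C>\<subseteq>D (k + 1). card \<C> = 2 ^ CARD('n) \<and> Q = \<Union>\<C>"
    by (rule bspec[OF grid[unfolded dyadic_lattice_def, THEN spec, THEN conjunct2, THEN conjunct2] assms])
  then obtain \<C> where C: "\<C> \<subseteq> D (k + 1)" "card \<C> = 2 ^ CARD('n)" "Q = \<Union>\<C>" by (elim exE conjE)
  have "finite \<C>" by (rule ccontr) (use C(2) in simp)
  then show thesis using that C(1,3) by simp
qed

definition cube_of :: "int \<Rightarrow> real ^ 'n \<Rightarrow> (real ^ 'n) set" where
  "cube_of k x = (THE Q. Q \<in> D k \<and> x \<in> Q)"

lemma disjoint_cubes: "Q \<in> D k \<Longrightarrow> R \<in> D k \<Longrightarrow> x \<in> Q \<Longrightarrow> x \<in> R \<Longrightarrow> Q = R"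
  using disjointD[OF partition_onD2[OF partition[of k]], of Q R] by auto

lemma cube_of_eq: "Q \<in> D k \<Longrightarrow> x \<in> Q \<Longrightarrow> cube_of k x = Q"
  unfolding cube_of_def by (rule the_equality) (simp, metis disjoint_cubes)

lemma cube_of: "cube_of k x \<in> D k" "x \<in> cube_of k x"
proof -
  obtain Q where "Q \<in> D k" "x \<in> Q" using partition_onD1[OF partition[of k]] by blast
  then show "cube_of k x \<in> D k" "x \<in> cube_of k x" using cube_of_eq[of Q k x] by simp_all
qed

lemma cube_of_cube_of: "y \<in> cube_of k x \<Longrightarrow> cube_of k y = cube_of k x"
  by (rule cube_of_eq[OF cube_of(1)])

lemma nonempty: "Q \<in> D k \<Longrightarrow> Q \<noteq> {}"
  using partition_onD3[OF partition[of k]] by metis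

lemma cube_at_borel: "cube_at y k \<in> sets borel" for y :: "real ^ 'n"
proof -
  have "cube_at y k = (\<Inter>i\<in>UNIV. (\<lambda>x. x $ i) -` {y $ i ..< y $ i + 2 powi (- k)} \<inter> space borel)"
    by (auto simp: cube_at_def)
  also have "\<dots> \<in> sets borel"
    by (intro sets.finite_INT measurable_sets[where A = borel]) auto
  finally show ?thesis .
qed

lemma vol_cube_at: "vol (cube_at y k :: (real ^ 'n) set) = (2 powi (- k)) ^ CARD('n)"
proof -
  define s :: real where "s = 2 powi (- k)"
  have s: "s > 0" by (simp add: s_def)
  define z where "z = (\<chi> i. y $ i + s)"
  have sub: "box y z \<subseteq> cube_at y k" "cube_at y k \<subseteq> cbox y z"
    by (auto simp: cube_at_def mem_box_cart z_def less_imp_le s_def)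
  have fin: "cube_at y k \<in> fmeasurable lborel" "box y z \<in> fmeasurable lborel" "cbox y z \<in> fmeasurable lborel"
    using fmeasurableI2[OF fmeasurable_cbox sub(2)] cube_at_borel by auto
  have inn: "(z - y) \<bullet> b = s" if "b \<in> Basis" for b
    using that by (auto simp: Basis_vec_def inner_axis z_def)
  have le: "\<And>b. b \<in> Basis \<Longrightarrow> y \<bullet> b \<le> z \<bullet> b" using inn s by (simp add: inner_diff_left algebra_simps)
  have c: "measure lborel (cbox y z) = s ^ CARD('n)" "measure lborel (box y z) = s ^ CARD('n)"
    using measure_lborel_cbox[OF le] measure_lborel_box[OF le] inn by simp_all
  have "measure lborel (box y z) \<le> vol (cube_at y k)" "vol (cube_at y k) \<le> measure lborel (cbox y z)"
    using sub fin by (auto intro!: measure_mono_fmeasurable)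
  then show ?thesis using c by (simp add: s_def)
qed

lemma borel: "Q \<in> D k \<Longrightarrow> Q \<in> sets borel"
  by (erule cubeE) (simp add: cube_at_borel)

lemma vol_eq: "Q \<in> D k \<Longrightarrow> vol Q = (2 powi (- k)) ^ CARD('n)"
  by (erule cubeE) (simp add: vol_cube_at)

lemma vol_pos: "Q \<in> D k \<Longrightarrow> 0 < vol Q"
  by (simp add: vol_eq)

lemma bounded: "Q \<in> D k \<Longrightarrow> bounded Q"
proof -
  assume "Q \<in> D k"
  then obtain y where "Q = cube_at y k" by (rule cubeE)
  then have "Q \<subseteq> cbox y (\<chi> i. y $ i + 2 powi (- k))"
    by (auto simp: cube_at_def mem_box_cart less_imp_le)
  then show ?thesis using bounded_cbox bounded_subset by blast
qed

lemma generation_unique: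
  assumes "Q \<in> D k" "Q \<in> D j"
  shows "k = j"
proof -
  have "(2 powi (- k) :: real) ^ CARD('n) = (2 powi (- j)) ^ CARD('n)" using vol_eq[OF assms(1)] vol_eq[OF assms(2)] by simp
  then have "(2 powi (- k) :: real) = 2 powi (- j)" by (simp add: power_eq_iff_eq_base)
  then have "\<not> - k < - j" "\<not> - j < - k"
    using power_int_strict_increasing[of "- k" "- j" "2::real"] power_int_strict_increasing[of "- j" "- k" "2::real"] by auto
  then show ?thesis by simp
qed

lemma cube_of_Suc: "cube_of (k + 1) x \<subseteq> cube_of k x"
proof -
  obtain \<C> where C: "\<C> \<subseteq> D (k + 1)" "cube_of k x = \<Union>\<C>" using childrenE[OF cube_of(1)] by metis
  then obtain R where R: "R \<in> \<C>" "x \<in> R" using cube_of(2)[of x k] by auto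
  then have "cube_of (k + 1) x = R" using C by (intro cube_of_eq) auto
  then show ?thesis using R C by auto
qed

lemma cube_of_antimono: "j \<le> k \<Longrightarrow> cube_of k x \<subseteq> cube_of j x"
proof (induction k rule: int_ge_induct)
  case (step i)
  then show ?case using cube_of_Suc[of i x] by blast
qed simp

lemma nested:
  assumes "Q \<in> D k" "R \<in> D j" "j \<le> k" "x \<in> Q" "x \<in> R"
  shows "Q \<subseteq> R"
  using cube_of_antimono[OF assms(3), of x] cube_of_eq[OF assms(1,4)] cube_of_eq[OF assms(2,5)] by simp

lemma cube_of_eq_antimono:
  assumes "j \<le> k" "cube_of k x = cube_of k y"
  shows "cube_of j x = cube_of j y"
proof -
  have "y \<in> cube_of j x" using cube_of(2)[of y k] assms cube_of_antimono[OF assms(1), of x] by auto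
  then show ?thesis using cube_of_cube_of by metis
qed

lemma ancestor_eq:
  assumes "Q \<in> D k" "x \<in> Q"
  shows "ancestor D r Q = cube_of (k - int r) x"
  unfolding ancestor_def
proof (rule the_equality)
  show "\<exists>j. Q \<in> D j \<and> cube_of (k - int r) x \<in> D (j - int r) \<and> Q \<subseteq> cube_of (k - int r) x"
    using assms cube_of nested[OF assms(1) cube_of(1) _ assms(2) cube_of(2)] by (intro exI[of _ k]) auto
  fix R assume "\<exists>j. Q \<in> D j \<and> R \<in> D (j - int r) \<and> Q \<subseteq> R"
  then have "R \<in> D (k - int r)" "Q \<subseteq> R" using generation_unique[OF assms(1)] by auto
  then show "R = cube_of (k - int r) x" using assms cube_of_eq by blast
qed

lemma ancestorD:
  assumes "Q \<in> D j" "ancestor D r Q = K" "K \<in> D k"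
  shows "j = k + int r" "Q \<subseteq> K"
proof -
  obtain x where x: "x \<in> Q" using nonempty[OF assms(1)] by blast
  have K: "K = cube_of (j - int r) x" using ancestor_eq[OF assms(1) x] assms(2) by simp
  then show "j = k + int r" using generation_unique[OF cube_of(1)[of "j - int r" x], of k] assms(3) by simp
  show "Q \<subseteq> K" using cube_of_antimono[of "j - int r" j x] cube_of_eq[OF assms(1) x] K by simp
qed

lemma finite_descendants: "finite {I \<in> D (k + int m). \<exists>x\<in>Q. x \<in> I}" if "Q \<in> D k"
  using that
proof (induction m arbitrary: k Q)
  case 0
  have "{I \<in> D (k + int 0). \<exists>x\<in>Q. x \<in> I} \<subseteq> {Q}" using disjoint_cubes 0 by auto
  then show ?case by (rule finite_subset) simp
next
  case (Suc m)
  obtain \<C> where C: "\<C> \<subseteq> D (k + 1)" "finite \<C>" "Q = \<Union>\<C>" using childrenE[OF Suc.prems] by metis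
  have "{I \<in> D (k + int (Suc m)). \<exists>x\<in>Q. x \<in> I} = (\<Union>R\<in>\<C>. {I \<in> D (k + 1 + int m). \<exists>x\<in>R. x \<in> I})"
    unfolding C(3) by (auto simp: algebra_simps)
  also have "finite \<dots>" using C Suc.IH by auto
  finally show ?case .
qed

text \<open>
The definition of a lattice does not say where the children lie inside a cube. Suppose that a side of a child begins
strictly between the two expected positions. Move a point of the child parallel to that side to the face of the cube; the child \<open>R'\<close> that
contains the new point begins at the face, and its side reaches beyond the beginning of the given child. So the two children
meet, hence coincide, which contradicts their different positions.
\<close>
lemma child_corner:
  assumes Q: "cube_at y k \<in> D k" and R: "cube_at z (k + 1) \<in> D (k + 1)" and sub: "cube_at z (k + 1) \<subseteq> cube_at y k"
  shows "z $ i = y $ i \<or> z $ i = y $ i + 2 powi (- k - 1)"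
proof (rule ccontr)
  define s :: real where "s = 2 powi (- k - 1)"
  have s: "s > 0" "2 powi (- (k + 1)) = s" "2 powi (- k) = 2 * s"
    by (simp_all add: s_def power_int_diff)
  assume "\<not> ?thesis"
  then have ne: "z $ i \<noteq> y $ i" "z $ i \<noteq> y $ i + s" by (auto simp: s_def)
  have zR: "z \<in> cube_at z (k + 1)" using s by (simp add: cube_at_def)
  then have zQ: "z \<in> cube_at y k" using sub by auto
  have "z $ i + s \<le> y $ i + 2 * s"
  proof (rule field_le_epsilon)
    fix e :: real assume e: "e > 0"
    define t where "t = max 0 (s - e)"
    have t: "0 \<le> t" "t < s" "s \<le> t + e" using e s by (auto simp: t_def)
    have "(\<chi> j. if j = i then z $ i + t else z $ j) \<in> cube_at z (k + 1)"
      using t s by (auto simp: cube_at_def)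
    then have "(\<chi> j. if j = i then z $ i + t else z $ j) \<in> cube_at y k" using sub by auto
    then have "z $ i + t < y $ i + 2 * s" by (auto simp: cube_at_def s dest!: spec[of _ i])
    then show "z $ i + s \<le> y $ i + 2 * s + e" using t by linarith
  qed
  then have zi: "y $ i < z $ i" "z $ i < y $ i + s" using zQ ne by (auto simp: cube_at_def dest!: spec[of _ i])
  define u where "u = (\<chi> j. if j = i then y $ i else z $ j)"
  have uQ: "u \<in> cube_at y k" using zQ s by (auto simp: cube_at_def u_def)
  define R' where "R' = cube_of (k + 1) u"
  obtain z' where z': "R' = cube_at z' (k + 1)" using cubeE[OF cube_of(1)] unfolding R'_def by metis
  have uR': "u \<in> R'" by (simp add: R'_def cube_of)
  have "R' \<subseteq> cube_at y k" unfolding R'_def using nested[OF cube_of(1) Q _ cube_of(2) uQ] by simp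
  moreover have "z' \<in> R'" using s by (simp add: z' cube_at_def)
  ultimately have "y $ i \<le> z' $ i" by (auto simp: cube_at_def)
  then have z'i: "z' $ i = y $ i" using uR' by (auto simp: z' cube_at_def u_def dest!: spec[of _ i])
  have "z \<in> R'"
    unfolding z' cube_at_def
  proof (intro CollectI allI)
    fix j
    show "z' $ j \<le> z $ j \<and> z $ j < z' $ j + 2 powi (- (k + 1))"
      using uR' zi s z'i by (cases "j = i") (auto simp: z' cube_at_def u_def dest!: spec[of _ j])
  qed
  then have "R' = cube_at z (k + 1)" using disjoint_cubes[OF _ R _ zR] R'_def cube_of(1) by blast
  then have "u \<in> cube_at z (k + 1)" using uR' by simp
  then show False using zi by (auto simp: cube_at_def u_def dest!: spec[of _ i])
qed

end

section \<open>Haar functions\<close>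

lemma side_cube_at: "side (cube_at y k) i = {y $ i ..< y $ i + 2 powi (- k)}" for y :: "real ^ 'n::finite"
proof
  show "side (cube_at y k) i \<subseteq> {y $ i ..< y $ i + 2 powi (- k)}" by (auto simp: side_def cube_at_def)
  show "{y $ i ..< y $ i + 2 powi (- k)} \<subseteq> side (cube_at y k) i"
  proof
    fix t assume t: "t \<in> {y $ i ..< y $ i + 2 powi (- k)}"
    have "(\<chi> j. if j = i then t else y $ j) \<in> cube_at y k" using t by (auto simp: cube_at_def)
    then show "t \<in> side (cube_at y k) i" unfolding side_def by (rule rev_image_eqI) simp
  qed
qed

lemma haar_interval_eq:
  fixes a s :: real
  assumes s: "0 < s"
  shows "haar_interval e {a..<a + s} t = s powr (- (1 / 2)) * (if a \<le> t \<and> t < a + s then if e \<and> a + s / 2 \<le> t then - 1 else 1 else 0)"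
proof -
  have "Inf {a..<a + s} = a" "Sup {a..<a + s} = a + s" "measure lborel {a..<a + s} = s"
    using s by (auto simp: measure_def)
  moreover have "(a + (a + s)) / 2 = a + s / 2" by simp
  ultimately show ?thesis
    using s by (simp add: haar_interval_def left_half_def right_half_def indicator_def)
qed

lemma haar_interval_measurable:
  fixes a s :: real
  assumes s: "0 < s"
  shows "haar_interval e {a..<a + s} \<in> borel_measurable borel"
  unfolding haar_interval_eq[OF s, abs_def] by measurable

context dyadic_grid
begin

lemma haar_measurable: "Q \<in> D k \<Longrightarrow> haar \<eta> Q \<in> borel_measurable borel"
proof -
  assume "Q \<in> D k"
  then obtain y where Q: "Q = cube_at y k" by (rule cubeE)
  have "(\<lambda>x. haar_interval (\<eta> i) (side Q i) (x $ i)) \<in> borel_measurable borel" for i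
    unfolding Q side_cube_at
    by (rule measurable_compose[of "\<lambda>x. x $ i" borel borel, OF _ haar_interval_measurable]) auto
  then show ?thesis unfolding haar_def[abs_def] by (intro borel_measurable_prod)
qed

lemma haar_bound:
  assumes "Q \<in> D k"
  shows "\<bar>haar \<eta> Q x\<bar> \<le> vol Q powr (- (1 / 2)) * indicator Q x"
proof -
  obtain y where Q: "Q = cube_at y k" using assms by (rule cubeE)
  define s :: real where "s = 2 powi (- k)"
  have s: "s > 0" by (simp add: s_def)
  have v: "vol Q powr (- (1 / 2)) = (s powr (- (1 / 2))) ^ CARD('n)"
    using s by (simp add: vol_eq[OF assms] s_def[symmetric] powr_power powr_powr mult.commute flip: powr_realpow)
  have "\<bar>haar \<eta> Q x\<bar> = (\<Prod>i\<in>UNIV. \<bar>haar_interval (\<eta> i) (side Q i) (x $ i)\<bar>)"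
    by (simp add: haar_def abs_prod)
  also have "\<dots> \<le> vol Q powr (- (1 / 2)) * indicator Q x"
  proof (cases "x \<in> Q")
    case True
    have "(\<Prod>i\<in>UNIV. \<bar>haar_interval (\<eta> i) (side Q i) (x $ i)\<bar>) \<le> (\<Prod>i\<in>(UNIV::'n set). s powr (- (1 / 2)))"
      using s by (intro prod_mono) (auto simp: Q side_cube_at haar_interval_eq s_def[symmetric] abs_mult)
    then show ?thesis using True by (simp add: v)
  next
    case False
    then obtain i where "\<not> (y $ i \<le> x $ i \<and> x $ i < y $ i + s)" by (auto simp: Q cube_at_def s_def)
    then have "haar_interval (\<eta> i) (side Q i) (x $ i) = 0"
      using haar_interval_eq[OF s] by (simp add: Q side_cube_at s_def)
    then have "(\<Prod>i\<in>UNIV. \<bar>haar_interval (\<eta> i) (side Q i) (x $ i)\<bar>) = 0" by (intro prod_zero) auto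
    then show ?thesis by (simp only:) simp
  qed
  finally show ?thesis .
qed

text \<open>
By \<open>child_corner\<close>, every side of a child lies in one half of the side of the cube.
\<close>
lemma haar_const_on_child:
  assumes Q: "Q \<in> D k" and R: "R \<in> D (k + 1)" and x: "x \<in> R" "x' \<in> R"
  shows "haar \<eta> Q x = haar \<eta> Q x'"
proof (cases "x \<in> Q \<or> x' \<in> Q")
  case False
  then show ?thesis using haar_bound[OF Q, of \<eta> x] haar_bound[OF Q, of \<eta> x'] by simp
next
  case True
  then have sub: "R \<subseteq> Q" using nested[OF R Q] x by auto
  obtain y where y: "Q = cube_at y k" using Q by (rule cubeE)
  obtain z where z: "R = cube_at z (k + 1)" using R by (rule cubeE)
  define s :: real where "s = 2 powi (- k)"
  have s: "s > 0" "2 powi (- (k + 1)) = s / 2" "2 powi (- k - 1) = s / 2" by (simp_all add: s_def power_int_diff)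
  have *: "haar_interval e (side Q i) (u $ i) = s powr (- (1 / 2)) * (if e \<and> z $ i \<noteq> y $ i then - 1 else 1)"
    if u: "u \<in> R" for u e i
  proof -
    have "z $ i = y $ i \<or> z $ i = y $ i + s / 2"
      using child_corner[of y k z i] Q R sub y z s by simp
    moreover have "z $ i \<le> u $ i" "u $ i < z $ i + s / 2" using u s by (auto simp: z cube_at_def)
    ultimately show ?thesis
      using haar_interval_eq[OF s(1), of e "y $ i" "u $ i"] s(1) by (auto simp: y side_cube_at s_def[symmetric])
  qed
  show ?thesis unfolding haar_def using *[OF x(1)] *[OF x(2)] by simp
qed

lemma haar_functionsD:
  assumes "g \<in> haar_functions Q" "Q \<in> D k"
  shows "g \<in> borel_measurable borel" "\<bar>g x\<bar> \<le> vol Q powr (- (1 / 2)) * indicator Q x"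
    "k + 1 \<le> j \<Longrightarrow> cube_of j x = cube_of j x' \<Longrightarrow> g x = g x'"
proof -
  obtain \<eta> where g: "g = haar \<eta> Q" using assms(1) by (auto simp: haar_functions_def)
  show "g \<in> borel_measurable borel" unfolding g by (rule haar_measurable[OF assms(2)])
  show "\<bar>g x\<bar> \<le> vol Q powr (- (1 / 2)) * indicator Q x" unfolding g by (rule haar_bound[OF assms(2)])
  show "g x = g x'" if "k + 1 \<le> j" "cube_of j x = cube_of j x'"
  proof -
    have "cube_of (k + 1) x = cube_of (k + 1) x'" by (rule cube_of_eq_antimono[OF that])
    then show ?thesis unfolding g
      using haar_const_on_child[OF assms(2) cube_of(1)[of "k + 1" x] cube_of(2)] cube_of(2)[of x' "k + 1"] by simp
  qed
qed

end

section \<open>A finite model of a dyadic shift\<close>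

context dyadic_grid
begin

lemma sets_radon: "radon_measure \<mu> \<Longrightarrow> Q \<in> D k \<Longrightarrow> Q \<in> sets \<mu>"
  using borel by (simp add: radon_measure_def)

lemma emeasure_radon:
  assumes "radon_measure \<mu>" "Q \<in> D k"
  shows "emeasure \<mu> Q < \<infinity>"
proof -
  have "emeasure \<mu> Q \<le> emeasure \<mu> (closure Q)"
    using assms closure_subset[of Q] by (intro emeasure_mono) (auto simp: radon_measure_def)
  also have "\<dots> < \<infinity>"
    using assms(1)[unfolded radon_measure_def, THEN conjunct2, THEN conjunct1] bounded[OF assms(2)] by (simp add: compact_closure)
  finally show ?thesis .
qed

end

locale shift_setup = dyadic_grid D
  for D :: "int \<Rightarrow> (real ^ 'n::finite) set set" +
  fixes m n :: nat
    and a :: "(real ^ 'n) set \<Rightarrow> (real ^ 'n) set \<Rightarrow> (real ^ 'n) set \<Rightarrow> real"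
    and g h :: "(real ^ 'n) set \<Rightarrow> (real ^ 'n) set \<Rightarrow> real ^ 'n \<Rightarrow> real"
  assumes shift: "dyadic_shift D m n a g h"
begin

definition pairs :: "(real ^ 'n) set \<Rightarrow> ((real ^ 'n) set \<times> (real ^ 'n) set) set" where
  "pairs K = {(I, J). I \<in> dyadic_cubes D \<and> J \<in> dyadic_cubes D \<and> ancestor D m I = K \<and> ancestor D n J = K}"

definition active :: "(real ^ 'n) set set" where
  "active = {K \<in> dyadic_cubes D. \<exists>I \<in> dyadic_cubes D. \<exists>J \<in> dyadic_cubes D. ancestor D m I = K \<and> ancestor D n J = K \<and> a I J K \<noteq> 0}"

lemma finite_active: "finite active"
  using shift by (simp add: dyadic_shift_def active_def)

lemma pairsD:
  assumes "(I, J) \<in> pairs K" "K \<in> D k"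
  shows "I \<in> D (k + int m)" "I \<subseteq> K" "J \<in> D (k + int n)" "J \<subseteq> K"
    "g I J \<in> haar_functions I" "h I J \<in> haar_functions J" "\<bar>a I J K\<bar> \<le> sqrt (vol I * vol J) / vol K"
proof -
  have p: "I \<in> dyadic_cubes D" "J \<in> dyadic_cubes D" "ancestor D m I = K" "ancestor D n J = K"
    using assms(1) by (auto simp: pairs_def)
  have K: "K \<in> dyadic_cubes D" using assms(2) by (auto simp: dyadic_cubes_def)
  obtain i j where ij: "I \<in> D i" "J \<in> D j" using p(1,2) by (auto simp: dyadic_cubes_def)
  show "I \<in> D (k + int m)" "I \<subseteq> K" "J \<in> D (k + int n)" "J \<subseteq> K"
    using ancestorD[OF ij(1) p(3) assms(2)] ancestorD[OF ij(2) p(4) assms(2)] ij by auto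
  show "g I J \<in> haar_functions I" "h I J \<in> haar_functions J" "\<bar>a I J K\<bar> \<le> sqrt (vol I * vol J) / vol K"
    using shift[unfolded dyadic_shift_def, THEN conjunct1, THEN bspec[OF _ p(1)], THEN bspec[OF _ p(2)], THEN bspec[OF _ K], THEN mp] p(3,4)
    by simp_all
qed

lemma finite_pairs: "K \<in> D k \<Longrightarrow> finite (pairs K)"
proof (rule finite_subset)
  assume K: "K \<in> D k"
  show "pairs K \<subseteq> {I \<in> D (k + int m). \<exists>x\<in>K. x \<in> I} \<times> {J \<in> D (k + int n). \<exists>x\<in>K. x \<in> J}"
  proof
    fix P assume "P \<in> pairs K"
    moreover obtain I J where P: "P = (I, J)" by force
    ultimately have "(I, J) \<in> pairs K" by simp
    then show "P \<in> {I \<in> D (k + int m). \<exists>x\<in>K. x \<in> I} \<times> {J \<in> D (k + int n). \<exists>x\<in>K. x \<in> J}"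
      using pairsD[OF _ K] nonempty[of I "k + int m"] nonempty[of J "k + int n"] unfolding P by blast
  qed
  show "finite ({I \<in> D (k + int m). \<exists>x\<in>K. x \<in> I} \<times> {J \<in> D (k + int n). \<exists>x\<in>K. x \<in> J})"
    using finite_descendants[OF K] by simp
qed

lemma block_eq: "shift_block D m n a g h \<mu> K f x = (\<Sum>(I, J)\<in>pairs K. a I J K * pairing \<mu> f (g I J) * h I J x)"
  by (simp add: shift_block_def pairs_def)

lemma block_inactive:
  assumes "K \<in> dyadic_cubes D" "K \<notin> active"
  shows "shift_block D m n a g h \<mu> K f x = 0"
  unfolding block_eq using assms by (intro sum.neutral) (auto simp: pairs_def active_def)

lemma block_outside:
  assumes "K \<in> D k" "x \<notin> K"
  shows "shift_block D m n a g h \<mu> K f x = 0"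
  unfolding block_eq
proof (intro sum.neutral ballI)
  fix P assume "P \<in> pairs K"
  then obtain I J where P: "P = (I, J)" "(I, J) \<in> pairs K" by (cases P) auto
  have "x \<notin> J" using pairsD(4)[OF P(2) assms(1)] assms(2) by auto
  then have "h I J x = 0"
    using haar_functionsD(2)[OF pairsD(6,3)[OF P(2) assms(1)], of x] by simp
  then show "(case P of (I, J) \<Rightarrow> a I J K * pairing \<mu> f (g I J) * h I J x) = 0" by (simp add: P)
qed

lemma shift_op_eq: "shift_op D m n a g h \<mu> f x = (\<Sum>K\<in>active. shift_block D m n a g h \<mu> K f x)"
proof -
  have "shift_op D m n a g h \<mu> f x = (\<Sum>\<^sub>\<infinity>K\<in>active. shift_block D m n a g h \<mu> K f x)"
    unfolding shift_op_def using block_inactive by (intro infsum_cong_neutral) (auto simp: active_def)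
  then show ?thesis using finite_active by simp
qed

end

text \<open>
The levels \<open>1, \<dots>, Kn\<close> of the finite model stand for the generations \<open>k0, \<dots>, k0 + Kn - 1\<close>, which contain all active cubes.
\<close>
locale finite_model = shift_setup D m n a g h
  for D :: "int \<Rightarrow> (real ^ 'n::finite) set set" and m n a g h +
  fixes k0 :: int and Kn :: nat
  assumes gens: "K \<in> active \<Longrightarrow> \<exists>i\<in>{1..Kn}. K \<in> D (k0 + int i - 1)"
begin

definition r :: nat where "r = max m n + 1"
definition L :: nat where "L = Kn + r"

text \<open>
Labels are defined for all points and not only for the points of the finite model, so that functions that are constant on
cubes need no translation.
\<close>
definition lab :: "nat \<Rightarrow> real ^ 'n \<Rightarrow> (real ^ 'n) set" where
  "lab i x = cube_of (k0 + int i - 1) x"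

text \<open>
The cubes of generation \<open>k0\<close> that contain an active cube.
\<close>
definition tops :: "(real ^ 'n) set set" where
  "tops = (\<lambda>K. cube_of k0 (SOME x. x \<in> K)) ` active"

definition atoms :: "(real ^ 'n) set set" where
  "atoms = (\<Union>Q\<in>tops. {A \<in> D (k0 + int L - 1). \<exists>x\<in>Q. x \<in> A})"

text \<open>
One representative point in each atom.
\<close>
definition X :: "(real ^ 'n) set" where
  "X = (\<lambda>A. SOME x. x \<in> A) ` atoms"

definition \<Omega> :: "(real ^ 'n) set" where
  "\<Omega> = \<Union> atoms"

lemma L_pos: "1 \<le> L" "k0 + int L - 1 = k0 + int (L - 1)"
  by (simp_all add: L_def r_def)

lemma lab_D: "lab i x \<in> D (k0 + int i - 1)" and lab_in: "x \<in> lab i x"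
  by (simp_all add: lab_def cube_of)

lemma lab_eq: "z \<in> lab i x \<longleftrightarrow> lab i z = lab i x"
  unfolding lab_def using cube_of_cube_of cube_of(2) by metis

lemma lab_eq_mono: "i \<le> j \<Longrightarrow> lab j x = lab j y \<Longrightarrow> lab i x = lab i y"
  unfolding lab_def by (rule cube_of_eq_antimono) auto

lemma lab_sub: "i \<le> j \<Longrightarrow> lab j x \<subseteq> lab i x"
  unfolding lab_def by (rule cube_of_antimono) auto

lemma finite_atoms: "finite atoms"
proof -
  have "finite tops" by (simp add: tops_def finite_active)
  moreover have "tops \<subseteq> D k0" unfolding tops_def using cube_of(1) by auto
  ultimately show ?thesis unfolding atoms_def L_pos(2) using finite_descendants by auto
qed

lemma finite_X: "finite X"
  by (simp add: X_def finite_atoms)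

lemma atoms_D: "A \<in> atoms \<Longrightarrow> A \<in> D (k0 + int L - 1)"
  by (auto simp: atoms_def)

lemma X_atom:
  assumes "x \<in> X"
  shows "lab L x \<in> atoms" "(SOME z. z \<in> lab L x) = x"
proof -
  obtain A where A: "A \<in> atoms" "x = (SOME z. z \<in> A)" using assms by (auto simp: X_def)
  have "\<exists>z. z \<in> A" using nonempty[OF atoms_D[OF A(1)]] by auto
  then have "x \<in> A" unfolding A(2) by (rule someI_ex)
  then have "lab L x = A" unfolding lab_def using atoms_D[OF A(1)] by (intro cube_of_eq)
  then show "lab L x \<in> atoms" "(SOME z. z \<in> lab L x) = x" using A by auto
qed

lemma X_inj: "x \<in> X \<Longrightarrow> y \<in> X \<Longrightarrow> lab L x = lab L y \<Longrightarrow> x = y"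
  using X_atom(2) by metis

lemma \<Omega>_iff: "z \<in> \<Omega> \<longleftrightarrow> lab L z \<in> atoms"
proof
  assume "z \<in> \<Omega>"
  then obtain A where "A \<in> atoms" "z \<in> A" by (auto simp: \<Omega>_def)
  then show "lab L z \<in> atoms" unfolding lab_def using cube_of_eq[OF atoms_D] by metis
qed (use lab_in in \<open>auto simp: \<Omega>_def\<close>)

lemma rep_ex: "z \<in> \<Omega> \<Longrightarrow> \<exists>x\<in>X. lab L z = lab L x"
proof -
  assume "z \<in> \<Omega>"
  then have A: "lab L z \<in> atoms" by (simp add: \<Omega>_iff)
  define x where "x = (SOME u. u \<in> lab L z)"
  have "x \<in> lab L z" unfolding x_def by (rule someI[of "\<lambda>u. u \<in> lab L z", OF lab_in])
  then have "lab L x = lab L z" by (simp add: lab_eq)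
  then show ?thesis using A by (intro bexI[of _ x]) (auto simp: x_def X_def)
qed

lemma X_sub_\<Omega>: "x \<in> X \<Longrightarrow> x \<in> \<Omega>"
  by (simp add: \<Omega>_iff X_atom(1))

lemma \<Omega>_top: "z \<in> \<Omega> \<longleftrightarrow> lab 1 z \<in> tops"
proof
  assume "z \<in> \<Omega>"
  then obtain Q A where Q: "Q \<in> tops" "A \<in> D (k0 + int L - 1)" "\<exists>x\<in>Q. x \<in> A" "z \<in> A"
    by (auto simp: \<Omega>_def atoms_def)
  then have QD: "Q \<in> D k0" by (auto simp: tops_def cube_of(1))
  have "A \<subseteq> Q" using Q nested[OF Q(2) QD] L_pos(1) by auto
  then have "lab 1 z = Q" unfolding lab_def using cube_of_eq[OF QD, of z] Q(4) by auto
  then show "lab 1 z \<in> tops" using Q by simp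
next
  assume t: "lab 1 z \<in> tops"
  have "lab L z \<in> atoms" unfolding atoms_def using t lab_in[of z] lab_D[of L z] by blast
  then show "z \<in> \<Omega>" by (simp add: \<Omega>_iff)
qed

lemma lab_sub_\<Omega>:
  assumes "x \<in> \<Omega>" "1 \<le> i"
  shows "lab i x \<subseteq> \<Omega>"
proof
  fix z assume "z \<in> lab i x"
  then have "lab i z = lab i x" by (simp add: lab_eq)
  then have "lab 1 z = lab 1 x" by (rule lab_eq_mono[OF assms(2)])
  moreover have "lab 1 x \<in> tops" using assms(1) by (rule iffD1[OF \<Omega>_top])
  ultimately have "lab 1 z \<in> tops" by (rule ssubst)
  then show "z \<in> \<Omega>" by (rule iffD2[OF \<Omega>_top])
qed

lemma active_sub_\<Omega>:
  assumes "K \<in> active"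
  shows "K \<subseteq> \<Omega>"
proof
  fix z assume z: "z \<in> K"
  obtain i where i: "i \<in> {1..Kn}" "K \<in> D (k0 + int i - 1)" using gens[OF assms] by auto
  define x where "x = (SOME x. x \<in> K)"
  have x: "x \<in> K" unfolding x_def using z by (rule someI)
  have "lab i z = K" "lab i x = K" unfolding lab_def by (rule cube_of_eq[OF i(2) z], rule cube_of_eq[OF i(2) x])
  then have "lab 1 z = lab 1 x" using lab_eq_mono[of 1 i z x] i by auto
  moreover have "lab 1 x \<in> tops" using assms by (simp add: lab_def tops_def x_def)
  ultimately have "lab 1 z \<in> tops" by (rule ssubst)
  then show "z \<in> \<Omega>" by (rule iffD2[OF \<Omega>_top])
qed

sublocale filtration X lab
proof
  show "finite X" by (rule finite_X)
  show "lab (Suc k) x = lab (Suc k) y \<Longrightarrow> lab k x = lab k y" for x y k by (rule lab_eq_mono[of k "Suc k"]) simp_all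
qed

definition wt :: "(real ^ 'n) measure \<Rightarrow> real ^ 'n \<Rightarrow> real" where
  "wt \<mu> x = measure \<mu> (lab L x)"

lemma lab_cell:
  assumes "x \<in> X" "1 \<le> i" "i \<le> L"
  shows "lab i x = (\<Union>y\<in>cell i x. lab L y)"
proof
  show "lab i x \<subseteq> (\<Union>y\<in>cell i x. lab L y)"
  proof
    fix z assume z: "z \<in> lab i x"
    then have "z \<in> \<Omega>" using lab_sub_\<Omega>[OF X_sub_\<Omega>[OF assms(1)] assms(2)] by auto
    then obtain y where y: "y \<in> X" "lab L z = lab L y" using rep_ex by auto
    then have "lab i y = lab i x" using lab_eq_mono[OF assms(3) y(2)] z by (simp add: lab_eq)
    then show "z \<in> (\<Union>y\<in>cell i x. lab L y)" using y by (auto simp: cell_def lab_eq)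
  qed
  show "(\<Union>y\<in>cell i x. lab L y) \<subseteq> lab i x"
  proof
    fix z assume "z \<in> (\<Union>y\<in>cell i x. lab L y)"
    then obtain y where "lab i y = lab i x" "lab L z = lab L y" by (auto simp: cell_def lab_eq)
    then show "z \<in> lab i x" using lab_eq_mono[OF assms(3), of z y] by (simp add: lab_eq)
  qed
qed

lemma disjoint_atoms: "disjoint_family_on (lab L) X"
  unfolding disjoint_family_on_def using X_inj lab_eq by fastforce

lemma sum_wt:
  assumes \<mu>: "radon_measure \<mu>" and "x \<in> X" "1 \<le> i" "i \<le> L"
  shows "(\<Sum>y\<in>cell i x. wt \<mu> y) = measure \<mu> (lab i x)"
proof -
  have "measure \<mu> (\<Union>y\<in>cell i x. lab L y) = (\<Sum>y\<in>cell i x. measure \<mu> (lab L y))"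
  proof (rule measure_finite_Union)
    show "disjoint_family_on (lab L) (cell i x)" using disjoint_atoms cell_subset disjoint_family_on_mono by metis
    show "lab L ` cell i x \<subseteq> sets \<mu>" using sets_radon[OF \<mu> lab_D] by auto
    show "emeasure \<mu> (lab L y) \<noteq> \<infinity>" for y using emeasure_radon[OF \<mu> lab_D, of L y] by auto
  qed simp
  then show ?thesis unfolding lab_cell[OF assms(2-4)] by (simp add: wt_def)
qed

text \<open>
The kernel of the part of the shift at the cube of level \<open>i\<close> around \<open>x\<close>. The case distinction makes the definition
symmetric, so that the kernel of the adjoint is obtained by exchanging \<open>x\<close> and \<open>y\<close>.
\<close>
definition ker :: "nat \<Rightarrow> real ^ 'n \<Rightarrow> real ^ 'n \<Rightarrow> real" where
  "ker i x y = (if lab i x = lab i y then \<Sum>(I, J)\<in>pairs (lab i x). a I J (lab i x) * h I J x * g I J y else 0)"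

definition \<rho> :: "nat \<Rightarrow> real ^ 'n \<Rightarrow> real" where
  "\<rho> i x = 1 / vol (lab i x)"

lemma vol_lab: "vol (lab i x) = (2 powi (- (k0 + int i - 1))) ^ CARD('n)"
  using vol_eq[OF lab_D] .

lemma \<rho>_double: "2 * \<rho> i x \<le> \<rho> (Suc i) x"
proof -
  define s :: real where "s = 2 powi (- (k0 + int i - 1))"
  have s: "s > 0" by (simp add: s_def)
  have "(2::real) powi (e - 1) = 2 powi e / 2" for e by (simp add: power_int_diff)
  moreover have "- (k0 + int (Suc i) - 1) = - (k0 + int i - 1) - 1" by simp
  ultimately have "2 powi (- (k0 + int (Suc i) - 1)) = s / 2" unfolding s_def by (simp only:)
  then have "vol (lab (Suc i) x) = (s / 2) ^ CARD('n)" "vol (lab i x) = s ^ CARD('n)"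
    unfolding vol_lab by (simp_all only: s_def)
  then have "\<rho> (Suc i) x = 2 ^ CARD('n) * \<rho> i x" using s by (simp add: \<rho>_def power_divide)
  moreover have "(2::real) ^ 1 \<le> 2 ^ CARD('n)" by (intro power_increasing) (auto simp: Suc_leI)
  moreover have "0 \<le> \<rho> i x" by (simp add: \<rho>_def)
  ultimately show ?thesis using mult_right_mono[of 2 "2 ^ CARD('n)" "\<rho> i x"] by simp
qed

lemma term_le:
  assumes "(I, J) \<in> pairs K" "K \<in> D k"
  shows "\<bar>a I J K * h I J x * g I J y\<bar> \<le> 1 / vol K * (indicator I y * indicator J x)"
proof -
  note P = pairsD[OF assms]
  have v: "vol I > 0" "vol J > 0" "vol K > 0" using vol_pos P assms(2) by auto
  have "\<bar>a I J K * h I J x * g I J y\<bar> = \<bar>a I J K\<bar> * \<bar>h I J x\<bar> * \<bar>g I J y\<bar>" by (simp add: abs_mult)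
  also have "\<dots> \<le> sqrt (vol I * vol J) / vol K * (vol J powr (- (1 / 2)) * indicator J x) * (vol I powr (- (1 / 2)) * indicator I y)"
    using haar_functionsD(2)[OF P(6,3), of x] haar_functionsD(2)[OF P(5,1), of y] P(7)
    by (intro mult_mono mult_nonneg_nonneg) auto
  also have "\<dots> = 1 / vol K * (indicator I y * indicator J x)"
    using v by (simp add: powr_minus powr_half_sqrt real_sqrt_mult field_simps)
  finally show ?thesis .
qed

text \<open>
At given points \<open>x\<close> and \<open>y\<close> at most one pair of cubes \<open>(I, J)\<close> contributes to the sum.
\<close>
lemma ker_le: "\<bar>ker i x y\<bar> \<le> \<rho> i x"
proof (cases "lab i x = lab i y")
  case True
  define K where "K = lab i x"
  define k where "k = k0 + int i - 1"
  have K: "K \<in> D k" by (simp add: K_def k_def lab_D)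
  have "\<bar>ker i x y\<bar> \<le> (\<Sum>(I, J)\<in>pairs K. \<bar>a I J K * h I J x * g I J y\<bar>)"
    using True by (simp add: ker_def K_def case_prod_unfold)
  also have "\<dots> \<le> (\<Sum>P\<in>pairs K. if P = (cube_of (k + int m) y, cube_of (k + int n) x) then \<rho> i x else 0)"
  proof (rule sum_mono)
    fix P assume "P \<in> pairs K"
    then obtain I J where P: "P = (I, J)" "(I, J) \<in> pairs K" by (cases P) auto
    show "(case P of (I, J) \<Rightarrow> \<bar>a I J K * h I J x * g I J y\<bar>) \<le> (if P = (cube_of (k + int m) y, cube_of (k + int n) x) then \<rho> i x else 0)"
    proof (cases "y \<in> I \<and> x \<in> J")
      case True
      then have "I = cube_of (k + int m) y" "J = cube_of (k + int n) x"
        using cube_of_eq pairsD(1,3)[OF P(2) K] by auto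
      then show ?thesis using term_le[OF P(2) K, of x y] True P by (simp add: \<rho>_def K_def)
    next
      case False
      have "0 \<le> \<rho> i x" by (simp add: \<rho>_def)
      then show ?thesis using term_le[OF P(2) K, of x y] False P by (auto simp: indicator_def split: if_splits)
    qed
  qed
  also have "\<dots> \<le> \<rho> i x"
    using finite_pairs[OF K] by (simp add: sum.delta \<rho>_def)
  finally show ?thesis .
qed (simp add: ker_def \<rho>_def)

lemma haar_lab_const:
  assumes "(I, J) \<in> pairs K" "K \<in> D (k0 + int i - 1)" "lab (i + r) x = lab (i + r) x'"
  shows "h I J x = h I J x'" "g I J x = g I J x'"
proof -
  have e: "cube_of (k0 + int (i + r) - 1) x = cube_of (k0 + int (i + r) - 1) x'" using assms(3) by (simp add: lab_def)
  show "h I J x = h I J x'"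
    by (rule haar_functionsD(3)[OF pairsD(6,3)[OF assms(1,2)] _ e]) (simp add: r_def)
  show "g I J x = g I J x'"
    by (rule haar_functionsD(3)[OF pairsD(5,1)[OF assms(1,2)] _ e]) (simp add: r_def)
qed

lemma ker_lab1:
  assumes "lab (i + r) x = lab (i + r) x'"
  shows "ker i x y = ker i x' y"
proof -
  have "lab i x = lab i x'" using lab_eq_mono[OF _ assms] by simp
  moreover have "(\<Sum>(I, J)\<in>pairs (lab i x'). a I J (lab i x') * h I J x * g I J y) = (\<Sum>(I, J)\<in>pairs (lab i x'). a I J (lab i x') * h I J x' * g I J y)"
    using haar_lab_const(1)[OF _ lab_D assms] by (intro sum.cong refl) auto
  ultimately show ?thesis unfolding ker_def by (simp only:)
qed

lemma ker_lab2:
  assumes "lab (i + r) y = lab (i + r) y'"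
  shows "ker i x y = ker i x y'"
proof -
  have "lab i y = lab i y'" using lab_eq_mono[OF _ assms] by simp
  moreover have "(\<Sum>(I, J)\<in>pairs (lab i x). a I J (lab i x) * h I J x * g I J y) = (\<Sum>(I, J)\<in>pairs (lab i x). a I J (lab i x) * h I J x * g I J y')"
    using haar_lab_const(2)[OF _ lab_D assms] by (intro sum.cong refl) auto
  ultimately show ?thesis unfolding ker_def by (simp only:)
qed

definition atom_int :: "(real ^ 'n) measure \<Rightarrow> (real ^ 'n \<Rightarrow> real) \<Rightarrow> real ^ 'n \<Rightarrow> real" where
  "atom_int \<mu> f y = (LINT z|\<mu>. f z * indicator (lab L y) z)"

lemma pairing_eq:
  assumes int: "\<And>y. y \<in> X \<Longrightarrow> integrable \<mu> (\<lambda>z. f z * indicator (lab L y) z)"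
    and K: "K \<in> active" and P: "(I, J) \<in> pairs K"
  shows "pairing \<mu> f (g I J) = (\<Sum>y\<in>X. g I J y * atom_int \<mu> f y)"
proof -
  obtain i where i: "i \<in> {1..Kn}" "K \<in> D (k0 + int i - 1)" using gens[OF K] by auto
  have "f z * g I J z = (\<Sum>y\<in>X. g I J y * (f z * indicator (lab L y) z))" for z
  proof (cases "z \<in> \<Omega>")
    case False
    then have "z \<notin> I" using pairsD(2)[OF P i(2)] active_sub_\<Omega>[OF K] by auto
    then have "g I J z = 0" using haar_functionsD(2)[OF pairsD(5,1)[OF P i(2)], of z] by simp
    moreover have "z \<notin> lab L y" if "y \<in> X" for y
      using lab_sub_\<Omega>[OF X_sub_\<Omega>[OF that] L_pos(1)] False by auto
    ultimately show ?thesis by simp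
  next
    case True
    then obtain x where x: "x \<in> X" "lab L z = lab L x" using rep_ex by auto
    have "lab (i + r) z = lab (i + r) x" using lab_eq_mono[OF _ x(2)] i by (simp add: L_def)
    then have gx: "g I J z = g I J x" by (rule haar_lab_const(2)[OF P i(2)])
    have "(\<Sum>y\<in>X. g I J y * (f z * indicator (lab L y) z)) = (\<Sum>y\<in>X. if y = x then g I J x * f z else 0)"
      using X_inj x by (intro sum.cong) (auto simp: indicator_def lab_eq)
    then show ?thesis using x finite_X gx by simp
  qed
  then have "pairing \<mu> f (g I J) = (LINT z|\<mu>. (\<Sum>y\<in>X. g I J y * (f z * indicator (lab L y) z)))"
    by (simp add: pairing_def)
  also have "\<dots> = (\<Sum>y\<in>X. LINT z|\<mu>. g I J y * (f z * indicator (lab L y) z))"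
    using int by (intro Bochner_Integration.integral_sum integrable_mult_right)
  finally show ?thesis by (simp add: atom_int_def)
qed

text \<open>
The shift is an integral operator on the finite model: the value at \<open>x\<close> depends on \<open>f\<close> only through its integrals over
the atoms, and only the cubes that contain \<open>x\<close> contribute.
\<close>
lemma shift_op_X:
  assumes int: "\<And>y. y \<in> X \<Longrightarrow> integrable \<mu> (\<lambda>z. f z * indicator (lab L y) z)"
  shows "shift_op D m n a g h \<mu> f x = (\<Sum>i=1..Kn. \<Sum>y\<in>X. ker i x y * atom_int \<mu> f y)"
proof -
  let ?b = "\<lambda>K. shift_block D m n a g h \<mu> K f x"
  have lab_K: "lab i x = K" if "K \<in> D (k0 + int i - 1)" "x \<in> K" for i K
    unfolding lab_def using that by (rule cube_of_eq)
  have "shift_op D m n a g h \<mu> f x = (\<Sum>K\<in>{K \<in> active. x \<in> K}. ?b K)"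
    unfolding shift_op_eq
  proof (rule sum.mono_neutral_right)
    show "\<forall>K\<in>active - {K \<in> active. x \<in> K}. ?b K = 0"
    proof (rule ballI)
      fix K assume K: "K \<in> active - {K \<in> active. x \<in> K}"
      then have "K \<in> active" by simp
      then obtain i where "K \<in> D (k0 + int i - 1)" using gens[of K] by blast
      then show "?b K = 0" using K by (intro block_outside) auto
    qed
  qed (auto simp: finite_active)
  also have "{K \<in> active. x \<in> K} = (\<lambda>i. lab i x) ` {i \<in> {1..Kn}. lab i x \<in> active}"
  proof (intro subset_antisym subsetI)
    fix K assume K: "K \<in> {K \<in> active. x \<in> K}"
    then obtain i where i: "i \<in> {1..Kn}" "K \<in> D (k0 + int i - 1)" using gens[of K] by auto
    then have "lab i x = K" using lab_K K by auto
    then show "K \<in> (\<lambda>i. lab i x) ` {i \<in> {1..Kn}. lab i x \<in> active}" using i K by auto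
  qed (auto simp: lab_in)
  also have "(\<Sum>K\<in>(\<lambda>i. lab i x) ` {i \<in> {1..Kn}. lab i x \<in> active}. ?b K) = (\<Sum>i\<in>{i \<in> {1..Kn}. lab i x \<in> active}. ?b (lab i x))"
  proof (rule sum.reindex[unfolded o_def], rule inj_onI)
    fix i j assume "lab i x = lab j x"
    then have "k0 + int i - 1 = k0 + int j - 1" using generation_unique[OF lab_D] lab_D by metis
    then show "i = j" by simp
  qed
  also have "\<dots> = (\<Sum>i=1..Kn. ?b (lab i x))"
  proof -
    have "lab i x \<in> dyadic_cubes D" for i using lab_D[of i x] by (auto simp: dyadic_cubes_def)
    then have "?b (lab i x) = 0" if "lab i x \<notin> active" for i using that by (rule block_inactive)
    then show ?thesis by (intro sum.mono_neutral_left) auto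
  qed
  also have "\<dots> = (\<Sum>i=1..Kn. \<Sum>y\<in>X. ker i x y * atom_int \<mu> f y)"
  proof (rule sum.cong[OF refl])
    fix i assume i: "i \<in> {1..Kn}"
    define K where "K = lab i x"
    have KD: "K \<in> D (k0 + int i - 1)" by (simp add: K_def lab_D)
    have "?b K = (\<Sum>(I, J)\<in>pairs K. \<Sum>y\<in>X. a I J K * h I J x * g I J y * atom_int \<mu> f y)"
      unfolding block_eq
    proof (rule sum.cong[OF refl])
      fix P assume "P \<in> pairs K"
      then obtain I J where P: "P = (I, J)" "(I, J) \<in> pairs K" by (cases P) auto
      have "a I J K * pairing \<mu> f (g I J) * h I J x = (\<Sum>y\<in>X. a I J K * h I J x * g I J y * atom_int \<mu> f y)"
      proof (cases "a I J K = 0")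
        case False
        then have "K \<in> active" using P KD by (auto simp: active_def pairs_def dyadic_cubes_def)
        then show ?thesis using pairing_eq[OF int _ P(2)] by (simp add: sum_distrib_left sum_distrib_right mult_ac)
      qed simp
      then show "(case P of (I, J) \<Rightarrow> a I J K * pairing \<mu> f (g I J) * h I J x)
        = (case P of (I, J) \<Rightarrow> \<Sum>y\<in>X. a I J K * h I J x * g I J y * atom_int \<mu> f y)" by (simp add: P)
    qed
    also have "\<dots> = (\<Sum>y\<in>X. \<Sum>(I, J)\<in>pairs K. a I J K * h I J x * g I J y * atom_int \<mu> f y)"
      unfolding case_prod_unfold by (rule sum.swap)
    also have "\<dots> = (\<Sum>y\<in>X. ker i x y * atom_int \<mu> f y)"
    proof (rule sum.cong[OF refl])
      fix y assume "y \<in> X"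
      show "(\<Sum>(I, J)\<in>pairs K. a I J K * h I J x * g I J y * atom_int \<mu> f y) = ker i x y * atom_int \<mu> f y"
      proof (cases "lab i x = lab i y")
        case True
        then show ?thesis by (simp add: ker_def K_def sum_distrib_right case_prod_unfold)
      next
        case False
        have "(\<Sum>(I, J)\<in>pairs K. a I J K * h I J x * g I J y * atom_int \<mu> f y) = 0"
        proof (intro sum.neutral ballI)
          fix P assume "P \<in> pairs K"
          then obtain I J where P: "P = (I, J)" "(I, J) \<in> pairs K" by (cases P) auto
          have "y \<notin> I" using pairsD(2)[OF P(2) KD] False by (auto simp: K_def lab_eq)
          then have "g I J y = 0" using haar_functionsD(2)[OF pairsD(5,1)[OF P(2) KD], of y] by simp
          then show "(case P of (I, J) \<Rightarrow> a I J K * h I J x * g I J y * atom_int \<mu> f y) = 0" by (simp add: P)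
        qed
        then show ?thesis using False by (simp add: ker_def)
      qed
    qed
    finally show "?b (lab i x) = (\<Sum>y\<in>X. ker i x y * atom_int \<mu> f y)" by (simp add: K_def)
  qed
  finally show ?thesis .
qed

lemma shift_op_outside: "z \<notin> \<Omega> \<Longrightarrow> shift_op D m n a g h \<mu> f z = 0"
  unfolding shift_op_eq
proof (intro sum.neutral ballI)
  fix K assume z: "z \<notin> \<Omega>" and K: "K \<in> active"
  obtain i where "K \<in> D (k0 + int i - 1)" using gens[OF K] by auto
  then show "shift_block D m n a g h \<mu> K f z = 0"
    using z active_sub_\<Omega>[OF K] by (intro block_outside) auto
qed

lemma shift_op_const:
  assumes "lab L z = lab L x"
  shows "shift_op D m n a g h \<mu> f z = shift_op D m n a g h \<mu> f x"
  unfolding shift_op_eq block_eq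
proof (intro sum.cong refl)
  fix K P assume K: "K \<in> active" and "P \<in> pairs K"
  then obtain I J where P: "P = (I, J)" "(I, J) \<in> pairs K" by (cases P) auto
  obtain i where i: "i \<in> {1..Kn}" "K \<in> D (k0 + int i - 1)" using gens[OF K] by auto
  have "lab (i + r) z = lab (i + r) x" using lab_eq_mono[OF _ assms] i by (simp add: L_def)
  then have "h I J z = h I J x" by (rule haar_lab_const(1)[OF P(2) i(2)])
  then show "(case P of (I, J) \<Rightarrow> a I J K * pairing \<mu> f (g I J) * h I J z) = (case P of (I, J) \<Rightarrow> a I J K * pairing \<mu> f (g I J) * h I J x)"
    by (simp add: P)
qed

end

section \<open>Norms and constants in the finite model\<close>

lemma epowr_ennreal: "0 \<le> v \<Longrightarrow> epowr (ennreal v) a = ennreal (v powr a)"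
  by (simp add: epowr_def)

lemma epowr_0 [simp]: "epowr 0 a = 0"
  using epowr_ennreal[of 0 a] by simp

context finite_model
begin

lemma weighted: "weighted_filtration X lab (wt \<mu>)"
  by unfold_locales (simp add: wt_def)

abbreviation mnrm :: "(real ^ 'n) measure \<Rightarrow> real \<Rightarrow> (real ^ 'n \<Rightarrow> real) \<Rightarrow> real" where
  "mnrm \<mu> \<equiv> weighted_filtration.nrm X (wt \<mu>)"

lemma mass_eq:
  assumes "radon_measure \<mu>" "x \<in> X" "i \<in> {1..L}"
  shows "weighted_filtration.mass X lab (wt \<mu>) i x = measure \<mu> (lab i x)"
  unfolding weighted_filtration.mass_def[OF weighted] using assms by (intro sum_wt) auto

lemma Lp_norm_atoms:
  assumes \<mu>: "radon_measure \<mu>" and p: "0 < p" and \<phi>: "\<And>x. x \<in> X \<Longrightarrow> 0 \<le> \<phi> x"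
    and \<Phi>: "\<And>x z. x \<in> X \<Longrightarrow> z \<in> lab L x \<Longrightarrow> \<Phi> z = ennreal (\<phi> x)" and out: "\<And>z. z \<notin> \<Omega> \<Longrightarrow> \<Phi> z = 0"
  shows "Lp_norm \<mu> p \<Phi> = ennreal (mnrm \<mu> p \<phi>)"
proof -
  interpret weighted_filtration X lab "wt \<mu>" by (rule weighted)
  have "epowr (\<Phi> z) p = (\<Sum>x\<in>X. ennreal (\<phi> x powr p) * indicator (lab L x) z)" for z
  proof (cases "z \<in> \<Omega>")
    case True
    then obtain x where x: "x \<in> X" "lab L z = lab L x" using rep_ex by auto
    then have z: "z \<in> lab L x" by (simp add: lab_eq)
    have "(\<Sum>y\<in>X. ennreal (\<phi> y powr p) * indicator (lab L y) z) = (\<Sum>y\<in>X. if y = x then ennreal (\<phi> x powr p) else 0)"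
      using X_inj x by (intro sum.cong) (auto simp: indicator_def lab_eq)
    then show ?thesis using \<Phi>[OF x(1) z] \<phi>[OF x(1)] x(1) finite_X by (simp add: epowr_ennreal)
  next
    case False
    then have "z \<notin> lab L y" if "y \<in> X" for y
      using lab_sub_\<Omega>[OF X_sub_\<Omega>[OF that] L_pos(1)] by auto
    then show ?thesis using out[OF False] by (simp add: sum.neutral)
  qed
  then have "(\<integral>\<^sup>+ z. epowr (\<Phi> z) p \<partial>\<mu>) = (\<Sum>x\<in>X. ennreal (\<phi> x powr p) * emeasure \<mu> (lab L x))"
    using sets_radon[OF \<mu> lab_D] by (simp add: nn_integral_sum nn_integral_cmult_indicator)
  also have "\<dots> = (\<Sum>x\<in>X. ennreal (wt \<mu> x * \<bar>\<phi> x\<bar> powr p))"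
  proof (rule sum.cong[OF refl])
    fix x assume "x \<in> X"
    have "emeasure \<mu> (lab L x) = ennreal (wt \<mu> x)"
      unfolding wt_def using emeasure_radon[OF \<mu> lab_D, of L x] by (intro emeasure_eq_ennreal_measure) auto
    then show "ennreal (\<phi> x powr p) * emeasure \<mu> (lab L x) = ennreal (wt \<mu> x * \<bar>\<phi> x\<bar> powr p)"
      using \<phi>[OF \<open>x \<in> X\<close>] by (simp add: ennreal_mult' mult.commute)
  qed
  also have "\<dots> = ennreal (I (\<lambda>x. \<bar>\<phi> x\<bar> powr p))"
    unfolding I_def by (intro sum_ennreal) (simp add: wt_def)
  finally show ?thesis unfolding Lp_norm_def nrm_def by (simp add: epowr_ennreal I_nonneg)
qed

definition cubes :: "(real ^ 'n) set set" where
  "cubes = (\<Union>i\<in>{1..L}. lab i ` X)"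

lemma finite_cubes: "finite cubes"
  by (simp add: cubes_def finite_X)

lemma lab_inj: "lab i x = lab j y \<Longrightarrow> i = j"
proof -
  assume "lab i x = lab j y"
  then have "lab i x \<in> D (k0 + int j - 1)" using lab_D[of j y] by simp
  then have "k0 + int i - 1 = k0 + int j - 1" by (rule generation_unique[OF lab_D])
  then show "i = j" by simp
qed

lemma sum_cubes:
  fixes G :: "(real ^ 'n) set \<Rightarrow> ennreal"
  assumes z: "x \<in> X" "z \<in> lab L x" and G: "\<And>Q. z \<notin> Q \<Longrightarrow> G Q = 0"
  shows "(\<Sum>Q\<in>cubes. G Q) = (\<Sum>i=1..L. G (lab i x))"
proof -
  have "(\<Sum>Q\<in>cubes. G Q) = (\<Sum>Q\<in>(\<lambda>i. lab i x) ` {1..L}. G Q)"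
  proof (rule sum.mono_neutral_right[OF finite_cubes])
    show "(\<lambda>i. lab i x) ` {1..L} \<subseteq> cubes" using z(1) by (auto simp: cubes_def)
    show "\<forall>Q\<in>cubes - (\<lambda>i. lab i x) ` {1..L}. G Q = 0"
    proof (rule ballI)
      fix Q assume Q: "Q \<in> cubes - (\<lambda>i. lab i x) ` {1..L}"
      then obtain i y where i: "i \<in> {1..L}" "y \<in> X" "Q = lab i y" by (auto simp: cubes_def)
      have "z \<notin> Q"
      proof
        assume "z \<in> Q"
        then have e1: "lab i z = lab i y" by (simp add: i lab_eq)
        have "lab L z = lab L x" using z(2) by (simp add: lab_eq)
        then have e2: "lab i z = lab i x" by (rule lab_eq_mono[rotated]) (use i in auto)
        have "Q = lab i x" unfolding i(3) e1[symmetric] by (rule e2)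
        then show False using Q i(1) by auto
      qed
      then show "G Q = 0" by (rule G)
    qed
  qed
  also have "\<dots> = (\<Sum>i=1..L. G (lab i x))"
    by (rule sum.reindex[unfolded o_def]) (rule inj_onI, erule lab_inj)
  finally show ?thesis .
qed

lemma cube_in_\<Omega>: "Q \<in> cubes \<Longrightarrow> Q \<subseteq> \<Omega>"
proof -
  assume "Q \<in> cubes"
  then obtain i x where "x \<in> X" "1 \<le> i" "Q = lab i x" by (auto simp: cubes_def)
  then show ?thesis using lab_sub_\<Omega>[OF X_sub_\<Omega>] by simp
qed

lemma not_in_cube: "z \<notin> \<Omega> \<Longrightarrow> Q \<in> cubes \<Longrightarrow> indicator Q z = (0::real)"
  using cube_in_\<Omega>[of Q] by (auto simp: indicator_def)

text \<open>
Coefficients indexed by levels and points, regarded as coefficients indexed by cubes and extended by zero to all other cubes.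
\<close>
definition ext :: "(nat \<Rightarrow> real ^ 'n \<Rightarrow> real) \<Rightarrow> (real ^ 'n) set \<Rightarrow> real" where
  "ext b Q = (if Q \<in> cubes then THE v. \<exists>i\<in>{1..L}. \<exists>x\<in>X. Q = lab i x \<and> v = b i x else 0)"

lemma ext_lab:
  assumes b: "\<And>k. cst k (b k)" and i: "i \<in> {1..L}" and x: "x \<in> X"
  shows "ext b (lab i x) = b i x"
proof -
  have "lab i x \<in> cubes" using i x by (auto simp: cubes_def)
  moreover have "(THE v. \<exists>j\<in>{1..L}. \<exists>y\<in>X. lab i x = lab j y \<and> v = b j y) = b i x"
  proof (rule the_equality)
    show "\<exists>j\<in>{1..L}. \<exists>y\<in>X. lab i x = lab j y \<and> b i x = b j y" using i x by blast
    fix v assume "\<exists>j\<in>{1..L}. \<exists>y\<in>X. lab i x = lab j y \<and> v = b j y"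
    then obtain j y where j: "y \<in> X" "lab i x = lab j y" "v = b j y" by blast
    have ij: "i = j" by (rule lab_inj[OF j(2)])
    then have "lab i x = lab i y" using j(2) by simp
    then have "b i x = b i y" by (rule cstD[OF b x j(1)])
    then show "v = b i x" using j(3) ij by simp
  qed
  ultimately show ?thesis by (simp add: ext_def)
qed

lemma ext_outside: "Q \<notin> cubes \<Longrightarrow> ext b Q = 0"
  by (simp add: ext_def)

lemma cubes_dyadic: "cubes \<subseteq> dyadic_cubes D"
  using lab_D by (auto simp: cubes_def dyadic_cubes_def)

lemma Lp_norm_square_function:
  assumes \<mu>: "radon_measure \<mu>" and p: "0 < p"
    and \<Phi>: "\<And>x z. x \<in> X \<Longrightarrow> z \<in> lab L x \<Longrightarrow> \<Phi> z = (\<Sum>i=1..L. ennreal ((b i x)\<^sup>2))" and out: "\<And>z. z \<notin> \<Omega> \<Longrightarrow> \<Phi> z = 0"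
  shows "Lp_norm \<mu> p (\<lambda>z. epowr (\<Phi> z) (1 / 2)) = ennreal (mnrm \<mu> p (\<lambda>x. L2_set (\<lambda>k. b k x) {1..L}))"
proof (rule Lp_norm_atoms[OF \<mu> p])
  fix x z assume "x \<in> X" "z \<in> lab L x"
  then have "\<Phi> z = ennreal (\<Sum>i=1..L. (b i x)\<^sup>2)" using \<Phi> by (simp add: sum_ennreal)
  then show "epowr (\<Phi> z) (1 / 2) = ennreal (L2_set (\<lambda>k. b k x) {1..L})"
    by (simp add: epowr_ennreal sum_nonneg L2_set_def powr_half_sqrt)
qed (simp_all add: out)

lemma infsum_ext:
  fixes c :: "(real ^ 'n) set \<Rightarrow> real"
  assumes c: "\<And>Q. Q \<notin> cubes \<Longrightarrow> c Q = 0"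
  shows "(\<Sum>\<^sub>\<infinity>Q \<in> dyadic_cubes D. ennreal ((c Q)\<^sup>2 * indicator Q z)) = (\<Sum>Q\<in>cubes. ennreal ((c Q)\<^sup>2 * indicator Q z))"
proof -
  have "(\<Sum>\<^sub>\<infinity>Q \<in> dyadic_cubes D. ennreal ((c Q)\<^sup>2 * indicator Q z)) = (\<Sum>\<^sub>\<infinity>Q \<in> cubes. ennreal ((c Q)\<^sup>2 * indicator Q z))"
    using c cubes_dyadic by (intro infsum_cong_neutral) auto
  then show ?thesis using finite_cubes by simp
qed

lemma Lp_norm_cubes:
  assumes \<mu>: "radon_measure \<mu>" and p: "0 < p" and c: "\<And>Q. Q \<notin> cubes \<Longrightarrow> c Q = 0"
    and b: "\<And>i x. i \<in> {1..L} \<Longrightarrow> x \<in> X \<Longrightarrow> c (lab i x) = b i x"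
  shows "Lp_norm \<mu> p (\<lambda>z. epowr (\<Sum>\<^sub>\<infinity>Q \<in> dyadic_cubes D. ennreal ((c Q)\<^sup>2 * indicator Q z)) (1 / 2))
    = ennreal (mnrm \<mu> p (\<lambda>x. L2_set (\<lambda>k. b k x) {1..L}))"
proof -
  have ie: "(\<Sum>\<^sub>\<infinity>Q \<in> dyadic_cubes D. ennreal ((c Q)\<^sup>2 * indicator Q z)) = (\<Sum>Q\<in>cubes. ennreal ((c Q)\<^sup>2 * indicator Q z))" for z
    by (rule infsum_ext) (rule c)
  show ?thesis
  proof (rule Lp_norm_square_function[OF \<mu> p])
    fix x z assume x: "x \<in> X" "z \<in> lab L x"
    have "z \<in> lab i x" if "i \<in> {1..L}" for i using lab_sub[of i L x] that x(2) by auto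
    then show "(\<Sum>\<^sub>\<infinity>Q \<in> dyadic_cubes D. ennreal ((c Q)\<^sup>2 * indicator Q z)) = (\<Sum>i=1..L. ennreal ((b i x)\<^sup>2))"
      unfolding ie using b x by (subst sum_cubes[OF x]) (auto intro!: sum.cong)
  next
    fix z assume "z \<notin> \<Omega>"
    then show "(\<Sum>\<^sub>\<infinity>Q \<in> dyadic_cubes D. ennreal ((c Q)\<^sup>2 * indicator Q z)) = 0"
      unfolding ie using not_in_cube by (intro sum.neutral) simp
  qed
qed

lemma apq_discrete:
  assumes \<sigma>: "radon_measure \<sigma>" and w: "radon_measure w" and pq: "0 < p" "0 < q" and A: "0 \<le> A"
    and bound: "quadratic_Apq_bound D p q \<sigma> w (ennreal A)" and b: "\<And>k. cst k (b k)"
  shows "mnrm w q (\<lambda>x. L2_set (\<lambda>k. b k x * (weighted_filtration.mass X lab (wt \<sigma>) k x * \<rho> k x)) {1..L})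
    \<le> A * mnrm \<sigma> p (\<lambda>x. L2_set (\<lambda>k. b k x) {1..L})"
proof -
  have e1: "Lp_norm w q (\<lambda>x. epowr (\<Sum>\<^sub>\<infinity>Q \<in> dyadic_cubes D. ennreal ((ext b Q * (measure \<sigma> Q / vol Q))\<^sup>2 * indicator Q x)) (1 / 2))
    = ennreal (mnrm w q (\<lambda>x. L2_set (\<lambda>k. b k x * (weighted_filtration.mass X lab (wt \<sigma>) k x * \<rho> k x)) {1..L}))"
    using ext_lab[OF b] mass_eq[OF \<sigma>] by (intro Lp_norm_cubes[OF w pq(2)]) (auto simp: ext_outside \<rho>_def)
  have e2: "Lp_norm \<sigma> p (\<lambda>x. epowr (\<Sum>\<^sub>\<infinity>Q \<in> dyadic_cubes D. ennreal ((ext b Q)\<^sup>2 * indicator Q x)) (1 / 2))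
    = ennreal (mnrm \<sigma> p (\<lambda>x. L2_set (\<lambda>k. b k x) {1..L}))"
    using ext_lab[OF b] by (intro Lp_norm_cubes[OF \<sigma> pq(1)]) (auto simp: ext_outside)
  have "ennreal (mnrm w q (\<lambda>x. L2_set (\<lambda>k. b k x * (weighted_filtration.mass X lab (wt \<sigma>) k x * \<rho> k x)) {1..L}))
    \<le> ennreal A * ennreal (mnrm \<sigma> p (\<lambda>x. L2_set (\<lambda>k. b k x) {1..L}))"
    using bound[unfolded quadratic_Apq_bound_def, THEN spec, of "ext b"] unfolding e1 e2 .
  then show ?thesis
    using A weighted_filtration.nrm_nonneg[OF weighted] by (simp add: ennreal_mult'[symmetric] ennreal_le_iff)
qed

text \<open>
The testing condition concerns sequences of cubes; it is used for an enumeration of the cubes of the finite model, continued by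
zero coefficients.
\<close>
lemma testing_discrete:
  assumes \<sigma>: "radon_measure \<sigma>" and w: "radon_measure w" and pq: "0 < p" "0 < q" and C: "0 \<le> C"
    and bound: "testing_bound D p q \<sigma> w T (ennreal C)" and b: "\<And>k. cst k (b k)"
    and T: "\<And>i x z. i \<in> {1..L} \<Longrightarrow> x \<in> X \<Longrightarrow> z \<in> lab L x \<Longrightarrow> T (indicator (lab i x)) z = \<tau> i x"
  shows "mnrm w q (\<lambda>x. L2_set (\<lambda>k. b k x * \<tau> k x) {1..L}) \<le> C * mnrm \<sigma> p (\<lambda>x. L2_set (\<lambda>k. b k x) {1..L})"
proof (cases "X = {}")
  case True
  show ?thesis unfolding weighted_filtration.nrm_def[OF weighted] weighted_filtration.I_def[OF weighted]
    using True by simp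
next
  case False
  define N where "N = card cubes"
  obtain e where e: "bij_betw e {0..<N} cubes" using ex_bij_betw_nat_finite[OF finite_cubes] unfolding N_def by blast
  have "cubes \<noteq> {}" using False L_pos by (auto simp: cubes_def)
  then have N: "0 < N" using finite_cubes by (simp add: N_def card_gt_0_iff)
  define Qs where "Qs = (\<lambda>i. if i < N then e i else e 0)"
  define as where "as = (\<lambda>i. if i < N then ext b (e i) else 0)"
  have Qs: "Qs i \<in> dyadic_cubes D" for i
    using bij_betwE[OF e] N cubes_dyadic by (auto simp: Qs_def)
  have series: "(\<Sum>i. F (as i) (Qs i)) = (\<Sum>Q\<in>cubes. F (ext b Q) Q)" if "\<And>Q. F 0 Q = (0 :: ennreal)" for F
  proof -
    have "(\<Sum>i. F (as i) (Qs i)) = (\<Sum>i\<in>{0..<N}. F (as i) (Qs i))"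
      using that by (intro suminf_finite) (auto simp: as_def)
    also have "\<dots> = (\<Sum>i\<in>{0..<N}. F (ext b (e i)) (e i))" by (intro sum.cong) (auto simp: as_def Qs_def)
    also have "\<dots> = (\<Sum>Q\<in>cubes. F (ext b Q) Q)" by (rule sum.reindex_bij_betw[OF e])
    finally show ?thesis .
  qed
  have e1: "Lp_norm w q (\<lambda>x. epowr (\<Sum>i. ennreal ((as i * indicator (Qs i) x * T (indicator (Qs i)) x)\<^sup>2)) (1 / 2))
    = ennreal (mnrm w q (\<lambda>x. L2_set (\<lambda>k. b k x * \<tau> k x) {1..L}))"
  proof (rule Lp_norm_square_function[OF w pq(2)])
    fix z
    have s: "(\<Sum>i. ennreal ((as i * indicator (Qs i) z * T (indicator (Qs i)) z)\<^sup>2))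
      = (\<Sum>Q\<in>cubes. ennreal ((ext b Q * indicator Q z * T (indicator Q) z)\<^sup>2))"
      by (rule series[of "\<lambda>u Q. ennreal ((u * indicator Q z * T (indicator Q) z)\<^sup>2)"]) simp
    show "(\<Sum>i. ennreal ((as i * indicator (Qs i) z * T (indicator (Qs i)) z)\<^sup>2)) = (\<Sum>i=1..L. ennreal ((b i x * \<tau> i x)\<^sup>2))"
      if x: "x \<in> X" "z \<in> lab L x" for x
    proof -
      have "z \<in> lab i x" if "i \<in> {1..L}" for i using lab_sub[of i L x] that x(2) by auto
      then show ?thesis unfolding s using ext_lab[OF b] T x by (subst sum_cubes[OF x]) (auto intro!: sum.cong)
    qed
    show "(\<Sum>i. ennreal ((as i * indicator (Qs i) z * T (indicator (Qs i)) z)\<^sup>2)) = 0" if "z \<notin> \<Omega>"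
      unfolding s using not_in_cube[OF that] by (intro sum.neutral) simp
  qed
  have e2: "Lp_norm \<sigma> p (\<lambda>x. epowr (\<Sum>i. ennreal ((as i)\<^sup>2 * indicator (Qs i) x)) (1 / 2))
    = ennreal (mnrm \<sigma> p (\<lambda>x. L2_set (\<lambda>k. b k x) {1..L}))"
  proof (rule Lp_norm_square_function[OF \<sigma> pq(1)])
    fix z
    have s: "(\<Sum>i. ennreal ((as i)\<^sup>2 * indicator (Qs i) z)) = (\<Sum>Q\<in>cubes. ennreal ((ext b Q)\<^sup>2 * indicator Q z))"
      by (rule series[of "\<lambda>u Q. ennreal (u\<^sup>2 * indicator Q z)"]) simp
    show "(\<Sum>i. ennreal ((as i)\<^sup>2 * indicator (Qs i) z)) = (\<Sum>i=1..L. ennreal ((b i x)\<^sup>2))"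
      if x: "x \<in> X" "z \<in> lab L x" for x
    proof -
      have "z \<in> lab i x" if "i \<in> {1..L}" for i using lab_sub[of i L x] that x(2) by auto
      then show ?thesis unfolding s using ext_lab[OF b] x by (subst sum_cubes[OF x]) (auto intro!: sum.cong)
    qed
    show "(\<Sum>i. ennreal ((as i)\<^sup>2 * indicator (Qs i) z)) = 0" if "z \<notin> \<Omega>"
      unfolding s using not_in_cube[OF that] by (intro sum.neutral) simp
  qed
  have "ennreal (mnrm w q (\<lambda>x. L2_set (\<lambda>k. b k x * \<tau> k x) {1..L}))
    \<le> ennreal C * ennreal (mnrm \<sigma> p (\<lambda>x. L2_set (\<lambda>k. b k x) {1..L}))"
    using bound[unfolded testing_bound_def, THEN spec, of Qs, THEN spec, of as, THEN mp, OF allI[OF Qs]] unfolding e1 e2 .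
  then show ?thesis
    using C weighted_filtration.nrm_nonneg[OF weighted] by (simp add: ennreal_mult'[symmetric] ennreal_le_iff)
qed

lemma shift_op_indicator:
  assumes \<mu>: "radon_measure \<mu>" and i: "i \<in> {1..L}" and x: "x \<in> X" and z: "z \<in> lab L x"
  shows "shift_op D m n a g h \<mu> (indicator (lab i x)) z = (\<Sum>j\<in>{1..Kn}. \<Sum>y\<in>cell i x. ker j x y * wt \<mu> y)"
proof -
  have sub: "indicator (lab i x) u * indicator (lab L y) u = (if y \<in> cell i x then indicator (lab L y) u else (0::real))" if y: "y \<in> X" for y u
  proof (cases "u \<in> lab L y")
    case True
    then have "lab L u = lab L y" by (simp add: lab_eq)
    then have "lab i u = lab i y" by (rule lab_eq_mono[rotated]) (use i in auto)
    then show ?thesis using True y by (auto simp: indicator_def lab_eq cell_def)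
  qed simp
  have fin: "emeasure \<mu> (lab L y) < \<infinity>" and meas: "lab L y \<in> sets \<mu>" for y
    using emeasure_radon[OF \<mu> lab_D] sets_radon[OF \<mu> lab_D] by auto
  have at: "atom_int \<mu> (indicator (lab i x)) y = (if y \<in> cell i x then wt \<mu> y else 0)" if "y \<in> X" for y
  proof -
    have "space \<mu> = UNIV" using \<mu> sets_eq_imp_space_eq[of \<mu> borel] by (simp add: radon_measure_def)
    then show ?thesis unfolding atom_int_def sub[OF that] by (auto simp: wt_def)
  qed
  have int: "integrable \<mu> (\<lambda>u. indicator (lab i x) u * indicator (lab L y) u :: real)" if "y \<in> X" for y
    unfolding sub[OF that] using fin[of y] meas[of y] by (cases "y \<in> cell i x") (auto simp: integrable_indicator_iff)
  have "shift_op D m n a g h \<mu> (indicator (lab i x)) z = shift_op D m n a g h \<mu> (indicator (lab i x)) x"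
    using z by (intro shift_op_const) (simp add: lab_eq)
  also have "\<dots> = (\<Sum>j=1..Kn. \<Sum>y\<in>X. ker j x y * atom_int \<mu> (indicator (lab i x)) y)"
    by (intro shift_op_X int)
  also have "\<dots> = (\<Sum>j\<in>{1..Kn}. \<Sum>y\<in>cell i x. ker j x y * wt \<mu> y)"
  proof (rule sum.cong[OF refl])
    fix j
    have "(\<Sum>y\<in>X. ker j x y * atom_int \<mu> (indicator (lab i x)) y) = (\<Sum>y\<in>X. if y \<in> cell i x then ker j x y * wt \<mu> y else 0)"
      using at by (intro sum.cong) auto
    also have "\<dots> = (\<Sum>y\<in>{y \<in> X. y \<in> cell i x}. ker j x y * wt \<mu> y)" by (rule sum.inter_filter[OF finite_X, symmetric])
    also have "{y \<in> X. y \<in> cell i x} = cell i x" using cell_subset by auto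
    finally show "(\<Sum>y\<in>X. ker j x y * atom_int \<mu> (indicator (lab i x)) y) = (\<Sum>y\<in>cell i x. ker j x y * wt \<mu> y)" .
  qed
  finally show ?thesis .
qed

end

section \<open>The norm bound for a dyadic shift\<close>

lemma epowr_mono: "x \<le> y \<Longrightarrow> 0 \<le> a \<Longrightarrow> epowr x a \<le> epowr y a"
  by (cases x; cases y) (auto simp: epowr_def top_unique intro!: ennreal_leI powr_mono2)

lemma epowr_finite_iff: "epowr x a < \<infinity> \<longleftrightarrow> x < \<infinity>"
  by (cases x) (auto simp: epowr_def)

lemma Lp_space_finite:
  assumes "f \<in> Lp_space \<mu> p"
  shows "(\<integral>\<^sup>+ z. ennreal (\<bar>f z\<bar> powr p) \<partial>\<mu>) < \<infinity>" "Lp_norm \<mu> p (\<lambda>x. ennreal \<bar>f x\<bar>) = epowr (\<integral>\<^sup>+ z. ennreal (\<bar>f z\<bar> powr p) \<partial>\<mu>) (1 / p)"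
    "f \<in> borel_measurable \<mu>"
proof -
  show e: "Lp_norm \<mu> p (\<lambda>x. ennreal \<bar>f x\<bar>) = epowr (\<integral>\<^sup>+ z. ennreal (\<bar>f z\<bar> powr p) \<partial>\<mu>) (1 / p)"
    by (simp add: Lp_norm_def epowr_ennreal)
  show "(\<integral>\<^sup>+ z. ennreal (\<bar>f z\<bar> powr p) \<partial>\<mu>) < \<infinity>"
  proof -
    have "Lp_norm \<mu> p (\<lambda>x. ennreal \<bar>f x\<bar>) < \<infinity>" using assms by (simp add: Lp_space_def)
    then show ?thesis unfolding e epowr_finite_iff .
  qed
  show "f \<in> borel_measurable \<mu>" using assms by (simp add: Lp_space_def)
qed

lemma Lp_space_local:
  assumes f: "f \<in> Lp_space \<mu> p" and p: "1 < p" and Q: "Q \<in> sets \<mu>" "emeasure \<mu> Q < \<infinity>"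
  shows "integrable \<mu> (\<lambda>z. \<bar>f z\<bar> powr p * indicator Q z)" "integrable \<mu> (\<lambda>z. f z * indicator Q z)"
proof -
  note F = Lp_space_finite[OF f]
  have m: "f \<in> borel_measurable \<mu>" by (rule F(3))
  have "integrable \<mu> (\<lambda>z. \<bar>f z\<bar> powr p)"
    using F(1) m by (intro integrableI_bounded) auto
  then show i: "integrable \<mu> (\<lambda>z. \<bar>f z\<bar> powr p * indicator Q z)"
    using Q(1) by (intro integrable_real_mult_indicator)
  have "integrable \<mu> (\<lambda>z. indicator Q z + \<bar>f z\<bar> powr p * indicator Q z)"
    using Q i by (intro Bochner_Integration.integrable_add integrable_real_indicator)
  then show "integrable \<mu> (\<lambda>z. f z * indicator Q z)"
  proof (rule Bochner_Integration.integrable_bound)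
    show "(\<lambda>z. f z * indicator Q z) \<in> borel_measurable \<mu>" using m Q by measurable
    have "\<bar>u\<bar> \<le> 1 + \<bar>u\<bar> powr p" for u :: real
    proof (cases "\<bar>u\<bar> \<le> 1")
      case True then show ?thesis by (smt (verit) powr_ge_zero)
    next
      case False
      then have "\<bar>u\<bar> powr 1 \<le> \<bar>u\<bar> powr p" using p by (intro powr_mono) auto
      then show ?thesis using False by simp
    qed
    then show "AE z in \<mu>. norm (f z * indicator Q z) \<le> norm (indicator Q z + \<bar>f z\<bar> powr p * indicator Q z :: real)"
      by (intro AE_I2) (auto simp: indicator_def intro: order_trans)
  qed
qed

text \<open>
The tangent inequality for the \<open>p\<close>-th power at the modulus of the average, integrated over the set.
\<close>
lemma jensen_on_set:
  assumes f: "f \<in> Lp_space \<mu> p" and p: "1 < p" and Q: "Q \<in> sets \<mu>" "emeasure \<mu> Q < \<infinity>"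
  shows "measure \<mu> Q * \<bar>(LINT z|\<mu>. f z * indicator Q z) / measure \<mu> Q\<bar> powr p \<le> (LINT z|\<mu>. \<bar>f z\<bar> powr p * indicator Q z)"
proof (cases "measure \<mu> Q = 0")
  case True then show ?thesis by simp
next
  case False
  define M where "M = measure \<mu> Q"
  have M: "M > 0" using False by (simp add: M_def zero_less_measure_iff)
  define c where "c = \<bar>(LINT z|\<mu>. f z * indicator Q z) / M\<bar>"
  have c: "c \<ge> 0" "c * M = \<bar>LINT z|\<mu>. f z * indicator Q z\<bar>" using M by (auto simp: c_def abs_mult)
  have i1: "integrable \<mu> (\<lambda>z. \<bar>f z\<bar> * indicator Q z)"
    using integrable_abs[OF Lp_space_local(2)[OF f p Q]] by (simp add: abs_mult)
  have i2: "integrable \<mu> (\<lambda>z. indicator Q z :: real)" using Q by simp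
  have "\<bar>LINT z|\<mu>. f z * indicator Q z\<bar> \<le> (LINT z|\<mu>. \<bar>f z\<bar> * indicator Q z)"
    using integral_abs_bound[of \<mu> "\<lambda>z. f z * indicator Q z"] by (simp add: abs_mult)
  then have "0 \<le> p * c powr (p - 1) * ((LINT z|\<mu>. \<bar>f z\<bar> * indicator Q z) - c * M)"
    using c p by (intro mult_nonneg_nonneg) auto
  then have "M * c powr p \<le> c powr p * M + p * c powr (p - 1) * ((LINT z|\<mu>. \<bar>f z\<bar> * indicator Q z) - c * M)" by simp
  also have "\<dots> = (LINT z|\<mu>. c powr p * indicator Q z + p * c powr (p - 1) * (\<bar>f z\<bar> * indicator Q z - c * indicator Q z))"
    using i1 i2 Q(1) by (simp add: M_def)
  also have "\<dots> \<le> (LINT z|\<mu>. \<bar>f z\<bar> powr p * indicator Q z)"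
  proof (rule integral_mono)
    show "integrable \<mu> (\<lambda>z. c powr p * indicator Q z + p * c powr (p - 1) * (\<bar>f z\<bar> * indicator Q z - c * indicator Q z))"
      using i1 i2 by simp
    show "integrable \<mu> (\<lambda>z. \<bar>f z\<bar> powr p * indicator Q z)" by (rule Lp_space_local(1)[OF f p Q])
    show "c powr p * indicator Q z + p * c powr (p - 1) * (\<bar>f z\<bar> * indicator Q z - c * indicator Q z) \<le> \<bar>f z\<bar> powr p * indicator Q z" for z
      using powr_tangent_le[of p c "\<bar>f z\<bar>"] p c by (simp add: indicator_def)
  qed
  finally show ?thesis by (simp add: c_def M_def)
qed

context finite_model
begin

lemma nrm_average_le:
  assumes \<mu>: "radon_measure \<mu>" and p: "1 < p" and f: "f \<in> Lp_space \<mu> p"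
  shows "ennreal (mnrm \<mu> p (\<lambda>y. atom_int \<mu> f y / wt \<mu> y)) \<le> Lp_norm \<mu> p (\<lambda>x. ennreal \<bar>f x\<bar>)"
proof -
  interpret weighted_filtration X lab "wt \<mu>" by (rule weighted)
  have Q: "lab L y \<in> sets \<mu>" "emeasure \<mu> (lab L y) < \<infinity>" for y
    using sets_radon[OF \<mu> lab_D] emeasure_radon[OF \<mu> lab_D] by auto
  have "ennreal (I (\<lambda>y. \<bar>atom_int \<mu> f y / wt \<mu> y\<bar> powr p)) = (\<Sum>y\<in>X. ennreal (wt \<mu> y * \<bar>atom_int \<mu> f y / wt \<mu> y\<bar> powr p))"
    unfolding I_def by (rule sum_ennreal[symmetric]) (simp add: wt_def)
  also have "\<dots> \<le> (\<Sum>y\<in>X. \<integral>\<^sup>+ z. ennreal (\<bar>f z\<bar> powr p) * indicator (lab L y) z \<partial>\<mu>)"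
  proof (rule sum_mono)
    fix y assume "y \<in> X"
    have "ennreal (wt \<mu> y * \<bar>atom_int \<mu> f y / wt \<mu> y\<bar> powr p) \<le> ennreal (LINT z|\<mu>. \<bar>f z\<bar> powr p * indicator (lab L y) z)"
      unfolding wt_def atom_int_def by (intro ennreal_leI jensen_on_set f p Q)
    also have "\<dots> = (\<integral>\<^sup>+ z. ennreal (\<bar>f z\<bar> powr p * indicator (lab L y) z) \<partial>\<mu>)"
      by (intro nn_integral_eq_integral[symmetric] Lp_space_local f p Q) auto
    also have "\<dots> = (\<integral>\<^sup>+ z. ennreal (\<bar>f z\<bar> powr p) * indicator (lab L y) z \<partial>\<mu>)"
      by (intro nn_integral_cong) (auto simp: indicator_def)
    finally show "ennreal (wt \<mu> y * \<bar>atom_int \<mu> f y / wt \<mu> y\<bar> powr p) \<le> (\<integral>\<^sup>+ z. ennreal (\<bar>f z\<bar> powr p) * indicator (lab L y) z \<partial>\<mu>)" .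
  qed
  also have "\<dots> = (\<integral>\<^sup>+ z. (\<Sum>y\<in>X. ennreal (\<bar>f z\<bar> powr p) * indicator (lab L y) z) \<partial>\<mu>)"
    using Lp_space_finite(3)[OF f] Q by (intro nn_integral_sum[symmetric]) auto
  also have "\<dots> \<le> (\<integral>\<^sup>+ z. ennreal (\<bar>f z\<bar> powr p) \<partial>\<mu>)"
  proof (rule nn_integral_mono)
    fix z
    have "(\<Sum>y\<in>X. ennreal (\<bar>f z\<bar> powr p) * indicator (lab L y) z) = (\<Sum>y\<in>X. if z \<in> lab L y then ennreal (\<bar>f z\<bar> powr p) else 0)"
      by (intro sum.cong) (auto simp: indicator_def)
    also have "\<dots> = (\<Sum>y\<in>{y \<in> X. z \<in> lab L y}. ennreal (\<bar>f z\<bar> powr p))"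
      by (rule sum.inter_filter[OF finite_X, symmetric])
    also have "\<dots> \<le> ennreal (\<bar>f z\<bar> powr p)"
    proof -
      have "card {y \<in> X. z \<in> lab L y} \<le> 1"
        using X_inj by (intro card_le_Suc0_iff_eq[THEN iffD2, folded One_nat_def]) (auto simp: finite_X lab_eq)
      then consider "card {y \<in> X. z \<in> lab L y} = 0" | "card {y \<in> X. z \<in> lab L y} = 1" by linarith
      then show ?thesis unfolding sum_constant by cases simp_all
    qed
    finally show "(\<Sum>y\<in>X. ennreal (\<bar>f z\<bar> powr p) * indicator (lab L y) z) \<le> ennreal (\<bar>f z\<bar> powr p)" .
  qed
  finally have "epowr (ennreal (I (\<lambda>y. \<bar>atom_int \<mu> f y / wt \<mu> y\<bar> powr p))) (1 / p) \<le> epowr (\<integral>\<^sup>+ z. ennreal (\<bar>f z\<bar> powr p) \<partial>\<mu>) (1 / p)"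
    using p by (intro epowr_mono) auto
  then show ?thesis
    unfolding Lp_space_finite(2)[OF f] nrm_def by (simp add: epowr_ennreal I_nonneg)
qed

end

context shift_setup
begin

text \<open>
The adjoint of a shift with parameters \<open>(m, n)\<close> is the shift with parameters \<open>(n, m)\<close> in which the two cubes of every pair
exchange their roles.
\<close>
definition swap_a :: "(real ^ 'n) set \<Rightarrow> (real ^ 'n) set \<Rightarrow> (real ^ 'n) set \<Rightarrow> real" where
  "swap_a J I K = a I J K"

definition swap_h :: "(real ^ 'n) set \<Rightarrow> (real ^ 'n) set \<Rightarrow> real ^ 'n \<Rightarrow> real" where
  "swap_h J I = h I J"

definition swap_g :: "(real ^ 'n) set \<Rightarrow> (real ^ 'n) set \<Rightarrow> real ^ 'n \<Rightarrow> real" where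
  "swap_g J I = g I J"

lemma adjoint_op_eq: "adjoint_op D m n a g h \<mu> = shift_op D n m swap_a swap_h swap_g \<mu>"
proof -
  have "adjoint_block D m n a g h \<mu> K \<phi> x = shift_block D n m swap_a swap_h swap_g \<mu> K \<phi> x" for K \<phi> x
    unfolding adjoint_block_def shift_block_def swap_a_def swap_h_def swap_g_def
    by (rule sum.reindex_bij_witness[of _ prod.swap prod.swap]) auto
  then show ?thesis by (intro ext) (simp add: adjoint_op_def shift_op_def)
qed

lemma swap_shift: "shift_setup D n m swap_a swap_h swap_g"
proof
  have "{K \<in> dyadic_cubes D. \<exists>I \<in> dyadic_cubes D. \<exists>J \<in> dyadic_cubes D. ancestor D n I = K \<and> ancestor D m J = K \<and> swap_a I J K \<noteq> 0}
    = active"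
    unfolding active_def swap_a_def by blast
  then have 1: "finite {K \<in> dyadic_cubes D. \<exists>I \<in> dyadic_cubes D. \<exists>J \<in> dyadic_cubes D. ancestor D n I = K \<and> ancestor D m J = K \<and> swap_a I J K \<noteq> 0}"
    using finite_active by simp
  have 2: "swap_h I J \<in> haar_functions I \<and> swap_g I J \<in> haar_functions J \<and> \<bar>swap_a I J K\<bar> \<le> sqrt (vol I * vol J) / vol K"
    if "I \<in> dyadic_cubes D" "J \<in> dyadic_cubes D" "K \<in> dyadic_cubes D" "ancestor D n I = K \<and> ancestor D m J = K" for I J K
    using shift[unfolded dyadic_shift_def, THEN conjunct1, THEN bspec[OF _ that(2)], THEN bspec[OF _ that(1)], THEN bspec[OF _ that(3)], THEN mp] that(4)
    by (simp add: swap_a_def swap_h_def swap_g_def mult.commute)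
  show "dyadic_shift D n m swap_a swap_h swap_g"
    unfolding dyadic_shift_def using 1 2 by (intro conjI ballI impI) auto
qed

end

context finite_model
begin

lemma swap_model: "finite_model D n m swap_a swap_h swap_g k0 Kn"
proof -
  interpret sw: shift_setup D n m swap_a swap_h swap_g by (rule swap_shift)
  have "sw.active = active" unfolding sw.active_def active_def swap_a_def by blast
  then show ?thesis by unfold_locales (use gens in auto)
qed

lemma adjoint_op_indicator:
  assumes \<mu>: "radon_measure \<mu>" and i: "i \<in> {1..L}" and x: "x \<in> X" and z: "z \<in> lab L x"
  shows "adjoint_op D m n a g h \<mu> (indicator (lab i x)) z = (\<Sum>j\<in>{1..Kn}. \<Sum>y\<in>cell i x. ker j y x * wt \<mu> y)"
proof -
  interpret sw: finite_model D n m swap_a swap_h swap_g k0 Kn by (rule swap_model)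
  have act: "sw.active = active" unfolding sw.active_def active_def swap_a_def by blast
  have r: "sw.r = r" by (simp add: sw.r_def r_def max.commute)
  have L: "sw.L = L" by (simp add: sw.L_def L_def r)
  have atoms: "sw.atoms = atoms" by (simp add: sw.atoms_def atoms_def sw.tops_def tops_def act L)
  have X: "sw.X = X" by (simp add: sw.X_def X_def atoms)
  have wt: "sw.wt \<mu> = wt \<mu>" by (simp add: sw.wt_def wt_def fun_eq_iff L)
  have ker: "sw.ker j x y = ker j y x" for j x y
  proof -
    have "(\<Sum>(I, J)\<in>sw.pairs K. swap_a I J K * swap_g I J x * swap_h I J y) = (\<Sum>(I, J)\<in>pairs K. a I J K * h I J y * g I J x)" for K
      by (rule sum.reindex_bij_witness[of _ prod.swap prod.swap]) (auto simp: sw.pairs_def pairs_def swap_a_def swap_g_def swap_h_def)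
    then show ?thesis by (simp add: sw.ker_def ker_def)
  qed
  show ?thesis
    using sw.shift_op_indicator[OF \<mu>, of i x z] i x z unfolding adjoint_op_eq by (simp add: L X wt ker)
qed

text \<open>
The estimate on the finite model is applied to the averages \<open>f'\<close> of \<open>f\<close>, whose norm is at most that of \<open>f\<close>, and to the dual function
\<open>G\<close> of \<open>T f\<close>, which turns the bilinear form into the \<open>q\<close>-th power of the norm of \<open>T f\<close>.
\<close>
theorem norm_bound_shift:
  assumes \<sigma>: "radon_measure \<sigma>" and w: "radon_measure w" and p: "1 < p" and q: "1 < q"
    and nn: "0 \<le> A" "0 \<le> T" "0 \<le> T'"
    and apq: "quadratic_Apq_bound D p q \<sigma> w (ennreal A)"
    and T: "testing_bound D p q \<sigma> w (shift_op D m n a g h \<sigma>) (ennreal T)"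
    and T': "testing_bound D (holder_conj q) (holder_conj p) w \<sigma> (adjoint_op D m n a g h w) (ennreal T')"
  shows "norm_bound p q \<sigma> w (shift_op D m n a g h \<sigma>)
    (ennreal (shift_const p q * ((1 + real (max m n)) * (T + T') + (1 + real (max m n))\<^sup>2 * A)))"
proof -
  define P where "P = p / (p - 1)"
  define Q where "Q = q / (q - 1)"
  have PQ: "P > 1" "Q > 1" using p q by (auto simp: P_def Q_def)
  interpret S: weighted_filtration X lab "wt \<sigma>" by (rule weighted)
  interpret W: weighted_filtration X lab "wt w" by (rule weighted)
  have \<rho>_cst: "cst k (\<rho> k)" for k by (rule cstI) (simp add: \<rho>_def)
  have \<rho>0: "0 \<le> \<rho> k x" for k x by (simp add: \<rho>_def)
  have ker_loc: "lab k x = lab k y" if "ker k x y \<noteq> 0" for k x y using that by (auto simp: ker_def split: if_splits)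
  have kc1: "cst (k + r) (\<lambda>x. ker k x y)" for k y by (rule cstI) (rule ker_lab1)
  have kc2: "cst (k + r) (\<lambda>y. ker k x y)" for k x by (rule cstI) (rule ker_lab2)
  have ker_le': "\<bar>ker k y x\<bar> \<le> \<rho> k x" for k x y
    using ker_le[of k y x] ker_loc[of k y x] \<rho>0[of k x] by (cases "ker k y x = 0") (auto simp: \<rho>_def)
  have r0: "0 < r" by (simp add: r_def)
  interpret TW: two_weight X lab "wt \<sigma>" "wt w" p q \<rho> L A
  proof
    fix b :: "nat \<Rightarrow> real ^ 'n \<Rightarrow> real" assume b: "\<And>k. cst k (b k)"
    show "W.nrm q (\<lambda>x. L2_set (\<lambda>k. b k x * (S.mass k x * \<rho> k x)) {1..L}) \<le> A * S.nrm p (\<lambda>x. L2_set (\<lambda>k. b k x) {1..L})"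
      using p q by (intro apq_discrete[OF \<sigma> w _ _ nn(1) apq b]) auto
  qed (use p q nn \<rho>0 \<rho>_cst in auto)
  interpret TP: two_weight_pair X lab "wt \<sigma>" "wt w" p q \<rho> L A ker Kn r T T'
  proof
    fix b :: "nat \<Rightarrow> real ^ 'n \<Rightarrow> real" assume b: "\<And>k. cst k (b k)"
    show "W.nrm q (\<lambda>x. L2_set (\<lambda>k. b k x * (\<Sum>j\<in>{1..Kn}. \<Sum>y\<in>cell k x. ker j x y * wt \<sigma> y)) {1..L}) \<le> T * S.nrm p (\<lambda>x. L2_set (\<lambda>k. b k x) {1..L})"
      using p q by (intro testing_discrete[OF \<sigma> w _ _ nn(2) T b] shift_op_indicator[OF \<sigma>]) auto
    show "S.nrm (p / (p - 1)) (\<lambda>x. L2_set (\<lambda>k. b k x * (\<Sum>j\<in>{1..Kn}. \<Sum>y\<in>cell k x. ker j y x * wt w y)) {1..L}) \<le> T' * W.nrm (q / (q - 1)) (\<lambda>x. L2_set (\<lambda>k. b k x) {1..L})"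
    proof (rule testing_discrete[OF w \<sigma> _ _ nn(3) _ b])
      show "0 < q / (q - 1)" "0 < p / (p - 1)" using p q by auto
      show "testing_bound D (q / (q - 1)) (p / (p - 1)) w \<sigma> (adjoint_op D m n a g h w) (ennreal T')"
        using T' by (simp add: holder_conj_def)
    qed (rule adjoint_op_indicator[OF w])
    show "S.nrm (p / (p - 1)) (\<lambda>x. L2_set (\<lambda>k. b k x * (W.mass k x * \<rho> k x)) {1..L}) \<le> stein_norm p * A * W.nrm (q / (q - 1)) (\<lambda>x. L2_set (\<lambda>k. b k x) {1..L})"
      by (rule TW.dual_apq[OF b])
  next
    show "1 < q / (q - 1)" "1 < p / (p - 1)" using PQ by (auto simp: P_def Q_def)
    show "0 \<le> stein_norm p * A" using nn by (simp add: stein_norm_def)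
  qed (use nn r0 ker_le ker_le' kc1 kc2 ker_loc \<rho>_double \<rho>0 \<rho>_cst in \<open>auto simp: L_def dest: sym\<close>)
  define C where "C = shift_const p q * ((1 + real (max m n)) * (T + T') + (1 + real (max m n))\<^sup>2 * A)"
  have C: "C \<ge> 0" using shift_const_pos[of p q] nn by (simp add: C_def)
  show ?thesis unfolding norm_bound_def C_def[symmetric]
  proof
    fix f assume f: "f \<in> Lp_space \<sigma> p"
    define u where "u = shift_op D m n a g h \<sigma> f"
    define f' where "f' = (\<lambda>y. atom_int \<sigma> f y / wt \<sigma> y)"
    have Qm: "lab L y \<in> sets \<sigma>" "emeasure \<sigma> (lab L y) < \<infinity>" for y
      using sets_radon[OF \<sigma> lab_D] emeasure_radon[OF \<sigma> lab_D] by auto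
    have int: "integrable \<sigma> (\<lambda>z. f z * indicator (lab L y) z)" for y by (intro Lp_space_local[OF f p] Qm)
    have at: "wt \<sigma> y * f' y = atom_int \<sigma> f y" for y
    proof (cases "wt \<sigma> y = 0")
      case True
      then have "emeasure \<sigma> (lab L y) = 0" using Qm(2)[of y] by (auto simp: wt_def measure_def enn2real_eq_0_iff)
      then have "AE z in \<sigma>. z \<notin> lab L y" using Qm(1) by (intro AE_not_in null_setsI)
      then have "AE z in \<sigma>. f z * indicator (lab L y) z = 0" by eventually_elim simp
      then have "atom_int \<sigma> f y = 0" unfolding atom_int_def by (rule integral_eq_zero_AE)
      then show ?thesis using True by simp
    qed (simp add: f'_def)
    have u: "u x = (\<Sum>k=1..Kn. \<Sum>y\<in>X. ker k x y * (wt \<sigma> y * f' y))" for x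
      unfolding u_def at by (rule shift_op_X[OF int])
    \<comment> \<open>The extremal function in the duality for \<open>u\<close>.\<close>
    define G where "G = (\<lambda>x. sgn (u x) * \<bar>u x\<bar> powr (q - 1))"
    define N where "N = W.I (\<lambda>x. \<bar>u x\<bar> powr q)"
    have N0: "N \<ge> 0" by (auto simp: N_def intro!: W.I_nonneg)
    have uG: "u x * G x = \<bar>u x\<bar> powr q" for x
      using powr_add[of "\<bar>u x\<bar>" 1 "q - 1"] by (auto simp: G_def sgn_if)
    have "N = W.I (\<lambda>x. u x * G x)" by (simp add: N_def uG)
    also have "\<dots> = (\<Sum>k=1..Kn. TP.form k f' G)"
      by (simp add: TP.form_eq u sum_distrib_right W.I_sum)
    also have "\<dots> \<le> C * S.nrm p f' * W.nrm (q / (q - 1)) G"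
      using TP.form_bound[of "real (max m n)" f' G] unfolding C_def by (simp add: r_def abs_le_iff)
    also have "W.nrm (q / (q - 1)) G = N powr (1 - 1 / q)"
    proof -
      have "\<bar>G x\<bar> powr (q / (q - 1)) = \<bar>u x\<bar> powr q" for x
        using q by (simp add: G_def abs_mult powr_mult powr_powr sgn_if)
      then show ?thesis using q by (simp add: W.nrm_def N_def divide_simps)
    qed
    finally have NC: "N \<le> (C * S.nrm p f') * N powr (1 - 1 / q)" .
    have "W.nrm q u \<le> C * S.nrm p f'"
    proof (cases "N = 0")
      case True
      then show ?thesis using C q by (simp add: W.nrm_def N_def[symmetric])
    next
      case False
      then have "N powr (1 / q) * N powr (1 - 1 / q) = N" using N0 by (simp flip: powr_add)
      then have "N powr (1 / q) * N powr (1 - 1 / q) \<le> (C * S.nrm p f') * N powr (1 - 1 / q)" using NC by simp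
      then have "N powr (1 / q) \<le> C * S.nrm p f'" using False by (simp add: mult_le_cancel_right)
      then show ?thesis by (simp add: W.nrm_def N_def)
    qed
    then have "ennreal (mnrm w q (\<lambda>x. \<bar>u x\<bar>)) \<le> ennreal (C * S.nrm p f')"
      by (intro ennreal_leI) (simp add: W.nrm_def)
    also have "\<dots> = ennreal C * ennreal (S.nrm p f')" using C by (simp add: ennreal_mult')
    also have "\<dots> \<le> ennreal C * Lp_norm \<sigma> p (\<lambda>x. ennreal \<bar>f x\<bar>)"
      unfolding f'_def by (intro mult_left_mono nrm_average_le \<sigma> p f) auto
    also have "ennreal (mnrm w q (\<lambda>x. \<bar>u x\<bar>)) = Lp_norm w q (\<lambda>x. ennreal \<bar>u x\<bar>)"
    proof (rule Lp_norm_atoms[OF w, symmetric])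
      show "ennreal \<bar>u z\<bar> = ennreal \<bar>u x\<bar>" if "z \<in> lab L x" for x z
        using shift_op_const[of z x] that by (simp add: u_def lab_eq)
      show "ennreal \<bar>u z\<bar> = 0" if "z \<notin> \<Omega>" for z using shift_op_outside[OF that] by (simp add: u_def)
    qed (use q in auto)
    finally show "Lp_norm w q (\<lambda>x. ennreal \<bar>shift_op D m n a g h \<sigma> f x\<bar>) \<le> ennreal C * Lp_norm \<sigma> p (\<lambda>x. ennreal \<bar>f x\<bar>)"
      by (simp add: u_def)
  qed
qed

end

section \<open>Finiteness of the testing constants, and the theorem\<close>

lemma epowr_measurable [measurable]: "(\<lambda>x. epowr x a) \<in> borel_measurable borel"
  unfolding epowr_def by measurable

lemma epowr_half_square: "epowr (x * x) (1 / 2) = x"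
  by (cases x) (auto simp: epowr_def ennreal_mult'[symmetric] powr_half_sqrt ennreal_top_mult)

text \<open>
A replacement for Hoelder's inequality with a worse constant: after division by its norm, \<open>S\<close> is at most \<open>1 + S powr p\<close>.
\<close>
lemma local_integral_le_Lp_norm:
  assumes S: "S \<in> borel_measurable \<mu>" and \<Omega>: "\<Omega> \<in> sets \<mu>" and p: "1 < p" and fin: "Lp_norm \<mu> p S < \<infinity>"
  shows "(\<integral>\<^sup>+ y. S y * indicator \<Omega> y \<partial>\<mu>) \<le> Lp_norm \<mu> p S * (emeasure \<mu> \<Omega> + 1)"
proof -
  define v where "v = (\<integral>\<^sup>+ y. epowr (S y) p \<partial>\<mu>)"
  have v: "v < \<infinity>" using fin unfolding Lp_norm_def v_def epowr_finite_iff .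
  have t: "Lp_norm \<mu> p S = epowr v (1 / p)" by (simp add: Lp_norm_def v_def)
  show ?thesis
  proof (cases "v = 0")
    case True
    then have "AE y in \<mu>. epowr (S y) p = 0" using S unfolding v_def by (subst (asm) nn_integral_0_iff_AE) auto
    then have "AE y in \<mu>. S y = 0"
    proof eventually_elim
      fix y assume "epowr (S y) p = 0"
      then show "S y = 0" by (cases "S y") (auto simp: epowr_def split: if_splits)
    qed
    then have "(\<integral>\<^sup>+ y. S y * indicator \<Omega> y \<partial>\<mu>) = (\<integral>\<^sup>+ y. 0 \<partial>\<mu>)"
      by (intro nn_integral_cong_AE) (auto elim: eventually_mono)
    then show ?thesis by simp
  next
    case False
    define u where "u = enn2real v"
    have u: "v = ennreal u" "0 < u" using v False by (auto simp: u_def enn2real_positive_iff less_top zero_less_iff_neq_zero)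
    define s where "s = u powr (1 / p)"
    have s: "0 < s" "s powr p = u" using u p by (auto simp: s_def powr_powr)
    have tS: "Lp_norm \<mu> p S = ennreal s" unfolding t u(1) s_def using u by (simp add: epowr_ennreal)
    have pt: "S y * indicator \<Omega> y \<le> ennreal s * indicator \<Omega> y + ennreal (s / u) * epowr (S y) p" for y
    proof (cases "S y")
      case (real b)
      have "b \<le> s + s / u * b powr p"
      proof (cases "b \<le> s")
        case False
        then have "1 \<le> b / s" using s by simp
        then have "(b / s) powr 1 \<le> (b / s) powr p" using p by (intro powr_mono) auto
        then have "b / s \<le> b powr p / u" using s False by (simp add: powr_divide)
        then have "b \<le> s / u * b powr p" using s u by (simp add: field_simps)
        then show ?thesis using s by simp
      qed (use s u in \<open>auto intro: add_increasing2\<close>)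
      then have "ennreal b \<le> ennreal s + ennreal (s / u) * ennreal (b powr p)"
        using s u by (simp add: ennreal_mult'[symmetric] ennreal_plus[symmetric] del: ennreal_plus)
      then show ?thesis using real by (auto simp: epowr_ennreal indicator_def)
    next
      case top
      then show ?thesis using s u by (simp add: epowr_def ennreal_mult_top)
    qed
    have "(\<integral>\<^sup>+ y. S y * indicator \<Omega> y \<partial>\<mu>) \<le> (\<integral>\<^sup>+ y. ennreal s * indicator \<Omega> y + ennreal (s / u) * epowr (S y) p \<partial>\<mu>)"
      by (intro nn_integral_mono pt)
    also have "\<dots> = ennreal s * emeasure \<mu> \<Omega> + ennreal (s / u) * v"
      using S \<Omega> by (simp add: nn_integral_add nn_integral_cmult nn_integral_cmult_indicator v_def)
    also have "ennreal (s / u) * v = ennreal s" using u s by (simp add: ennreal_mult'[symmetric])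
    finally show ?thesis unfolding tS by (simp add: distrib_left)
  qed
qed

text \<open>
Minkowski's inequality: the length of a vector of integrals is at most the integral of the length. Every finite part of
the vector is paired with itself under the integral.
\<close>
lemma sum_square_integrals_le:
  fixes c :: "nat \<Rightarrow> real" and Q :: "nat \<Rightarrow> 'a set"
  assumes Q: "\<And>i. Q i \<in> sets \<mu>" and \<Omega>: "\<Omega> \<in> sets \<mu>" "emeasure \<mu> \<Omega> < \<infinity>"
  defines "S \<equiv> (\<lambda>y. epowr (\<Sum>i. ennreal ((c i)\<^sup>2 * indicator (Q i) y)) (1 / 2))"
  defines "R \<equiv> (\<integral>\<^sup>+ y. S y * indicator \<Omega> y \<partial>\<mu>)"
  shows "(\<Sum>i. ennreal ((c i * measure \<mu> (\<Omega> \<inter> Q i))\<^sup>2)) \<le> R * R"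
proof (rule suminf_le_const)
  fix n
  define b where "b = (\<lambda>i. \<bar>c i\<bar> * measure \<mu> (\<Omega> \<inter> Q i))"
  define V where "V = L2_set b {..<n}"
  have V0: "0 \<le> V" by (simp add: V_def)
  have V2: "(\<Sum>i<n. (b i)\<^sup>2) = V * V" by (simp add: V_def L2_set_def sum_nonneg flip: power2_eq_square)
  have m: "\<Omega> \<inter> Q i \<in> sets \<mu>" "emeasure \<mu> (\<Omega> \<inter> Q i) = ennreal (measure \<mu> (\<Omega> \<inter> Q i))" for i
  proof -
    show s: "\<Omega> \<inter> Q i \<in> sets \<mu>" using Q \<Omega> by auto
    have "emeasure \<mu> (\<Omega> \<inter> Q i) \<le> emeasure \<mu> \<Omega>" using \<Omega> by (intro emeasure_mono) auto
    then show "emeasure \<mu> (\<Omega> \<inter> Q i) = ennreal (measure \<mu> (\<Omega> \<inter> Q i))"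
      using \<Omega>(2) by (intro emeasure_eq_ennreal_measure) (auto simp: top_unique)
  qed
  have "ennreal V * ennreal V = ennreal (\<Sum>i<n. (b i)\<^sup>2)" using V0 V2 by (simp add: ennreal_mult')
  also have "\<dots> = (\<Sum>i<n. ennreal (b i * \<bar>c i\<bar>) * emeasure \<mu> (\<Omega> \<inter> Q i))"
    unfolding m(2) by (subst sum_ennreal[symmetric]) (auto simp: ennreal_mult'[symmetric] b_def power2_eq_square mult_ac)
  also have "\<dots> = (\<integral>\<^sup>+ y. (\<Sum>i<n. ennreal (b i * \<bar>c i\<bar>) * indicator (\<Omega> \<inter> Q i) y) \<partial>\<mu>)"
  proof (subst nn_integral_sum)
    show "(\<lambda>y. ennreal (b i * \<bar>c i\<bar>) * indicator (\<Omega> \<inter> Q i) y) \<in> borel_measurable \<mu>" for i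
      by (intro borel_measurable_times_ennreal borel_measurable_const borel_measurable_indicator m(1))
  qed (simp only: nn_integral_cmult_indicator[OF m(1)])
  also have "\<dots> \<le> (\<integral>\<^sup>+ y. ennreal V * (S y * indicator \<Omega> y) \<partial>\<mu>)"
  proof (rule nn_integral_mono)
    fix y
    show "(\<Sum>i<n. ennreal (b i * \<bar>c i\<bar>) * indicator (\<Omega> \<inter> Q i) y) \<le> ennreal V * (S y * indicator \<Omega> y)"
    proof (cases "y \<in> \<Omega>")
      case True
      define d where "d = (\<lambda>i. c i * indicator (Q i) y)"
      have "(\<Sum>i<n. ennreal (b i * \<bar>c i\<bar>) * indicator (\<Omega> \<inter> Q i) y) = (\<Sum>i<n. ennreal (\<bar>b i\<bar> * \<bar>d i\<bar>))"
        using True by (intro sum.cong) (auto simp: d_def indicator_def b_def)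
      also have "\<dots> = ennreal (\<Sum>i<n. \<bar>b i\<bar> * \<bar>d i\<bar>)" by (intro sum_ennreal) simp
      also have "\<dots> \<le> ennreal (V * L2_set d {..<n})"
        unfolding V_def by (intro ennreal_leI L2_set_mult_ineq)
      also have "\<dots> = ennreal V * ennreal (L2_set d {..<n})" using V0 by (simp add: ennreal_mult')
      also have "ennreal (L2_set d {..<n}) = epowr (\<Sum>i<n. ennreal ((d i)\<^sup>2)) (1 / 2)"
        by (simp add: L2_set_def sum_ennreal epowr_ennreal sum_nonneg powr_half_sqrt)
      also have "\<dots> \<le> epowr (\<Sum>i. ennreal ((d i)\<^sup>2)) (1 / 2)" by (intro epowr_mono sum_le_suminf) auto
      also have "\<dots> = S y" unfolding S_def d_def
        by (intro arg_cong2[of _ _ _ _ epowr] suminf_cong refl) (auto simp: indicator_def)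
      finally show ?thesis using True by (simp add: mult_left_mono)
    qed simp
  qed
  also have "\<dots> = ennreal V * R"
    unfolding R_def
  proof (rule nn_integral_cmult)
    show "(\<lambda>y. S y * indicator \<Omega> y) \<in> borel_measurable \<mu>" unfolding S_def using Q \<Omega> by measurable
  qed
  finally have "ennreal V * ennreal V \<le> ennreal V * R" .
  then have VR: "ennreal V \<le> R"
    using V0 by (cases "V = 0") (auto simp: ennreal_mult_le_mult_iff)
  have "(\<Sum>i<n. ennreal ((c i * measure \<mu> (\<Omega> \<inter> Q i))\<^sup>2)) = ennreal V * ennreal V"
    using V0 V2 by (simp add: ennreal_mult'[symmetric] b_def power_mult_distrib)
  also have "\<dots> \<le> R * R" by (intro mult_mono VR) auto
  finally show "(\<Sum>i<n. ennreal ((c i * measure \<mu> (\<Omega> \<inter> Q i))\<^sup>2)) \<le> R * R" .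
qed auto

text \<open>
An operator that on indicators is dominated by a multiple of the mass inside one fixed set of finite measure satisfies the testing
inequality: by Minkowski's inequality the left-hand side is a multiple of the integral of the square function over that set.
\<close>
lemma testing_of_local_bound:
  assumes p: "1 < p" and q: "1 < q" and \<mu>: "sets \<mu> = sets borel" and \<nu>: "sets \<nu> = sets borel"
    and D: "\<And>Q. Q \<in> dyadic_cubes D \<Longrightarrow> Q \<in> sets borel"
    and \<Omega>: "\<Omega> \<in> sets borel" "emeasure \<mu> \<Omega> < \<infinity>" "emeasure \<nu> \<Omega> < \<infinity>" and B: "0 \<le> B"
    and T: "\<And>Q x. Q \<in> dyadic_cubes D \<Longrightarrow> \<bar>T (indicator Q) x\<bar> \<le> B * indicator \<Omega> x * measure \<mu> (\<Omega> \<inter> Q)"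
  shows "\<exists>C>0. testing_bound D p q \<mu> \<nu> T (ennreal C)"
proof -
  define m where "m = measure \<mu> \<Omega> + 1"
  define k where "k = measure \<nu> \<Omega> powr (1 / q)"
  define C where "C = B * k * m + 1"
  have m: "emeasure \<mu> \<Omega> + 1 = ennreal m"
    using \<Omega>(2) by (simp add: m_def emeasure_eq_ennreal_measure ennreal_plus less_top)
  have m0: "m \<ge> 0" by (simp add: m_def)
  have C: "C > 0" using B by (simp add: C_def m0 k_def add_nonneg_pos)
  have "testing_bound D p q \<mu> \<nu> T (ennreal C)"
    unfolding testing_bound_def
  proof (intro allI impI)
    fix Q :: "nat \<Rightarrow> (real ^ 'a) set" and c :: "nat \<Rightarrow> real" assume Q: "\<forall>i. Q i \<in> dyadic_cubes D"
    have Qm: "Q i \<in> sets \<mu>" for i using Q D \<mu> by auto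
    define S where "S = (\<lambda>y. epowr (\<Sum>i. ennreal ((c i)\<^sup>2 * indicator (Q i) y)) (1 / 2))"
    define R where "R = (\<integral>\<^sup>+ y. S y * indicator \<Omega> y \<partial>\<mu>)"
    define t where "t = Lp_norm \<mu> p S"
    have Sm: "S \<in> borel_measurable \<mu>" unfolding S_def using Qm by measurable
    show "Lp_norm \<nu> q (\<lambda>x. epowr (\<Sum>i. ennreal ((c i * indicator (Q i) x * T (indicator (Q i)) x)\<^sup>2)) (1 / 2))
      \<le> ennreal C * Lp_norm \<mu> p (\<lambda>x. epowr (\<Sum>i. ennreal ((c i)\<^sup>2 * indicator (Q i) x)) (1 / 2))"
    proof (cases "t = \<infinity>")
      case True
      then show ?thesis using C by (simp add: t_def S_def ennreal_mult_top)
    next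
      case False
      then have t: "t < \<infinity>" by (simp add: less_top)
      have R: "R \<le> t * ennreal m"
        unfolding R_def t_def m[symmetric] using p \<Omega>(1) \<mu> t by (intro local_integral_le_Lp_norm Sm) (auto simp: t_def)
      have RR: "(\<Sum>i. ennreal ((c i * measure \<mu> (\<Omega> \<inter> Q i))\<^sup>2)) \<le> R * R"
        unfolding R_def S_def using \<Omega> \<mu> by (intro sum_square_integrals_le Qm) auto
      have pt: "epowr (\<Sum>i. ennreal ((c i * indicator (Q i) x * T (indicator (Q i)) x)\<^sup>2)) (1 / 2) \<le> ennreal B * R * indicator \<Omega> x" for x
      proof -
        have "(\<Sum>i. ennreal ((c i * indicator (Q i) x * T (indicator (Q i)) x)\<^sup>2))
          \<le> (\<Sum>i. ennreal ((B * indicator \<Omega> x)\<^sup>2) * ennreal ((c i * measure \<mu> (\<Omega> \<inter> Q i))\<^sup>2))"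
        proof (intro suminf_le)
          fix i
          have "\<bar>c i * indicator (Q i) x * T (indicator (Q i)) x\<bar> \<le> \<bar>c i\<bar> * (B * indicator \<Omega> x * measure \<mu> (\<Omega> \<inter> Q i))"
            using T[of "Q i" x] Q B by (auto simp: abs_mult indicator_def intro!: mult_left_mono)
          then have "(c i * indicator (Q i) x * T (indicator (Q i)) x)\<^sup>2 \<le> (\<bar>c i\<bar> * (B * indicator \<Omega> x * measure \<mu> (\<Omega> \<inter> Q i)))\<^sup>2"
            by (rule abs_le_square_iff[THEN iffD1, OF order_trans]) simp
          then have "(c i * indicator (Q i) x * T (indicator (Q i)) x)\<^sup>2 \<le> (B * indicator \<Omega> x)\<^sup>2 * (c i * measure \<mu> (\<Omega> \<inter> Q i))\<^sup>2"
            by (simp add: power_mult_distrib mult_ac)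
          then show "ennreal ((c i * indicator (Q i) x * T (indicator (Q i)) x)\<^sup>2)
            \<le> ennreal ((B * indicator \<Omega> x)\<^sup>2) * ennreal ((c i * measure \<mu> (\<Omega> \<inter> Q i))\<^sup>2)"
            by (simp add: ennreal_mult'[symmetric] ennreal_leI del: ennreal_mult')
        qed auto
        also have "\<dots> = ennreal ((B * indicator \<Omega> x)\<^sup>2) * (\<Sum>i. ennreal ((c i * measure \<mu> (\<Omega> \<inter> Q i))\<^sup>2))"
          by (rule ennreal_suminf_cmult)
        also have "\<dots> \<le> ennreal ((B * indicator \<Omega> x)\<^sup>2) * (R * R)" by (intro mult_left_mono RR) auto
        also have "\<dots> = (ennreal B * R * indicator \<Omega> x) * (ennreal B * R * indicator \<Omega> x)"
          using B by (auto simp: indicator_def power2_eq_square ennreal_mult' mult_ac)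
        finally have "epowr (\<Sum>i. ennreal ((c i * indicator (Q i) x * T (indicator (Q i)) x)\<^sup>2)) (1 / 2)
          \<le> epowr ((ennreal B * R * indicator \<Omega> x) * (ennreal B * R * indicator \<Omega> x)) (1 / 2)"
          by (intro epowr_mono) auto
        then show ?thesis unfolding epowr_half_square .
      qed
      define Z where "Z = ennreal B * R"
      have "t * ennreal m < \<infinity>" using t by (simp add: ennreal_mult_less_top)
      then have "R < \<infinity>" using R by (rule order.strict_trans1[rotated])
      then have Z: "Z < \<infinity>" by (simp add: Z_def ennreal_mult_less_top)
      then obtain z where z: "Z = ennreal z" "0 \<le> z" by (cases Z) auto
      have "Lp_norm \<nu> q (\<lambda>x. epowr (\<Sum>i. ennreal ((c i * indicator (Q i) x * T (indicator (Q i)) x)\<^sup>2)) (1 / 2))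
        \<le> Lp_norm \<nu> q (\<lambda>x. Z * indicator \<Omega> x)"
        unfolding Lp_norm_def using q pt by (intro epowr_mono nn_integral_mono) (auto simp: Z_def)
      also have "Lp_norm \<nu> q (\<lambda>x. Z * indicator \<Omega> x) = Z * ennreal k"
      proof -
        have "(\<integral>\<^sup>+ x. epowr (Z * indicator \<Omega> x) q \<partial>\<nu>) = (\<integral>\<^sup>+ x. ennreal (z powr q) * indicator \<Omega> x \<partial>\<nu>)"
          using z by (intro nn_integral_cong) (auto simp: indicator_def epowr_ennreal)
        also have "\<dots> = ennreal (z powr q) * emeasure \<nu> \<Omega>" using \<Omega> \<nu> by (intro nn_integral_cmult_indicator) auto
        also have "\<dots> = ennreal (z powr q * measure \<nu> \<Omega>)"
          using \<Omega>(3) by (simp add: emeasure_eq_ennreal_measure less_top ennreal_mult')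
        finally have e: "(\<integral>\<^sup>+ x. epowr (Z * indicator \<Omega> x) q \<partial>\<nu>) = ennreal (z powr q * measure \<nu> \<Omega>)" .
        have "Lp_norm \<nu> q (\<lambda>x. Z * indicator \<Omega> x) = ennreal ((z powr q * measure \<nu> \<Omega>) powr (1 / q))"
          unfolding Lp_norm_def e by (intro epowr_ennreal) simp
        also have "(z powr q * measure \<nu> \<Omega>) powr (1 / q) = z * k"
          using z q by (simp add: powr_mult powr_powr k_def)
        finally show ?thesis using z by (simp add: ennreal_mult')
      qed
      also have "\<dots> \<le> ennreal B * (t * ennreal m) * ennreal k"
        unfolding Z_def by (intro mult_right_mono mult_left_mono R) auto
      also have "\<dots> = ennreal (B * k * m) * t"
        using B m0 by (simp add: ennreal_mult' k_def mult_ac)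
      also have "\<dots> \<le> ennreal C * t"
        by (intro mult_right_mono ennreal_leI) (auto simp: C_def)
      finally show ?thesis by (simp add: t_def S_def)
    qed
  qed
  then show ?thesis using C by blast
qed

context shift_setup
begin

lemma active_region:
  assumes \<mu>: "radon_measure \<mu>"
  shows "\<Union>active \<in> sets \<mu>" "emeasure \<mu> (\<Union>active) < \<infinity>"
proof -
  have s: "K \<in> sets \<mu>" "emeasure \<mu> K < \<infinity>" if "K \<in> active" for K
    using that sets_radon[OF \<mu>] emeasure_radon[OF \<mu>] by (auto simp: active_def dyadic_cubes_def)
  show "\<Union>active \<in> sets \<mu>" using s finite_active by (intro sets.finite_Union) auto
  have "emeasure \<mu> (\<Union>K\<in>active. K) \<le> (\<Sum>K\<in>active. emeasure \<mu> K)"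
    using s finite_active by (intro emeasure_subadditive_finite) auto
  also have "\<dots> < \<infinity>" using s finite_active by simp
  finally show "emeasure \<mu> (\<Union>active) < \<infinity>" by simp
qed

text \<open>
A crude bound, with a constant that depends on the number of active cubes and of their descendants.
\<close>
lemma shift_op_indicator_le:
  assumes \<mu>: "radon_measure \<mu>" and Q: "Q \<in> sets borel"
  shows "\<bar>shift_op D m n a g h \<mu> (indicator Q) x\<bar>
    \<le> (\<Sum>K\<in>active. real (card (pairs K)) / vol K) * indicator (\<Union>active) x * measure \<mu> (\<Union>active \<inter> Q)"
proof -
  define \<Omega> where "\<Omega> = \<Union>active"
  have act: "\<exists>k. K \<in> D k" if "K \<in> active" for K using that by (auto simp: active_def dyadic_cubes_def)
  have sets: "sets \<mu> = sets borel" using \<mu> by (simp add: radon_measure_def)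
  have "\<bar>shift_block D m n a g h \<mu> K (indicator Q) x\<bar> \<le> real (card (pairs K)) / vol K * (indicator \<Omega> x * measure \<mu> (\<Omega> \<inter> Q))"
    if K: "K \<in> active" for K
  proof -
    obtain k where k: "K \<in> D k" using act[OF K] by auto
    have "\<bar>shift_block D m n a g h \<mu> K (indicator Q) x\<bar> \<le> (\<Sum>P\<in>pairs K. 1 / vol K * (indicator \<Omega> x * measure \<mu> (\<Omega> \<inter> Q)))"
      unfolding block_eq
    proof (intro order_trans[OF sum_abs] sum_mono)
      fix P assume "P \<in> pairs K"
      then obtain I J where P: "P = (I, J)" "(I, J) \<in> pairs K" by (cases P) auto
      note pd = pairsD[OF P(2) k]
      have sub: "I \<subseteq> \<Omega>" "J \<subseteq> \<Omega>" using pd(2,4) K by (auto simp: \<Omega>_def)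
      have IQ: "I \<inter> Q \<in> sets \<mu>" using borel[OF pd(1)] Q sets by auto
      have fin: "emeasure \<mu> \<Omega> < \<infinity>" "\<Omega> \<in> sets \<mu>"
        using active_region[OF \<mu>] by (auto simp: \<Omega>_def)
      have finI: "emeasure \<mu> (I \<inter> Q) < \<infinity>"
        using emeasure_mono[of "I \<inter> Q" I \<mu>] emeasure_radon[OF \<mu> pd(1)] sets_radon[OF \<mu> pd(1)] by (auto intro: order.strict_trans1)
      have "\<bar>pairing \<mu> (indicator Q) (g I J)\<bar> \<le> (LINT z|\<mu>. \<bar>indicator Q z * g I J z\<bar>)"
        unfolding pairing_def by (rule integral_abs_bound)
      also have "\<dots> \<le> (LINT z|\<mu>. vol I powr (- (1 / 2)) * indicator (I \<inter> Q) z)"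
      proof (rule integral_mono')
        show "integrable \<mu> (\<lambda>z. vol I powr (- (1 / 2)) * indicator (I \<inter> Q) z)"
          using IQ finI by (intro integrable_mult_right integrable_real_indicator)
        show "\<bar>indicator Q z * g I J z\<bar> \<le> vol I powr (- (1 / 2)) * indicator (I \<inter> Q) z" for z
          using haar_functionsD(2)[OF pd(5,1), of z] by (auto simp: indicator_def split: if_splits)
      qed auto
      also have "\<dots> = vol I powr (- (1 / 2)) * measure \<mu> (I \<inter> Q)"
        using sets.Int_space_eq2[OF IQ] by simp
      also have "\<dots> \<le> vol I powr (- (1 / 2)) * measure \<mu> (\<Omega> \<inter> Q)"
      proof (intro mult_left_mono measure_mono_fmeasurable)
        have "emeasure \<mu> (\<Omega> \<inter> Q) \<le> emeasure \<mu> \<Omega>" using fin by (intro emeasure_mono) auto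
        then show "\<Omega> \<inter> Q \<in> fmeasurable \<mu>" using fin Q sets by (intro fmeasurableI) (auto intro: order.strict_trans1)
      qed (use sub IQ in auto)
      finally have pr: "\<bar>pairing \<mu> (indicator Q) (g I J)\<bar> \<le> vol I powr (- (1 / 2)) * measure \<mu> (\<Omega> \<inter> Q)" .
      have v: "vol I > 0" "vol J > 0" "vol K > 0" using vol_pos pd k by auto
      have "\<bar>a I J K * pairing \<mu> (indicator Q) (g I J) * h I J x\<bar> = \<bar>a I J K\<bar> * \<bar>pairing \<mu> (indicator Q) (g I J)\<bar> * \<bar>h I J x\<bar>"
        by (simp add: abs_mult)
      also have "\<dots> \<le> sqrt (vol I * vol J) / vol K * (vol I powr (- (1 / 2)) * measure \<mu> (\<Omega> \<inter> Q)) * (vol J powr (- (1 / 2)) * indicator J x)"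
        using haar_functionsD(2)[OF pd(6,3), of x] pd(7) pr by (intro mult_mono mult_nonneg_nonneg) auto
      also have "\<dots> = 1 / vol K * (indicator J x * measure \<mu> (\<Omega> \<inter> Q))"
        using v by (simp add: powr_minus powr_half_sqrt real_sqrt_mult field_simps)
      also have "\<dots> \<le> 1 / vol K * (indicator \<Omega> x * measure \<mu> (\<Omega> \<inter> Q))"
        using sub(2) v by (intro mult_left_mono mult_right_mono) (auto simp: indicator_def)
      finally show "\<bar>case P of (I, J) \<Rightarrow> a I J K * pairing \<mu> (indicator Q) (g I J) * h I J x\<bar> \<le> 1 / vol K * (indicator \<Omega> x * measure \<mu> (\<Omega> \<inter> Q))"
        by (simp add: P)
    qed
    then show ?thesis by simp
  qed
  then have "\<bar>shift_op D m n a g h \<mu> (indicator Q) x\<bar> \<le> (\<Sum>K\<in>active. real (card (pairs K)) / vol K * (indicator \<Omega> x * measure \<mu> (\<Omega> \<inter> Q)))"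
    unfolding shift_op_eq by (rule order_trans[OF sum_abs sum_mono])
  then show ?thesis unfolding \<Omega>_def sum_distrib_right[symmetric] by (simp add: mult.assoc)
qed

lemma testing_finite:
  assumes \<mu>: "radon_measure \<mu>" and \<nu>: "radon_measure \<nu>" and p: "1 < p" and q: "1 < q"
  shows "\<exists>C>0. testing_bound D p q \<mu> \<nu> (shift_op D m n a g h \<mu>) (ennreal C)"
proof (rule testing_of_local_bound[OF p q])
  show sets: "sets \<mu> = sets borel" "sets \<nu> = sets borel" using \<mu> \<nu> by (auto simp: radon_measure_def)
  show b: "Q \<in> sets borel" if "Q \<in> dyadic_cubes D" for Q using that borel by (auto simp: dyadic_cubes_def)
  show "\<Union>active \<in> sets borel" using active_region(1)[OF \<mu>] by (simp add: sets)
  show "emeasure \<mu> (\<Union>active) < \<infinity>" "emeasure \<nu> (\<Union>active) < \<infinity>" using active_region(2) \<mu> \<nu> by auto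
  show "0 \<le> (\<Sum>K\<in>active. real (card (pairs K)) / vol K)" by (intro sum_nonneg) simp
  show "\<bar>shift_op D m n a g h \<mu> (indicator Q) x\<bar>
    \<le> (\<Sum>K\<in>active. real (card (pairs K)) / vol K) * indicator (\<Union>active) x * measure \<mu> (\<Union>active \<inter> Q)"
    if "Q \<in> dyadic_cubes D" for Q x using that by (intro shift_op_indicator_le \<mu> b)
qed

lemma finite_model_exists: "\<exists>k0 Kn. finite_model D m n a g h k0 Kn"
proof -
  have "\<exists>k. \<forall>K\<in>active. K \<in> D (k K)"
    by (rule bchoice) (auto simp: active_def dyadic_cubes_def)
  then obtain k where k: "\<And>K. K \<in> active \<Longrightarrow> K \<in> D (k K)" by blast
  obtain N where N: "\<And>K. K \<in> active \<Longrightarrow> \<bar>k K\<bar> \<le> N"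
    using finite_active by (metis (no_types, lifting) Max_ge finite_imageI imageI)
  \<comment> \<open>The generations \<open>- N, \<dots>, N\<close> become the levels \<open>1, \<dots>, 2 N + 1\<close>.\<close>
  have "finite_model D m n a g h (- N) (nat (2 * N + 1))"
  proof
    fix K assume K: "K \<in> active"
    then have "\<bar>k K\<bar> \<le> N" by (rule N)
    then have "nat (k K + N + 1) \<in> {1..nat (2 * N + 1)}" "- N + int (nat (k K + N + 1)) - 1 = k K" by auto
    then show "\<exists>i\<in>{1..nat (2 * N + 1)}. K \<in> D (- N + int i - 1)" using k[OF K] by metis
  qed
  then show ?thesis by blast
qed

end

lemma holder_conj_gt: "1 < p \<Longrightarrow> 1 < holder_conj p"
  by (simp add: holder_conj_def)

lemma quadratic_Apq_bound_mono:
  "quadratic_Apq_bound D p q \<sigma> w x \<Longrightarrow> x \<le> y \<Longrightarrow> quadratic_Apq_bound D p q \<sigma> w y"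
  unfolding quadratic_Apq_bound_def by (meson mult_right_mono order_trans zero_le)

lemma testing_bound_mono:
  "testing_bound D p q \<sigma> w T x \<Longrightarrow> x \<le> y \<Longrightarrow> testing_bound D p q \<sigma> w T y"
  unfolding testing_bound_def by (meson mult_right_mono order_trans zero_le)

text \<open>
Best constants are infima that need not be attained, so the estimates are used slightly above them.
\<close>
lemma bound_above_Inf:
  fixes P :: "ennreal \<Rightarrow> bool"
  assumes "\<And>x y. P x \<Longrightarrow> x \<le> y \<Longrightarrow> P y" "Inf {C. P C} < \<infinity>" "0 < e"
  shows "P (ennreal (enn2real (Inf {C. P C}) + e))"
proof -
  have "Inf {C. P C} = ennreal (enn2real (Inf {C. P C}))" using assms(2) by simp
  also have "\<dots> < ennreal (enn2real (Inf {C. P C}) + e)" using assms(3) by (intro ennreal_lessI) (auto simp: add_nonneg_pos)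
  finally obtain x where "P x" "x < ennreal (enn2real (Inf {C. P C}) + e)" by (auto simp: Inf_less_iff)
  then show ?thesis using assms(1) less_imp_le by blast
qed

text \<open>
All three inequalities hold with finite constants; the bound for the best constants follows from the estimates slightly above
them by letting the excess \<open>e\<close> tend to zero.
\<close>
theorem (in shift_setup) two_weight_shift_bounds:
  assumes p: "1 < p" and q: "1 < q" and \<sigma>: "radon_measure \<sigma>" and w: "radon_measure w"
    and Apq: "quadratic_Apq D p q \<sigma> w < \<infinity>" and \<kappa>: "\<kappa> = max m n"
  defines "T \<equiv> best_testing D p q \<sigma> w (shift_op D m n a g h \<sigma>)"
    and "T' \<equiv> best_testing D (holder_conj q) (holder_conj p) w \<sigma> (adjoint_op D m n a g h w)"
  shows "\<exists>C::real. norm_bound p q \<sigma> w (shift_op D m n a g h \<sigma>) (ennreal C)"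
    and "\<exists>C::real. testing_bound D p q \<sigma> w (shift_op D m n a g h \<sigma>) (ennreal C)"
    and "\<exists>C::real. testing_bound D (holder_conj q) (holder_conj p) w \<sigma> (adjoint_op D m n a g h w) (ennreal C)"
    and "best_norm p q \<sigma> w (shift_op D m n a g h \<sigma>) \<le> ennreal (shift_const p q) *
      (ennreal (1 + real \<kappa>) * (T + T') + ennreal ((1 + real \<kappa>)\<^sup>2) * quadratic_Apq D p q \<sigma> w)"
proof -
  interpret sw: shift_setup D n m swap_a swap_h swap_g by (rule swap_shift)
  obtain C1 where C1: "testing_bound D p q \<sigma> w (shift_op D m n a g h \<sigma>) (ennreal C1)"
    using testing_finite[OF \<sigma> w p q] by blast
  obtain C2 where C2: "testing_bound D (holder_conj q) (holder_conj p) w \<sigma> (adjoint_op D m n a g h w) (ennreal C2)"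
    using sw.testing_finite[OF w \<sigma> holder_conj_gt[OF q] holder_conj_gt[OF p]] unfolding adjoint_op_eq by blast
  show "\<exists>C::real. testing_bound D p q \<sigma> w (shift_op D m n a g h \<sigma>) (ennreal C)" using C1 by blast
  show "\<exists>C::real. testing_bound D (holder_conj q) (holder_conj p) w \<sigma> (adjoint_op D m n a g h w) (ennreal C)" using C2 by blast
  obtain k0 Kn where "finite_model D m n a g h k0 Kn" using finite_model_exists by blast
  then interpret M: finite_model D m n a g h k0 Kn .
  have "T \<le> ennreal C1" "T' \<le> ennreal C2"
    unfolding T_def T'_def best_testing_def using C1 C2 by (auto intro!: Inf_lower)
  then have fin: "T < \<infinity>" "T' < \<infinity>" by (auto intro: order.strict_trans1)
  define t where "t = enn2real T"
  define t' where "t' = enn2real T'"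
  define A where "A = enn2real (quadratic_Apq D p q \<sigma> w)"
  have nn: "0 \<le> t" "0 \<le> t'" "0 \<le> A" by (auto simp: t_def t'_def A_def)
  have eqs: "T = ennreal t" "T' = ennreal t'" "quadratic_Apq D p q \<sigma> w = ennreal A"
    using fin Apq by (auto simp: t_def t'_def A_def)
  define R where "R = 1 + real \<kappa>"
  have R: "R \<ge> 1" by (simp add: R_def)
  define c where "c = shift_const p q"
  have c: "c > 0" by (simp add: c_def shift_const_pos)
  have bound: "norm_bound p q \<sigma> w (shift_op D m n a g h \<sigma>) (ennreal (c * (R * ((t + e) + (t' + e)) + R\<^sup>2 * (A + e))))"
    if e: "0 < e" for e
    unfolding c_def R_def \<kappa>
  proof (rule M.norm_bound_shift[OF \<sigma> w p q])
    show "quadratic_Apq_bound D p q \<sigma> w (ennreal (A + e))"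
      unfolding A_def quadratic_Apq_def
      by (rule bound_above_Inf[OF quadratic_Apq_bound_mono Apq[unfolded quadratic_Apq_def] e])
    show "testing_bound D p q \<sigma> w (shift_op D m n a g h \<sigma>) (ennreal (t + e))"
      unfolding t_def T_def best_testing_def
      by (rule bound_above_Inf[OF testing_bound_mono fin(1)[unfolded T_def best_testing_def] e])
    show "testing_bound D (holder_conj q) (holder_conj p) w \<sigma> (adjoint_op D m n a g h w) (ennreal (t' + e))"
      unfolding t'_def T'_def best_testing_def
      by (rule bound_above_Inf[OF testing_bound_mono fin(2)[unfolded T'_def best_testing_def] e])
  qed (use nn e in auto)
  show "\<exists>C::real. norm_bound p q \<sigma> w (shift_op D m n a g h \<sigma>) (ennreal C)" using bound[of 1] by auto
  have "best_norm p q \<sigma> w (shift_op D m n a g h \<sigma>) \<le> ennreal (c * (R * (t + t') + R\<^sup>2 * A))"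
  proof (rule ennreal_le_epsilon)
    fix e :: real assume e: "0 < e"
    define d where "d = c * (2 * R + R\<^sup>2)"
    have d: "d > 0" using c R by (simp add: d_def add_pos_pos)
    have "best_norm p q \<sigma> w (shift_op D m n a g h \<sigma>) \<le> ennreal (c * (R * ((t + e / d) + (t' + e / d)) + R\<^sup>2 * (A + e / d)))"
      unfolding best_norm_def using bound[of "e / d"] e d by (intro Inf_lower) simp
    also have "c * (R * ((t + e / d) + (t' + e / d)) + R\<^sup>2 * (A + e / d)) = c * (R * (t + t') + R\<^sup>2 * A) + d * (e / d)"
    proof -
      have "c * (R * ((t + s) + (t' + s)) + R\<^sup>2 * (A + s)) = c * (R * (t + t') + R\<^sup>2 * A) + (c * (2 * R + R\<^sup>2)) * s" for s
        by (simp add: algebra_simps)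
      then show ?thesis unfolding d_def by blast
    qed
    also have "d * (e / d) = e" using d by simp
    also have "ennreal (c * (R * (t + t') + R\<^sup>2 * A) + e) = ennreal (c * (R * (t + t') + R\<^sup>2 * A)) + ennreal e"
      using c R nn e by (intro ennreal_plus) auto
    finally show "best_norm p q \<sigma> w (shift_op D m n a g h \<sigma>) \<le> ennreal (c * (R * (t + t') + R\<^sup>2 * A)) + ennreal e" .
  qed
  also have "\<dots> = ennreal c * (ennreal R * (T + T') + ennreal (R\<^sup>2) * quadratic_Apq D p q \<sigma> w)"
    unfolding eqs using c R nn by (simp add: ennreal_mult' ennreal_plus)
  finally show "best_norm p q \<sigma> w (shift_op D m n a g h \<sigma>) \<le> ennreal (shift_const p q) *
      (ennreal (1 + real \<kappa>) * (T + T') + ennreal ((1 + real \<kappa>)\<^sup>2) * quadratic_Apq D p q \<sigma> w)"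
    by (simp add: c_def R_def)
qed

theorem theorem1p1:
  fixes p q :: real
  assumes "1 < p" and "1 < q"
  shows "\<exists>c::real. c > 0 \<and>
    (\<forall>(D :: int \<Rightarrow> (real ^ 'n::finite) set set) (\<sigma> :: (real ^ 'n) measure) (w :: (real ^ 'n) measure)
       (m :: nat) (n :: nat) (\<kappa> :: nat)
       (a :: (real ^ 'n) set \<Rightarrow> (real ^ 'n) set \<Rightarrow> (real ^ 'n) set \<Rightarrow> real)
       (g :: (real ^ 'n) set \<Rightarrow> (real ^ 'n) set \<Rightarrow> real ^ 'n \<Rightarrow> real)
       (h :: (real ^ 'n) set \<Rightarrow> (real ^ 'n) set \<Rightarrow> real ^ 'n \<Rightarrow> real).
       dyadic_lattice D \<and> radon_measure \<sigma> \<and> radon_measure w \<and>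
       quadratic_Apq D p q \<sigma> w < \<infinity> \<and>
       dyadic_shift D m n a g h \<and> \<kappa> = max m n \<longrightarrow>
       ((\<exists>C::real. norm_bound p q \<sigma> w (shift_op D m n a g h \<sigma>) (ennreal C)) \<longleftrightarrow>
        (\<exists>C' C''::real.
           testing_bound D p q \<sigma> w (shift_op D m n a g h \<sigma>) (ennreal C') \<and>
           testing_bound D (holder_conj q) (holder_conj p) w \<sigma>
             (adjoint_op D m n a g h w) (ennreal C''))) \<and>
       best_norm p q \<sigma> w (shift_op D m n a g h \<sigma>) \<le>
         ennreal c *
         (ennreal (1 + real \<kappa>) *
            (best_testing D p q \<sigma> w (shift_op D m n a g h \<sigma>) +
             best_testing D (holder_conj q) (holder_conj p) w \<sigma> (adjoint_op D m n a g h w)) +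
          ennreal ((1 + real \<kappa>)\<^sup>2) * quadratic_Apq D p q \<sigma> w))"
proof (intro exI conjI allI impI)
  show "0 < shift_const p q" by (rule shift_const_pos)
next
  fix D :: "int \<Rightarrow> (real ^ 'n) set set" and \<sigma> w :: "(real ^ 'n) measure" and m n \<kappa> :: nat
    and a :: "(real ^ 'n) set \<Rightarrow> (real ^ 'n) set \<Rightarrow> (real ^ 'n) set \<Rightarrow> real"
    and g h :: "(real ^ 'n) set \<Rightarrow> (real ^ 'n) set \<Rightarrow> real ^ 'n \<Rightarrow> real"
  assume H: "dyadic_lattice D \<and> radon_measure \<sigma> \<and> radon_measure w \<and> quadratic_Apq D p q \<sigma> w < \<infinity> \<and>
    dyadic_shift D m n a g h \<and> \<kappa> = max m n"
  then interpret shift_setup D m n a g h by unfold_locales auto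
  have H': "radon_measure \<sigma>" "radon_measure w" "quadratic_Apq D p q \<sigma> w < \<infinity>" "\<kappa> = max m n" using H by auto
  note bounds = two_weight_shift_bounds[OF assms H']
  show "(\<exists>C::real. norm_bound p q \<sigma> w (shift_op D m n a g h \<sigma>) (ennreal C)) \<longleftrightarrow>
        (\<exists>C' C''::real. testing_bound D p q \<sigma> w (shift_op D m n a g h \<sigma>) (ennreal C') \<and>
           testing_bound D (holder_conj q) (holder_conj p) w \<sigma> (adjoint_op D m n a g h w) (ennreal C''))"
    using bounds(1-3) by blast
  show "best_norm p q \<sigma> w (shift_op D m n a g h \<sigma>) \<le> ennreal (shift_const p q) *
         (ennreal (1 + real \<kappa>) * (best_testing D p q \<sigma> w (shift_op D m n a g h \<sigma>) +
             best_testing D (holder_conj q) (holder_conj p) w \<sigma> (adjoint_op D m n a g h w)) +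
          ennreal ((1 + real \<kappa>)\<^sup>2) * quadratic_Apq D p q \<sigma> w)"
    by (rule bounds(4))
qed

end
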